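(* Let $\epsilon>0$, let $E(x,t)=(4\pi t)^{-3/2}e^{-|x|^2/(4t)}$ be the heat kernel in $\mathbb{R}^3$, and for $\eta>0$ let $$u_0(x)=\eta\begin{pmatrix}-\partial_2^2E(x,1)\\ \partial_1\partial_2E(x,1)\\ 0\end{pmatrix},\qquad x\in\mathbb{R}^3.$$ If $\eta>0$ is small enough, then the solution $u^\epsilon$, starting from $u_0$, of $$\partial_tu^\epsilon-\Delta u^\epsilon+u^\epsilon\cdot\nabla u^\epsilon+\tfrac12u^\epsilon\,\mathrm{div}(u^\epsilon)-\tfrac1\epsilon\nabla\,\mathrm{div}(u^\epsilon)=0\quad\text{in }\mathbb{R}^3\times(0,\infty)$$ satisfies $$\vec\lambda_\epsilon=\lim_{t\to\infty}\int_{\mathbb{R}^3}u^\epsilon(x,t)\,dx\neq0;$$ indeed, the first component of $\vec\lambda_\epsilon$ is strictly positive.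
   Context: The solution is understood in mild form: $u^\epsilon(t)=M_\epsilon(t)u_0-\int_0^tM_\epsilon(t-s)[u^\epsilon\cdot\nabla u^\epsilon+\frac12u^\epsilon\,\mathrm{div}\,u^\epsilon](s)\,ds$, where $M_\epsilon(t)$ is the Fourier multiplier with matrix symbol $(\widehat M_\epsilon(\xi,t))_{k,l}=e^{-t|\xi|^2}\bigl(\delta_{k,l}-\frac{\xi_k\xi_l}{|\xi|^2}(1-e^{-t|\xi|^2/\epsilon})\bigr)$. For small $\eta$, $u^\epsilon$ is the solution that is unique in a small ball centred at $0$ of the Banach space $\mathcal F$ of functions $f\in L^\infty([0,\infty),L^1(\mathbb{R}^3))$ with finite norm $$\|f\|_{\mathcal F}=\sup_{t>0}\|f(t)\|_1+\sup_{t>0}\sqrt t\,\|\nabla f(t)\|_1+\sup_{t>0}(1+t)^{3/2}\|f(t)\|_\infty+\sup_{t>0}\sqrt t\,(1+t)^{3/2}\|\nabla f(t)\|_\infty.$$ *)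

theory Defs
  imports "HOL-Analysis.Analysis" "HOL-Probability.Essential_Supremum"
begin

definition heat_kernel :: "real \<Rightarrow> real^3 \<Rightarrow> real" where
  "heat_kernel t x = (4 * pi * t) powr (-3/2) * exp (- (norm x)\<^sup>2 / (4 * t))"

definition partial :: "3 \<Rightarrow> (real^3 \<Rightarrow> real) \<Rightarrow> real^3 \<Rightarrow> real" where
  "partial j f x = deriv (\<lambda>h. f (x + h *\<^sub>R axis j 1)) 0"

definition initial_field :: "real \<Rightarrow> real^3 \<Rightarrow> real^3" where
  "initial_field \<eta> x = \<eta> *\<^sub>R vector
     [- partial 2 (partial 2 (heat_kernel 1)) x, partial 1 (partial 2 (heat_kernel 1)) x, 0]"

definition fourier :: "(real^3 \<Rightarrow> real) \<Rightarrow> real^3 \<Rightarrow> complex" where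
  "fourier f \<xi> = (LINT x|lborel. exp (- \<i> * of_real (\<xi> \<bullet> x)) * of_real (f x))"

definition symbol :: "real \<Rightarrow> real \<Rightarrow> real^3 \<Rightarrow> real^3^3" where
  "symbol \<epsilon> t \<xi> = (\<chi> k l. exp (- t * (norm \<xi>)\<^sup>2) *
     ((if k = l then 1 else 0)
       - \<xi> $ k * \<xi> $ l / (norm \<xi>)\<^sup>2 * (1 - exp (- t * (norm \<xi>)\<^sup>2 / \<epsilon>))))"

text \<open>The Fourier multiplier acting on integrable fields, for \<open>t > 0\<close> only: the symbol then decays
  like a Gaussian, so the inverse Fourier integral converges absolutely at every point. Since the
  symbol is real and even, that integral is already real and \<open>Re\<close> only adjusts the type.\<close>

definition multiplier :: "real \<Rightarrow> real \<Rightarrow> (real^3 \<Rightarrow> real^3) \<Rightarrow> real^3 \<Rightarrow> real^3" where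
  "multiplier \<epsilon> t f x = (\<chi> k. Re ((LINT \<xi>|lborel. exp (\<i> * of_real (\<xi> \<bullet> x)) *
     (\<Sum>l\<in>UNIV. of_real (symbol \<epsilon> t \<xi> $ k $ l) * fourier (\<lambda>y. f y $ l) \<xi>)) / of_real ((2 * pi) ^ 3)))"

definition test_function :: "(real^3 \<Rightarrow> real) \<Rightarrow> bool" where
  "test_function \<phi> \<longleftrightarrow>
     (\<forall>js x. foldr partial js \<phi> differentiable (at x)) \<and> compact (closure {x. \<phi> x \<noteq> 0})"

text \<open>\<open>J x $ i $ j\<close> is the distributional derivative of \<open>f\<^sub>i\<close> in direction \<open>j\<close>; it is unique
  up to null sets.\<close>

definition weak_jacobian :: "(real^3 \<Rightarrow> real^3) \<Rightarrow> (real^3 \<Rightarrow> real^3^3) \<Rightarrow> bool" where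
  "weak_jacobian f J \<longleftrightarrow> integrable lborel f \<and> integrable lborel J \<and>
     (\<forall>\<phi> i j. test_function \<phi> \<longrightarrow>
        (LINT x|lborel. f x $ i * partial j \<phi> x) = - (LINT x|lborel. J x $ i $ j * \<phi> x))"

definition L1_norm :: "(real^3 \<Rightarrow> 'b::real_normed_vector) \<Rightarrow> ennreal" where
  "L1_norm f = (\<integral>\<^sup>+x. ennreal (norm (f x)) \<partial>lborel)"

definition Linf_norm :: "(real^3 \<Rightarrow> 'b::real_normed_vector) \<Rightarrow> ennreal" where
  "Linf_norm f = esssup lborel (\<lambda>x. ennreal (norm (f x)))"

text \<open>A member of \<open>\<F>\<close> is given by a representative \<open>u\<close> together with its spatial weak Jacobian \<open>J\<close>,
  both jointly measurable in time and space (every strongly measurable function of time with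
  values in \<open>L\<^sup>1\<close> has such a representative).\<close>

definition F_norm :: "(real \<Rightarrow> real^3 \<Rightarrow> real^3) \<Rightarrow> (real \<Rightarrow> real^3 \<Rightarrow> real^3^3) \<Rightarrow> ennreal" where
  "F_norm u J =
     (SUP t\<in>{0<..}. L1_norm (u t))
   + (SUP t\<in>{0<..}. ennreal (sqrt t) * L1_norm (J t))
   + (SUP t\<in>{0<..}. ennreal ((1 + t) powr (3/2)) * Linf_norm (u t))
   + (SUP t\<in>{0<..}. ennreal (sqrt t * (1 + t) powr (3/2)) * Linf_norm (J t))"

definition F_member :: "(real \<Rightarrow> real^3 \<Rightarrow> real^3) \<Rightarrow> (real \<Rightarrow> real^3 \<Rightarrow> real^3^3) \<Rightarrow> bool" where
  "F_member u J \<longleftrightarrow>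
     (\<lambda>(t, x). u t x) \<in> borel_measurable (restrict_space borel {0<..} \<Otimes>\<^sub>M borel) \<and>
     (\<lambda>(t, x). J t x) \<in> borel_measurable (restrict_space borel {0<..} \<Otimes>\<^sub>M borel) \<and>
     (\<forall>t>0. weak_jacobian (u t) (J t)) \<and> F_norm u J < \<infinity>"

definition nonlinearity :: "(real^3 \<Rightarrow> real^3) \<Rightarrow> (real^3 \<Rightarrow> real^3^3) \<Rightarrow> real^3 \<Rightarrow> real^3" where
  "nonlinearity f J x = J x *v f x + (1/2 * trace (J x)) *\<^sub>R f x"

text \<open>At \<open>t = 0\<close> the multiplier is the identity, so the mild formula reads \<open>u 0 = u0\<close>. For members
  of \<open>\<F>\<close> the time integral converges absolutely at every point \<open>x\<close>.\<close>

definition mild_solution ::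
  "real \<Rightarrow> (real^3 \<Rightarrow> real^3) \<Rightarrow> (real \<Rightarrow> real^3 \<Rightarrow> real^3) \<Rightarrow> (real \<Rightarrow> real^3 \<Rightarrow> real^3^3) \<Rightarrow> bool" where
  "mild_solution \<epsilon> u0 u J \<longleftrightarrow>
     (AE x in lborel. u 0 x = u0 x) \<and>
     (\<forall>t>0. AE x in lborel. u t x = multiplier \<epsilon> t u0 x
        - (LINT s:{0<..<t}|lborel. multiplier \<epsilon> (t - s) (nonlinearity (u s) (J s)) x))"

definition mild_solution_in_ball ::
  "real \<Rightarrow> (real^3 \<Rightarrow> real^3) \<Rightarrow> real \<Rightarrow> (real \<Rightarrow> real^3 \<Rightarrow> real^3) \<Rightarrow> bool" where
  "mild_solution_in_ball \<epsilon> u0 r u \<longleftrightarrow>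
     (\<exists>J. F_member u J \<and> F_norm u J \<le> ennreal r \<and> mild_solution \<epsilon> u0 u J)"

end

theory Submission
  imports Defs "HOL-Probability.Probability"
begin

text \<open>The symbol is a Gaussian minus an average of Gaussians times \<open>\<xi>\<^sub>k \<xi>\<^sub>l\<close>, so the multiplier is the
  convolution with a kernel that, like its gradient, is dominated by a heat kernel with the parabolic
  scaling in time. The bilinear Duhamel term is then bounded on \<open>\<F>\<close>, and Picard iteration gives the
  solution; weak Jacobians are unique, so every mild solution in a small ball solves the same fixed point
  problem for the pair (field, Jacobian).

  The kernel has integral \<open>I\<close> and the initial field has integral \<open>0\<close>, hence
  \<open>\<lambda> = - \<integral>\<integral> (u \<cdot> \<nabla>u + u div u / 2) dx dt\<close>. The linear evolution \<open>\<eta> u\<^sub>1\<close> of the initial field is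
  divergence-free, so the term of order \<open>\<eta>\<^sup>2\<close> vanishes. In the term of order \<open>\<eta>\<^sup>3\<close> an integration by
  parts, done on the Fourier side, leaves only the divergence of the kernel, which is the gradient of the
  heat kernel at time \<open>c (t - s)\<close>, \<open>c = 1 + 1/\<epsilon>\<close>. The semigroup property reduces the coefficient to
  \<open>- 1/2 \<integral>\<integral>\<integral> (u\<^sub>1 \<cdot> \<nabla>u\<^sub>1)(y, s) \<cdot> \<nabla>\<partial>\<^sub>2\<^sup>2 E(y, T) dy ds dt\<close> over \<open>0 < s < t\<close>, with
  \<open>T = 1 + t + c (t - s) > 1 + s\<close>. The inner integral is a Gaussian moment and is negative exactly
  because \<open>T > 1 + s\<close>.\<close>

subsection \<open>Integrals over Euclidean space\<close>

text \<open>The Jacobian is treated as a second unknown. The definition of a mild solution only asks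
  for some weak Jacobian, so the fixed-point problem is posed for the pair, its second component
  being driven by the differentiated kernel; that this component is the Jacobian of the first is
  checked afterwards by testing. The parameter enters only through \<open>c\<close>: the gradient
  part of a field diffuses with coefficient \<open>c = 1 + 1/\<epsilon>\<close>, the divergence-free
  part with coefficient \<open>1\<close>. The linear flow is of the second kind, hence free of
  \<epsilon>, and the sign rests on \<open>T > 1 + s\<close>, which holds for every \<epsilon> > 0.
  The admissible size of \<eta> depends on \<epsilon> through the operator bounds. Orders one and
  two contribute nothing to the first component of the limit. Once the second Picard term is split
  off, the remainder is of order \<open>\<eta>^4\<close>, uniformly in time since the weight
  \<open>tw\<close> is integrable over the half-line. Derivatives of the heat kernel factor into
  functions of one coordinate, so their transforms, bounds and moments are one-dimensional
  computations.\<close>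

lemma
  fixes f :: "'n::finite \<Rightarrow> real \<Rightarrow> 'b::{real_normed_field,banach,second_countable_topology}"
  assumes f: "\<And>k. integrable lborel (f k)"
  shows integrable_prod_vec: "integrable lborel (\<lambda>x::real^'n. \<Prod>k\<in>UNIV. f k (x $ k))"
    and integral_prod_vec:
      "(LINT x::real^'n|lborel. (\<Prod>k\<in>UNIV. f k (x $ k))) = (\<Prod>k\<in>UNIV. (LINT x|lborel. f k x))"
proof -
  interpret product_sigma_finite "\<lambda>_::real^'n. lborel :: real measure"
    by standard
  let ?B = "Basis :: (real^'n) set"
  let ?T = "\<lambda>h. \<Sum>b\<in>?B. h b *\<^sub>R b :: real^'n"
  \<comment> \<open>Lebesgue measure on \<open>real^'n\<close> is the image of a product measure
    indexed by basis vectors; \<open>g\<close> carries the family from coordinates to basis vectors,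
    \<open>k\<close> going to \<open>axis k 1\<close>.\<close>
  define g where "g b = f (THE k. b = axis k 1)" for b :: "real^'n"
  have B: "?B = (\<lambda>k. axis k 1) ` UNIV"
    by (auto simp: Basis_vec_def)
  have inj: "inj_on (\<lambda>k::'n. axis k (1::real)) UNIV"
    by (auto simp: inj_on_def axis_eq_axis)
  have g_axis [simp]: "g (axis k 1) = f k" for k
    by (simp add: g_def axis_eq_axis)
  have T_nth: "?T h $ k = h (axis k 1)" for h k
  proof -
    have "?T h $ k = ?T h \<bullet> axis k 1" by (simp add: inner_axis)
    also have "\<dots> = h (axis k 1)"
      by (subst inner_sum_left_Basis) (auto simp: B)
    finally show ?thesis .
  qed
  have prod: "(\<Prod>b\<in>?B. g b (h b)) = (\<Prod>k\<in>UNIV. f k (?T h $ k))" for h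
    unfolding T_nth by (subst B, subst prod.reindex[OF inj]) simp
  have meas [measurable]: "f k \<in> borel_measurable borel" for k
    using f[of k] by (simp add: integrable_iff_bounded)
  have gi: "integrable lborel (g b)" if "b \<in> ?B" for b
    using that f by (auto simp: B)
  have *: "(\<lambda>x::real^'n. \<Prod>k\<in>UNIV. f k (x $ k)) \<in> borel_measurable borel"
    by measurable
  have T: "?T \<in> measurable (\<Pi>\<^sub>M b\<in>?B. lborel) borel" by measurable
  have "integrable (\<Pi>\<^sub>M b\<in>?B. lborel) (\<lambda>h. \<Prod>b\<in>?B. g b (h b))"
    by (rule product_integrable_prod) (auto intro: gi)
  then show "integrable lborel (\<lambda>x::real^'n. \<Prod>k\<in>UNIV. f k (x $ k))"
    unfolding lborel_eq[where 'a="real^'n"] prod by (subst integrable_distr_eq[OF T *])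
  have "(LINT x::real^'n|lborel. (\<Prod>k\<in>UNIV. f k (x $ k))) = (LINT h|(\<Pi>\<^sub>M b\<in>?B. lborel). (\<Prod>b\<in>?B. g b (h b)))"
    unfolding lborel_eq[where 'a="real^'n"] prod by (subst integral_distr[OF T *]) simp
  also have "\<dots> = (\<Prod>b\<in>?B. (LINT x|lborel. g b x))"
    by (rule product_integral_prod) (auto intro: gi)
  also have "\<dots> = (\<Prod>k\<in>UNIV. (LINT x|lborel. f k x))"
    by (subst B, subst prod.reindex[OF inj]) simp
  finally show "(LINT x::real^'n|lborel. (\<Prod>k\<in>UNIV. f k (x $ k))) = (\<Prod>k\<in>UNIV. (LINT x|lborel. f k x))" .
qed

lemma nn_integral_lborel_translation:
  fixes f :: "'a::euclidean_space \<Rightarrow> ennreal"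
  assumes [measurable]: "f \<in> borel_measurable borel"
  shows "(\<integral>\<^sup>+x. f (x + a) \<partial>lborel) = (\<integral>\<^sup>+x. f x \<partial>lborel)"
proof -
  have "(\<integral>\<^sup>+x. f (x + a) \<partial>lborel) = (\<integral>\<^sup>+x. f x \<partial>distr lborel borel ((+) a))"
    by (subst nn_integral_distr) (auto simp: add.commute)
  then show ?thesis by (simp add: lborel_distr_plus)
qed

lemma
  fixes f :: "'a::euclidean_space \<Rightarrow> 'b::{banach,second_countable_topology}"
  shows integral_lborel_translation: "(LINT x|lborel. f (x + a)) = (LINT x|lborel. f x)"
    and integrable_lborel_translation: "integrable lborel (\<lambda>x. f (x + a)) \<longleftrightarrow> integrable lborel f"
proof -
  have *: "integrable lborel (\<lambda>x. f (x + a))" if "integrable lborel f" for f :: "'a \<Rightarrow> 'b" and a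
  proof -
    have [measurable]: "f \<in> borel_measurable borel" using that by (simp add: integrable_iff_bounded)
    show ?thesis using that unfolding integrable_iff_bounded
      using nn_integral_lborel_translation[of "\<lambda>x. ennreal (norm (f x))" a] by simp
  qed
  show iff: "integrable lborel (\<lambda>x. f (x + a)) \<longleftrightarrow> integrable lborel f"
    using *[of f a] *[of "\<lambda>x. f (x + a)" "-a"] by auto
  show "(LINT x|lborel. f (x + a)) = (LINT x|lborel. f x)"
  proof (cases "integrable lborel f")
    case True
    then have [measurable]: "f \<in> borel_measurable borel" by (simp add: integrable_iff_bounded)
    have "(LINT x|lborel. f (x + a)) = (LINT x|distr lborel borel ((+) a). f x)"
      by (subst integral_distr) (auto simp: add.commute)
    then show ?thesis by (simp add: lborel_distr_plus)
  next
    case False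
    then show ?thesis using iff by (simp add: not_integrable_integral_eq)
  qed
qed

lemma nn_integral_lborel_uminus:
  fixes f :: "'a::euclidean_space \<Rightarrow> ennreal"
  assumes [measurable]: "f \<in> borel_measurable borel"
  shows "(\<integral>\<^sup>+x. f (- x) \<partial>lborel) = (\<integral>\<^sup>+x. f x \<partial>lborel)"
proof -
  have "(lborel :: 'a measure) = distr lborel borel uminus"
    using lborel_affine[of "-1" "0::'a"] by (simp add: density_1 one_ennreal_def[symmetric])
  then have "(\<integral>\<^sup>+x. f x \<partial>lborel) = (\<integral>\<^sup>+x. f x \<partial>distr lborel borel uminus)" by simp
  also have "\<dots> = (\<integral>\<^sup>+x. f (- x) \<partial>lborel)" by (subst nn_integral_distr) auto
  finally show ?thesis by simp
qed

lemma integral_lborel_uminus: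
  fixes f :: "'a::euclidean_space \<Rightarrow> 'b::{banach,second_countable_topology}"
  assumes [measurable]: "f \<in> borel_measurable borel"
  shows "(LINT x|lborel. f (- x)) = (LINT x|lborel. f x)"
proof -
  have "(lborel :: 'a measure) = distr lborel borel uminus"
    using lborel_affine[of "-1" "0::'a"] by (simp add: density_1 one_ennreal_def[symmetric])
  then have "(LINT x|lborel. f x) = (LINT x|distr lborel borel uminus. f x)" by simp
  also have "\<dots> = (LINT x|lborel. f (- x))" by (subst integral_distr) auto
  finally show ?thesis by simp
qed

text \<open>By translation invariance, \<open>0 = \<integral> (f (x + e) - f x) dx = \<integral>\<^sub>0\<^sup>1 \<integral> f' (x + r e) dx dr = \<integral> f'\<close>.\<close>

lemma integral_directional_derivative_eq_0:
  fixes f f' :: "'a::euclidean_space \<Rightarrow> 'b::euclidean_space"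
  assumes f: "integrable lborel f" and f': "integrable lborel f'"
    and cont: "continuous_on UNIV f'"
    and deriv: "\<And>x r. ((\<lambda>h. f (x + h *\<^sub>R e)) has_vector_derivative f' (x + r *\<^sub>R e)) (at r)"
  shows "(LINT x|lborel. f' x) = 0"
proof -
  have [measurable]: "f' \<in> borel_measurable borel" using cont by (rule borel_measurable_continuous_onI)
  let ?g = "\<lambda>(r::real, x). indicator {0..1} r *\<^sub>R f' (x + r *\<^sub>R e)"
  have m: "?g \<in> borel_measurable (lborel \<Otimes>\<^sub>M lborel)" by measurable
  have eq: "f (x + e) - f x = (LINT r|lborel. indicator {0..1} r *\<^sub>R f' (x + r *\<^sub>R e))" for x
  proof -
    have "(LINT r|lborel. indicator {0..1} r *\<^sub>R f' (x + r *\<^sub>R e)) = f (x + 1 *\<^sub>R e) - f (x + 0 *\<^sub>R e)"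
      by (rule integral_FTC_Icc[where F="\<lambda>r. f (x + r *\<^sub>R e)"])
        (auto intro!: has_vector_derivative_at_within[OF deriv] continuous_on_compose2[OF cont] continuous_intros)
    then show ?thesis by simp
  qed
  have "(\<integral>\<^sup>+p. ennreal (norm (?g p)) \<partial>(lborel \<Otimes>\<^sub>M lborel))
     = (\<integral>\<^sup>+r. \<integral>\<^sup>+x. ennreal (norm (?g (r, x))) \<partial>lborel \<partial>lborel)"
    by (rule lborel.nn_integral_fst[symmetric]) measurable
  also have "\<dots> = (\<integral>\<^sup>+r. indicator {0..1::real} r * (\<integral>\<^sup>+x. ennreal (norm (f' x)) \<partial>lborel) \<partial>lborel)"
  proof (rule nn_integral_cong)
    fix r :: real
    have "(\<integral>\<^sup>+x. ennreal (norm (?g (r, x))) \<partial>lborel)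
       = (\<integral>\<^sup>+x. indicator {0..1} r * ennreal (norm (f' (x + r *\<^sub>R e))) \<partial>lborel)"
      by (intro nn_integral_cong) (auto simp: indicator_def)
    also have "\<dots> = indicator {0..1} r * (\<integral>\<^sup>+x. ennreal (norm (f' (x + r *\<^sub>R e))) \<partial>lborel)"
      by (rule nn_integral_cmult) measurable
    finally show "(\<integral>\<^sup>+x. ennreal (norm (?g (r, x))) \<partial>lborel) =
        indicator {0..1} r * (\<integral>\<^sup>+x. ennreal (norm (f' x)) \<partial>lborel)"
      using nn_integral_lborel_translation[of "\<lambda>x. ennreal (norm (f' x))" "r *\<^sub>R e"] by simp
  qed
  also have "\<dots> < \<infinity>"
    using f' by (subst nn_integral_multc) (auto simp: integrable_iff_bounded)
  finally have int: "integrable (lborel \<Otimes>\<^sub>M lborel) ?g"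
    using m by (simp add: integrable_iff_bounded)
  have "0 = (LINT x|lborel. f (x + e) - f x)"
    using f by (simp add: integral_lborel_translation integrable_lborel_translation)
  also have "\<dots> = (LINT x|lborel. (LINT r|lborel. ?g (r, x)))"
    by (simp add: eq)
  also have "\<dots> = (LINT r|lborel. (LINT x|lborel. ?g (r, x)))"
    using lborel_pair.Fubini_integral[of "\<lambda>r x. ?g (r, x)"] int by (simp add: case_prod_beta)
  also have "\<dots> = (LINT r|lborel. indicator {0..1::real} r *\<^sub>R (LINT x|lborel. f' x))"
    by (simp add: integral_lborel_translation)
  also have "\<dots> = (LINT x|lborel. f' x)" by (simp add: integral_FTC_Icc)
  finally show ?thesis by simp
qed

lemma integral_vector_derivative_eq_0:
  fixes f f' :: "real \<Rightarrow> 'b::euclidean_space"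
  assumes f: "integrable lborel f" and f': "integrable lborel f'"
    and cont: "continuous_on UNIV f'"
    and deriv: "\<And>x. (f has_vector_derivative f' x) (at x)"
  shows "(LINT x|lborel. f' x) = 0"
proof (rule integral_directional_derivative_eq_0[OF f f' cont, where e=1])
  fix x r :: real
  have "((+) x has_vector_derivative 1) (at r)" by (auto intro!: derivative_eq_intros)
  from vector_diff_chain_at[OF this deriv]
  show "((\<lambda>h. f (x + h *\<^sub>R 1)) has_vector_derivative f' (x + r *\<^sub>R 1)) (at r)" by (simp add: o_def)
qed

subsection \<open>The one-dimensional heat kernel\<close>

text \<open>\<open>he m s\<close> is the \<open>m\<close>-th derivative of the heat kernel of the line at time \<open>s\<close>, computed by the
  three-term recursion of the Hermite functions.\<close>

fun he :: "nat \<Rightarrow> real \<Rightarrow> real \<Rightarrow> real" where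
  "he 0 s x = exp (- x\<^sup>2 / (4 * s)) / sqrt (4 * pi * s)"
| "he (Suc 0) s x = - (x * he 0 s x) / (2 * s)"
| "he (Suc (Suc m)) s x = - (x * he (Suc m) s x + real (Suc m) * he m s x) / (2 * s)"

declare he.simps [simp del]

text \<open>Merges the last two clauses of the recursion: at \<open>m = 0\<close> the truncated
  index \<open>m - 1\<close> does no harm, its coefficient being \<open>0\<close>.\<close>

lemma he_Suc: "he (Suc m) s x = - (x * he m s x + real m * he (m - 1) s x) / (2 * s)"
  by (cases m) (auto simp: he.simps)

text \<open>Differentiating \<open>2 * s * he (Suc m) s x + x * he m s x + real m * he (m - 1) s x =
  0\<close> raises each order by one and turns \<open>real m\<close> into
  \<open>real (Suc m)\<close>: this is the next instance of the recursion. As the recursion reaches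
  back two orders, the induction carries two consecutive ones.\<close>

lemma he_has_real_derivative:
  assumes "s > 0"
  shows "(he m s has_real_derivative he (Suc m) s x) (at x)"
proof -
  have "(he m s has_real_derivative he (Suc m) s x) (at x) \<and>
    (he (Suc m) s has_real_derivative he (Suc (Suc m)) s x) (at x)"
  proof (induction m)
    case 0
    have 1: "(he 0 s has_real_derivative he 1 s x) (at x)"
      using assms unfolding he.simps One_nat_def
      by (auto intro!: derivative_eq_intros simp: field_simps)
    have "he (Suc 0) s = (\<lambda>x. - (x * he 0 s x) / (2 * s))" by (rule ext) (rule he.simps)
    moreover have "((\<lambda>x. - (x * he 0 s x) / (2 * s)) has_real_derivative he (Suc (Suc 0)) s x) (at x)"
      by (rule derivative_eq_intros 1 refl)+
        (use assms in \<open>auto simp: field_simps he_Suc[of "Suc 0"]\<close>)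
    ultimately show ?case using 1 by simp
  next
    case (Suc m)
    have "he (Suc (Suc m)) s = (\<lambda>x. - (x * he (Suc m) s x + real (Suc m) * he m s x) / (2 * s))"
      by (rule ext) (rule he.simps)
    moreover have "((\<lambda>x. - (x * he (Suc m) s x + real (Suc m) * he m s x) / (2 * s))
        has_real_derivative he (Suc (Suc (Suc m))) s x) (at x)"
      using DERIV_cdivide[OF DERIV_minus[OF DERIV_add[OF DERIV_mult[OF DERIV_ident Suc.IH[THEN conjunct2]]
          DERIV_cmult[OF Suc.IH[THEN conjunct1], of "real (Suc m)"]]], of "2 * s"]
      by (simp add: he.simps(3)[of "Suc m"] algebra_simps)
    ultimately show ?case using Suc by simp
  qed
  then show ?thesis ..
qed

lemma borel_measurable_he [measurable]:
  assumes [measurable]: "f \<in> borel_measurable M" "g \<in> borel_measurable M"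
  shows "(\<lambda>p. he m (f p) (g p)) \<in> borel_measurable M"
proof -
  have "(\<lambda>p. he m (f p) (g p)) \<in> borel_measurable M \<and> (\<lambda>p. he (Suc m) (f p) (g p)) \<in> borel_measurable M"
  proof (induction m)
    case 0
    have [measurable]: "(\<lambda>p. he 0 (f p) (g p)) \<in> borel_measurable M" unfolding he.simps by measurable
    show ?case unfolding he.simps(2) by measurable
  next
    case (Suc m)
    note [measurable] = Suc.IH[THEN conjunct1] Suc.IH[THEN conjunct2]
    show ?case unfolding he.simps(3) by measurable
  qed
  then show ?thesis ..
qed

text \<open>From \<open>1 + y \<le> exp y\<close> and \<open>(y - 4 * m)\<^sup>2 \<ge> 0\<close>.
  With \<open>y = |x| / sqrt s\<close> the heat kernel supplies
  \<open>exp (- y\<^sup>2 / 4)\<close>; spending \<open>y\<^sup>2 / 8\<close> on the polynomial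
  leaves half of the exponent, that is, a heat kernel at the doubled time.\<close>

lemma one_plus_power_le_exp_square:
  fixes y :: real
  assumes "y \<ge> 0"
  shows "(1 + y) ^ m \<le> exp (2 * (real m)\<^sup>2) * exp (y\<^sup>2 / 8)"
proof -
  have "(1 + y) ^ m \<le> exp y ^ m"
    using assms by (intro power_mono) auto
  also have "\<dots> = exp (real m * y)" by (simp add: exp_of_nat_mult)
  also have "real m * y \<le> 2 * (real m)\<^sup>2 + y\<^sup>2 / 8"
    using zero_le_power2[of "y - 4 * real m"] by (simp add: power2_eq_square algebra_simps)
  finally show ?thesis by (simp add: exp_add)
qed

text \<open>Parabolic scaling: each derivative costs a factor \<open>1 / sqrt s\<close> and at most
  one degree in \<open>|x| / sqrt s\<close>. The recursion either goes down one order and multiplies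
  by \<open>x / (2 * s)\<close>, or goes down two orders and divides by \<open>2 * s\<close>; both
  fit this count.\<close>

lemma he_bound_poly:
  "\<exists>C\<ge>0. \<forall>s>0. \<forall>x. \<bar>he m s x\<bar> \<le> C * (1 / sqrt s) ^ Suc m * (1 + \<bar>x\<bar> / sqrt s) ^ m * exp (- x\<^sup>2 / (4 * s))"
proof (induction m rule: less_induct)
  case (less m)
  show ?case
  proof (cases m)
    case 0
    have "\<bar>he 0 s x\<bar> \<le> 1 * (1 / sqrt s) * exp (- x\<^sup>2 / (4 * s))" if "s > 0" for s x
    proof -
      have "sqrt s \<le> sqrt (4 * pi * s)"
        using pi_gt3 that by (intro real_sqrt_le_mono) auto
      then show ?thesis using that by (simp add: field_simps he.simps)
    qed
    then show ?thesis using 0 by (intro exI[of _ 1]) auto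
  next
    case (Suc k)
    obtain A where A: "A \<ge> 0" "\<And>s x. s > 0 \<Longrightarrow>
        \<bar>he k s x\<bar> \<le> A * (1 / sqrt s) ^ Suc k * (1 + \<bar>x\<bar> / sqrt s) ^ k * exp (- x\<^sup>2 / (4 * s))"
      using less[of k] Suc by blast
    obtain B where B: "B \<ge> 0" "\<And>s x. s > 0 \<Longrightarrow> \<bar>he (k - 1) s x\<bar> \<le>
        B * (1 / sqrt s) ^ Suc (k - 1) * (1 + \<bar>x\<bar> / sqrt s) ^ (k - 1) * exp (- x\<^sup>2 / (4 * s))"
      using less[of "k - 1"] Suc less_imp_diff_less[of k m 1] by blast
    have "\<bar>he m s x\<bar> \<le> (A + real k * B) * (1 / sqrt s) ^ Suc m * (1 + \<bar>x\<bar> / sqrt s) ^ m * exp (- x\<^sup>2 / (4 * s))"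
      if s: "s > 0" for s x
    proof -
      define r y e where "r = 1 / sqrt s" and "y = \<bar>x\<bar> * r" and "e = exp (- x\<^sup>2 / (4 * s))"
      have r: "r > 0" "r * r = 1 / s" using s by (auto simp: r_def)
      have y: "y \<ge> 0" "\<bar>x\<bar> / sqrt s = y" using r by (auto simp: y_def r_def)
      have e: "e > 0" by (simp add: e_def)
      have hA: "\<bar>he k s x\<bar> \<le> A * r ^ Suc k * (1 + y) ^ k * e"
        using A(2)[OF s, of x] y(2) by (simp add: r_def e_def)
      have hB: "real k * \<bar>he (k - 1) s x\<bar> \<le> real k * (B * r ^ k * (1 + y) ^ k * e)"
      proof (cases "k = 0")
        case False
        have "\<bar>he (k - 1) s x\<bar> \<le> B * r ^ k * (1 + y) ^ (k - 1) * e"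
          using B(2)[OF s, of x] y(2) False by (simp add: r_def e_def)
        also have "\<dots> \<le> B * r ^ k * (1 + y) ^ k * e"
          using B(1) r e y by (intro mult_right_mono mult_left_mono power_increasing) auto
        finally show ?thesis by (intro mult_left_mono) auto
      qed simp
      have "\<bar>he m s x\<bar> \<le> (\<bar>x\<bar> * \<bar>he k s x\<bar> + real k * \<bar>he (k - 1) s x\<bar>) / (2 * s)"
        using s abs_triangle_ineq[of "x * he k s x" "real k * he (k - 1) s x"]
        unfolding Suc he_Suc[of k] abs_divide abs_minus_cancel by (simp add: abs_mult divide_right_mono)
      also have "\<dots> \<le> (\<bar>x\<bar> * (A * r ^ Suc k * (1 + y) ^ k * e) + real k * (B * r ^ k * (1 + y) ^ k * e)) / (2 * s)"
        using s by (intro divide_right_mono add_mono mult_left_mono[OF hA] hB) auto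
      also have "\<dots> = (A * y + real k * B) * (r ^ k * (1 + y) ^ k * e) * (r * r) / 2"
        using s unfolding r(2) by (simp add: y_def field_simps)
      also have "\<dots> \<le> ((A + real k * B) * (1 + y)) * (r ^ k * (1 + y) ^ k * e) * (r * r)"
      proof -
        have "(A * y + real k * B) / 2 \<le> (A + real k * B) * (1 + y)"
          using A(1) B(1) y(1) by (simp add: algebra_simps add_increasing2)
        then have "(A * y + real k * B) / 2 * ((r ^ k * (1 + y) ^ k * e) * (r * r)) \<le>
           (A + real k * B) * (1 + y) * ((r ^ k * (1 + y) ^ k * e) * (r * r))"
          using r(1) y(1) e by (intro mult_right_mono mult_nonneg_nonneg zero_le_power) auto
        then show ?thesis by (simp add: mult_ac)
      qed
      also have "\<dots> = (A + real k * B) * r ^ Suc m * (1 + y) ^ m * e"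
        by (simp add: Suc mult_ac)
      finally show ?thesis unfolding y(2) by (simp only: r_def e_def)
    qed
    then show ?thesis using A(1) B(1) by (intro exI[of _ "A + real k * B"]) auto
  qed
qed

lemma he_bound:
  obtains C where "C \<ge> 0" "\<And>s x. s > 0 \<Longrightarrow> \<bar>he m s x\<bar> \<le> C * (1 / sqrt s) ^ m * he 0 (2 * s) x"
proof -
  obtain A where A: "A \<ge> 0" "\<And>s x. s > 0 \<Longrightarrow> \<bar>he m s x\<bar> \<le>
      A * (1 / sqrt s) ^ Suc m * (1 + \<bar>x\<bar> / sqrt s) ^ m * exp (- x\<^sup>2 / (4 * s))"
    using he_bound_poly[of m] by auto
  \<comment> \<open>\<open>sqrt (8 * pi) * sqrt s\<close> is the denominator of
    \<open>he 0 (2 * s)\<close>; the exponential is the price of absorbing the polynomial into the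
    Gaussian.\<close>
  define C where "C = A * exp (2 * (real m)\<^sup>2) * sqrt (8 * pi)"
  have "\<bar>he m s x\<bar> \<le> C * (1 / sqrt s) ^ m * he 0 (2 * s) x" if s: "s > 0" for s x
  proof -
    have "(1 + \<bar>x\<bar> / sqrt s) ^ m \<le> exp (2 * (real m)\<^sup>2) * exp (x\<^sup>2 / (8 * s))"
      using one_plus_power_le_exp_square[of "\<bar>x\<bar> / sqrt s" m] s by (simp add: power_divide mult.commute)
    then have "A * (1 / sqrt s) ^ Suc m * (1 + \<bar>x\<bar> / sqrt s) ^ m * exp (- x\<^sup>2 / (4 * s))
      \<le> A * (1 / sqrt s) ^ Suc m * (exp (2 * (real m)\<^sup>2) * exp (x\<^sup>2 / (8 * s))) * exp (- x\<^sup>2 / (4 * s))"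
      using A(1) s by (intro mult_right_mono mult_left_mono) auto
    also have "\<dots> = A * (1 / sqrt s) ^ Suc m * exp (2 * (real m)\<^sup>2) * exp (x\<^sup>2 / (8 * s) + - x\<^sup>2 / (4 * s))"
      by (simp only: exp_add mult_ac)
    also have "x\<^sup>2 / (8 * s) + - x\<^sup>2 / (4 * s) = - x\<^sup>2 / (4 * (2 * s))"
      using s by (simp add: field_simps)
    also have "A * (1 / sqrt s) ^ Suc m * exp (2 * (real m)\<^sup>2) * exp (- x\<^sup>2 / (4 * (2 * s))) = C * (1 / sqrt s) ^ m * he 0 (2 * s) x"
    proof -
      have "sqrt (4 * pi * (2 * s)) = sqrt (8 * pi) * sqrt s"
        by (simp flip: real_sqrt_mult add: mult_ac)
      then show ?thesis using s by (simp add: C_def field_simps he.simps)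
    qed
    finally show ?thesis using A(2)[OF s, of x] by linarith
  qed
  moreover have "C \<ge> 0" using A(1) by (simp add: C_def)
  ultimately show ?thesis using that by blast
qed

lemma integrable_he_0: "s > 0 \<Longrightarrow> integrable lborel (he 0 s)"
proof -
  assume s: "s > 0"
  have "he 0 s = normal_density 0 (sqrt (2 * s))"
    using s by (auto simp: fun_eq_iff normal_density_def mult_ac he.simps)
  then show ?thesis using s by (simp add: integrable_normal_density)
qed

lemma integrable_he:
  assumes "s > 0"
  shows "integrable lborel (he m s)"
proof -
  obtain C where C: "C \<ge> 0" "\<And>s x. s > 0 \<Longrightarrow> \<bar>he m s x\<bar> \<le> C * (1 / sqrt s) ^ m * he 0 (2 * s) x"
    using he_bound by blast
  show ?thesis
    by (rule Bochner_Integration.integrable_bound[where f="\<lambda>x. C * (1 / sqrt s) ^ m * he 0 (2 * s) x"])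
      (use assms C order_trans[OF C(2) abs_ge_self] in \<open>auto intro!: integrable_mult_right integrable_he_0\<close>)
qed

lemma isCont_he: "s > 0 \<Longrightarrow> isCont (he m s) x"
  using he_has_real_derivative DERIV_isCont by blast

lemma norm_exp_i [simp]: "norm (exp (\<i> * complex_of_real a)) = 1" "norm (exp (- (\<i> * complex_of_real a))) = 1"
  using norm_exp_i_times[of a] norm_exp_i_times[of "-a"] by auto

text \<open>Rescaling by the standard deviation \<open>sqrt (2 * s)\<close> turns the integral into
  the characteristic function of the standard normal distribution.\<close>

lemma fourier_he_0:
  assumes s: "s > 0"
  shows "(LINT x|lborel. exp (- \<i> * of_real (\<xi> * x)) * of_real (he 0 s x)) = of_real (exp (- s * \<xi>\<^sup>2))"
proof -
  define c where "c = sqrt (2 * s)"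
  have c: "c > 0" "c\<^sup>2 = 2 * s" using s by (auto simp: c_def)
  have "(LINT x|lborel. exp (- \<i> * of_real (\<xi> * x)) * of_real (he 0 s x))
    = \<bar>c\<bar> *\<^sub>R (LINT x|lborel. exp (- \<i> * of_real (\<xi> * (0 + c * x))) * of_real (he 0 s (0 + c * x)))"
    by (rule lborel_integral_real_affine) (use c in simp)
  also have "\<dots> = (LINT x|lborel. \<bar>c\<bar> *\<^sub>R (exp (- \<i> * of_real (\<xi> * (0 + c * x))) * of_real (he 0 s (0 + c * x))))"
    by (rule integral_scaleR_right[symmetric])
  also have "\<dots> = (LINT x|lborel. std_normal_density x *\<^sub>R iexp ((- \<xi> * c) * x))"
  proof (rule Bochner_Integration.integral_cong)
    fix x
    have q: "sqrt (4 * pi * s) = sqrt (2 * pi) * c"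
      by (simp flip: real_sqrt_mult add: c_def mult_ac)
    have "c * he 0 s (c * x) = std_normal_density x"
      using c s unfolding he.simps q by (simp add: normal_density_def field_simps)
    then show "\<bar>c\<bar> *\<^sub>R (exp (- \<i> * of_real (\<xi> * (0 + c * x))) * of_real (he 0 s (0 + c * x)))
      = std_normal_density x *\<^sub>R iexp ((- \<xi> * c) * x)"
      using c by (simp add: scaleR_conv_of_real flip: of_real_mult) (simp add: mult_ac flip: of_real_mult)
  qed simp
  also have "\<dots> = char std_normal_distribution (- \<xi> * c)"
    unfolding char_def by (subst integral_density) (auto simp: normal_density_nonneg)
  also have "\<dots> = of_real (exp (- s * \<xi>\<^sup>2))"
    using c(2) by (simp add: char_std_normal_distribution power_mult_distrib mult_ac)
  finally show ?thesis .
qed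

lemma fourier_he:
  assumes s: "s > 0"
  shows "(LINT x|lborel. exp (- \<i> * of_real (\<xi> * x)) * of_real (he m s x)) = (\<i> * of_real \<xi>) ^ m * of_real (exp (- s * \<xi>\<^sup>2))"
proof (induction m)
  case 0
  then show ?case using fourier_he_0[OF s] by simp
next
  case (Suc m)
  let ?e = "\<lambda>x. exp (- \<i> * of_real (\<xi> * x))"
  have int: "integrable lborel (\<lambda>x. ?e x * of_real (he m s x))" for m
    by (rule Bochner_Integration.integrable_bound[OF integrable_he[OF s, of m]])
      (auto simp: norm_mult)
  have "(LINT x|lborel. ?e x * of_real (he (Suc m) s x) - (\<i> * of_real \<xi>) * (?e x * of_real (he m s x))) = 0"
  proof (rule integral_vector_derivative_eq_0[where f="\<lambda>x. ?e x * of_real (he m s x)"])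
    show "continuous_on UNIV (\<lambda>x. ?e x * of_real (he (Suc m) s x) - (\<i> * of_real \<xi>) * (?e x * of_real (he m s x)))"
      by (intro continuous_intros continuous_at_imp_continuous_on ballI isCont_he s)
    fix x :: real
    have "((\<lambda>z. exp (- \<i> * (of_real \<xi> * z))) has_field_derivative - \<i> * of_real \<xi> * ?e x) (at (of_real x))"
      by (auto intro!: derivative_eq_intros)
    from has_vector_derivative_real_field[OF this]
    have e: "(?e has_vector_derivative - \<i> * of_real \<xi> * ?e x) (at x)"
      by simp
    show "((\<lambda>h. ?e h * of_real (he m s h)) has_vector_derivative
        (?e x * of_real (he (Suc m) s x) - (\<i> * of_real \<xi>) * (?e x * of_real (he m s x)))) (at x)"
      using has_vector_derivative_mult[OF e has_vector_derivative_of_real[OF he_has_real_derivative[OF s, of m x]]]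
      by (simp add: algebra_simps)
  qed (intro Bochner_Integration.integrable_diff integrable_mult_right int)+
  then have "(LINT x|lborel. ?e x * of_real (he (Suc m) s x)) = (\<i> * of_real \<xi>) * (LINT x|lborel. ?e x * of_real (he m s x))"
    using int[of m] int[of "Suc m"] by (simp only: Bochner_Integration.integral_diff integrable_mult_right integral_mult_right_zero) simp
  then show ?case using Suc by simp
qed

lemma integrable_power_gaussian:
  assumes "s > 0"
  shows "integrable lborel (\<lambda>x::real. x ^ m * exp (- s * x\<^sup>2))"
proof -
  define \<sigma> where "\<sigma> = sqrt (1 / (2 * s))"
  have \<sigma>: "\<sigma>\<^sup>2 = 1 / (2 * s)" "\<sigma> > 0" using assms by (auto simp: \<sigma>_def)
  have "integrable lborel (\<lambda>x. sqrt (2 * pi * \<sigma>\<^sup>2) * (normal_density 0 \<sigma> x * (x - 0) ^ m))"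
    by (intro integrable_mult_right integrable_normal_moment \<sigma>)
  also have "(\<lambda>x. sqrt (2 * pi * \<sigma>\<^sup>2) * (normal_density 0 \<sigma> x * (x - 0) ^ m)) = (\<lambda>x. x ^ m * exp (- s * x\<^sup>2))"
    using \<sigma> assms by (auto simp: normal_density_def fun_eq_iff field_simps)
  finally show ?thesis .
qed

text \<open>The integrals obey the recursion of \<open>he\<close>: the derivative of the integrand
  \<open>F m\<close> has integral zero, which links the orders \<open>m - 1\<close>,
  \<open>m\<close> and \<open>m + 1\<close>. Only order zero has to be computed, and no inversion
  theorem enters.\<close>

lemma integral_exp_power_gaussian:
  assumes s: "s > 0"
  shows "(LINT \<xi>|lborel. exp (\<i> * of_real (\<xi> * x)) * ((\<i> * of_real \<xi>) ^ m * of_real (exp (- s * \<xi>\<^sup>2))))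
    = of_real (2 * pi * he m s x)"
proof -
  define F where "F m \<xi> = exp (\<i> * of_real (\<xi> * x)) * ((\<i> * of_real \<xi>) ^ m * complex_of_real (exp (- s * \<xi>\<^sup>2)))" for m \<xi>
  have cont: "continuous_on UNIV (F m)" for m
    unfolding F_def by (intro continuous_intros)
  have int: "integrable lborel (F m)" for m
    by (rule Bochner_Integration.integrable_bound[OF integrable_power_gaussian[OF s, of m]])
      (auto simp: norm_mult F_def[of m] norm_power power_abs abs_mult intro!: borel_measurable_continuous_onI[OF cont])
  have rec: "(LINT \<xi>|lborel. F (Suc m) \<xi>) = - (of_real x * (LINT \<xi>|lborel. F m \<xi>) + of_nat m * (LINT \<xi>|lborel. F (m - 1) \<xi>)) / of_real (2 * s)" for m
  proof -
    let ?D = "\<lambda>\<xi>. \<i> * of_real x * F m \<xi> + \<i> * of_nat m * F (m - 1) \<xi> + \<i> * of_real (2 * s) * F (Suc m) \<xi>"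
    have "(LINT \<xi>|lborel. ?D \<xi>) = 0"
    proof (rule integral_vector_derivative_eq_0[where f="F m"])
      show "continuous_on UNIV ?D" by (intro continuous_intros cont)
      fix y :: real
      have "((\<lambda>\<xi>. exp (\<i> * \<xi> * of_real x) * ((\<i> * \<xi>) ^ m * exp (- of_real s * \<xi>\<^sup>2))) has_field_derivative ?D y) (at (of_real y))"
        unfolding F_def
        by (rule derivative_eq_intros refl)+
          (simp add: algebra_simps flip: exp_of_real)
      from has_vector_derivative_real_field[OF this]
      show "(F m has_vector_derivative ?D y) (at y)"
        by (simp add: F_def[abs_def] mult_ac flip: exp_of_real)
    qed (intro Bochner_Integration.integrable_add integrable_mult_right int)+
    then have "\<i> * of_real x * (LINT \<xi>|lborel. F m \<xi>) + \<i> * of_nat m * (LINT \<xi>|lborel. F (m - 1) \<xi>) + \<i> * of_real (2 * s) * (LINT \<xi>|lborel. F (Suc m) \<xi>) = 0"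
      using int by simp
    then have "\<i> * (of_real x * (LINT \<xi>|lborel. F m \<xi>) + of_nat m * (LINT \<xi>|lborel. F (m - 1) \<xi>) + of_real (2 * s) * (LINT \<xi>|lborel. F (Suc m) \<xi>)) = 0"
      by (simp add: algebra_simps)
    then have "of_real x * (LINT \<xi>|lborel. F m \<xi>) + of_nat m * (LINT \<xi>|lborel. F (m - 1) \<xi>) + of_real (2 * s) * (LINT \<xi>|lborel. F (Suc m) \<xi>) = 0"
      by simp
    moreover have "complex_of_real (2 * s) \<noteq> 0" using s by simp
    ultimately show ?thesis by (simp add: field_simps eq_neg_iff_add_eq_0)
  qed
  have "(LINT \<xi>|lborel. F m \<xi>) = of_real (2 * pi * he m s x)"
  proof (induction m rule: less_induct)
    case (less m)
    show ?case
    proof (cases m)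
      case 0
      \<comment> \<open>Up to the factor \<open>sqrt (pi / s)\<close>, the function
        \<open>exp (- s * \<xi>\<^sup>2)\<close> is itself the heat kernel at time
        \<open>1 / (4 * s)\<close>, whose transform is known.\<close>
      have s': "1 / (4 * s) > 0" using s by simp
      have "F 0 \<xi> = of_real (sqrt (pi / s)) * (exp (- \<i> * of_real (- x * \<xi>)) * of_real (he 0 (1 / (4 * s)) \<xi>))" for \<xi>
        using s by (simp add: F_def mult_ac real_sqrt_divide he.simps)
      then have "(LINT \<xi>|lborel. F 0 \<xi>) = of_real (sqrt (pi / s)) * of_real (exp (- (1 / (4 * s)) * (- x)\<^sup>2))"
        unfolding fourier_he_0[OF s', of "-x", symmetric] by simp
      also have "\<dots> = of_real (2 * pi * he 0 s x)"
      proof -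
        have "sqrt (pi / s) = 2 * pi / sqrt (4 * pi * s)"
        proof -
          have "sqrt (4 * pi * s) = 2 * (sqrt pi * sqrt s)" by (simp add: real_sqrt_mult)
          then show ?thesis using s by (simp add: real_sqrt_divide field_simps)
        qed
        then show ?thesis by (simp add: he.simps flip: of_real_mult)
      qed
      finally show ?thesis using 0 by simp
    next
      case (Suc k)
      have "(LINT \<xi>|lborel. F k \<xi>) = of_real (2 * pi * he k s x)"
        "(LINT \<xi>|lborel. F (k - 1) \<xi>) = of_real (2 * pi * he (k - 1) s x)"
        using less[of k] less[of "k - 1"] Suc by auto
      then show ?thesis
        unfolding Suc rec he_Suc[of k]
        by (simp add: field_simps)
    qed
  qed
  then show ?thesis by (simp add: F_def)
qed

subsection \<open>The heat kernel and its Fourier transform\<close>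

text \<open>\<open>heatD \<alpha> s\<close> is \<open>\<partial>\<^sup>\<alpha> E(\<cdot>, s)\<close> and \<open>gsym \<alpha> s\<close> is its Fourier transform.\<close>

definition heatD :: "(3 \<Rightarrow> nat) \<Rightarrow> real \<Rightarrow> real^3 \<Rightarrow> real" where
  "heatD \<alpha> s x = (\<Prod>k\<in>UNIV. he (\<alpha> k) s (x $ k))"

definition gsym :: "(3 \<Rightarrow> nat) \<Rightarrow> real \<Rightarrow> real^3 \<Rightarrow> complex" where
  "gsym \<alpha> s \<xi> = (\<Prod>k\<in>UNIV. (\<i> * of_real (\<xi> $ k)) ^ \<alpha> k) * of_real (exp (- s * (norm \<xi>)\<^sup>2))"

text \<open>The formula of \<open>multiplier\<close> for a scalar symbol, so that each component of
  the multiplier unfolds to it. Because of \<open>Re\<close> it is linear over the reals, not over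
  the complex numbers; hence the real factor in \<open>ift_scale\<close>.\<close>

definition ift :: "(real^3 \<Rightarrow> complex) \<Rightarrow> real^3 \<Rightarrow> real" where
  "ift m z = Re ((LINT \<xi>|lborel. exp (\<i> * of_real (\<xi> \<bullet> z)) * m \<xi>) / of_real ((2 * pi) ^ 3))"

definition inc :: "3 \<Rightarrow> (3 \<Rightarrow> nat) \<Rightarrow> 3 \<Rightarrow> nat" where
  "inc j \<alpha> = \<alpha>(j := Suc (\<alpha> j))"

abbreviation "z3 \<equiv> (\<lambda>_::3. 0::nat)"

lemma inc_commute: "inc i (inc j \<alpha>) = inc j (inc i \<alpha>)"
  by (auto simp: inc_def fun_eq_iff)

lemma sum_inc: "(\<Sum>k\<in>UNIV. inc j \<alpha> k) = Suc (\<Sum>k\<in>UNIV. \<alpha> k)"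
proof -
  have "inc j \<alpha> k = \<alpha> k + (if k = j then 1 else 0)" for k by (simp add: inc_def)
  then show ?thesis by (simp add: sum.distrib)
qed

lemma norm_power2_vec: "(norm (x::real^'n))\<^sup>2 = (\<Sum>k\<in>UNIV. (x $ k)\<^sup>2)"
  unfolding power2_norm_eq_inner inner_vec_def by (simp add: power2_eq_square)

lemma gsym_prod: "gsym \<alpha> s \<xi> = (\<Prod>k\<in>UNIV. (\<i> * of_real (\<xi> $ k)) ^ \<alpha> k * of_real (exp (- s * (\<xi> $ k)\<^sup>2)))"
  by (simp add: gsym_def norm_power2_vec prod.distrib sum_distrib_left exp_sum sum_negf[symmetric])

lemma gsym_inc: "gsym (inc j \<alpha>) s \<xi> = \<i> * of_real (\<xi> $ j) * gsym \<alpha> s \<xi>"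
proof -
  have "(\<Prod>k\<in>UNIV. (\<i> * complex_of_real (\<xi> $ k)) ^ inc j \<alpha> k)
     = (\<Prod>k\<in>UNIV. (if k = j then \<i> * complex_of_real (\<xi> $ k) else 1) * (\<i> * complex_of_real (\<xi> $ k)) ^ \<alpha> k)"
    by (intro prod.cong) (auto simp: inc_def)
  also have "\<dots> = \<i> * complex_of_real (\<xi> $ j) * (\<Prod>k\<in>UNIV. (\<i> * complex_of_real (\<xi> $ k)) ^ \<alpha> k)"
    by (simp add: prod.distrib)
  finally show ?thesis by (simp add: gsym_def)
qed

lemma gsym_0: "gsym z3 s \<xi> = of_real (exp (- s * (norm \<xi>)\<^sup>2))"
  by (simp add: gsym_def)

lemma gsym_exp: "of_real (exp (- t * (norm \<xi>)\<^sup>2)) * gsym \<alpha> s \<xi> = gsym \<alpha> (t + s) \<xi>"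
proof -
  have "exp (- t * (norm \<xi>)\<^sup>2) * exp (- s * (norm \<xi>)\<^sup>2) = exp (- (t + s) * (norm \<xi>)\<^sup>2)"
    by (simp add: algebra_simps flip: exp_add)
  then show ?thesis unfolding gsym_def
    by (metis (no_types, lifting) mult.commute mult.left_commute of_real_mult)
qed

lemma borel_measurable_vec_nth [measurable (raw)]:
  "f \<in> borel_measurable M \<Longrightarrow> (\<lambda>x. f x $ k :: 'b::real_normed_vector) \<in> borel_measurable M"
  by (rule borel_measurable_continuous_on[where f="\<lambda>x. x $ k"]) (auto intro!: continuous_intros)

lemma borel_measurable_of_real_comp [measurable (raw)]:
  "f \<in> borel_measurable M \<Longrightarrow> (\<lambda>x. of_real (f x) :: 'b::real_normed_algebra_1) \<in> borel_measurable M"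
  by (rule borel_measurable_continuous_on[where f=of_real]) (auto intro!: continuous_intros)

lemma borel_measurable_gsym [measurable]:
  assumes [measurable]: "f \<in> borel_measurable M" "g \<in> borel_measurable M"
  shows "(\<lambda>p. gsym \<alpha> (f p) (g p)) \<in> borel_measurable M"
  unfolding gsym_def by measurable

lemma borel_measurable_heatD [measurable]:
  assumes [measurable]: "f \<in> borel_measurable M" "g \<in> borel_measurable M"
  shows "(\<lambda>p. heatD \<alpha> (f p) (g p)) \<in> borel_measurable M"
  unfolding heatD_def by measurable

lemma heatD_0_nonneg:
  assumes "s \<ge> 0"
  shows "heatD z3 s x \<ge> 0"
  unfolding heatD_def by (intro prod_nonneg) (auto simp: he.simps assms)

lemma integrable_heatD: "s > 0 \<Longrightarrow> integrable lborel (heatD \<alpha> s)"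
  unfolding heatD_def by (intro integrable_prod_vec integrable_he)

lemma integrable_gsym: "s > 0 \<Longrightarrow> integrable lborel (gsym \<alpha> s)"
proof -
  assume s: "s > 0"
  have "integrable lborel (\<lambda>x. (\<i> * complex_of_real x) ^ m * of_real (exp (- s * x\<^sup>2)))" for m
    by (rule Bochner_Integration.integrable_bound[OF integrable_power_gaussian[OF s, of m]])
      (auto simp: norm_mult norm_power power_abs abs_mult)
  then show ?thesis unfolding gsym_prod by (intro integrable_prod_vec)
qed

lemma exp_inner_prod: "exp (c * complex_of_real (\<xi> \<bullet> x)) = (\<Prod>k\<in>UNIV. exp (c * of_real ((\<xi>::real^3) $ k * x $ k)))"
  by (simp add: inner_vec_def sum_distrib_left flip: exp_sum)

lemma fourier_heatD:
  assumes "s > 0"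
  shows "fourier (heatD \<alpha> s) \<xi> = gsym \<alpha> s \<xi>"
proof -
  have "fourier (heatD \<alpha> s) \<xi> = (LINT x|lborel. (\<Prod>k\<in>UNIV. exp (- \<i> * of_real (\<xi> $ k * x $ k)) * of_real (he (\<alpha> k) s (x $ k))))"
    unfolding fourier_def heatD_def exp_inner_prod by (simp add: prod.distrib)
  also have "\<dots> = (\<Prod>k\<in>UNIV. (LINT x|lborel. exp (- \<i> * of_real (\<xi> $ k * x)) * of_real (he (\<alpha> k) s x)))"
  proof (rule integral_prod_vec)
    fix k show "integrable lborel (\<lambda>x. exp (- \<i> * of_real (\<xi> $ k * x)) * complex_of_real (he (\<alpha> k) s x))"
      by (rule Bochner_Integration.integrable_bound[OF integrable_he[OF assms, of "\<alpha> k"]]) (auto simp: norm_mult)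
  qed
  also have "\<dots> = gsym \<alpha> s \<xi>" unfolding gsym_prod fourier_he[OF assms] ..
  finally show ?thesis .
qed

lemma ift_gsym:
  assumes "s > 0"
  shows "ift (gsym \<alpha> s) x = heatD \<alpha> s x"
proof -
  have "(LINT \<xi>|lborel. exp (\<i> * of_real (\<xi> \<bullet> x)) * gsym \<alpha> s \<xi>)
    = (LINT \<xi>|lborel. (\<Prod>k\<in>UNIV. exp (\<i> * of_real (\<xi> $ k * x $ k)) * ((\<i> * of_real (\<xi> $ k)) ^ \<alpha> k * of_real (exp (- s * (\<xi> $ k)\<^sup>2)))))"
    unfolding exp_inner_prod gsym_prod by (simp add: prod.distrib)
  also have "\<dots> = (\<Prod>k\<in>UNIV. (LINT \<xi>|lborel. exp (\<i> * of_real (\<xi> * x $ k)) * ((\<i> * of_real \<xi>) ^ \<alpha> k * of_real (exp (- s * \<xi>\<^sup>2)))))"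
  proof (rule integral_prod_vec)
    fix k show "integrable lborel (\<lambda>\<xi>. exp (\<i> * of_real (\<xi> * x $ k)) * ((\<i> * complex_of_real \<xi>) ^ \<alpha> k * of_real (exp (- s * \<xi>\<^sup>2))))"
      by (rule Bochner_Integration.integrable_bound[OF integrable_power_gaussian[OF assms, of "\<alpha> k"]])
        (auto simp: norm_mult norm_power power_abs abs_mult)
  qed
  also have "\<dots> = of_real ((2 * pi) ^ 3 * heatD \<alpha> s x)"
    unfolding integral_exp_power_gaussian[OF assms] heatD_def by (simp add: prod.distrib)
  finally show ?thesis unfolding ift_def by (simp del: of_real_mult of_real_power flip: of_real_divide)
qed

lemma heatD_bound:
  obtains C where "C \<ge> 0" "\<And>s x. s > 0 \<Longrightarrow> \<bar>heatD \<alpha> s x\<bar> \<le> C * (1 / sqrt s) ^ (\<Sum>k\<in>UNIV. \<alpha> k) * heatD z3 (2 * s) x"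
proof -
  have "\<exists>C. \<forall>k. C k \<ge> 0 \<and> (\<forall>s x. s > 0 \<longrightarrow> \<bar>he (\<alpha> k) s x\<bar> \<le> C k * (1 / sqrt s) ^ \<alpha> k * he 0 (2 * s) x)"
    by (rule choice) (meson he_bound)
  then obtain C where C: "\<And>k. C k \<ge> 0" "\<And>k s x. s > 0 \<Longrightarrow> \<bar>he (\<alpha> k) s x\<bar> \<le> C k * (1 / sqrt s) ^ \<alpha> k * he 0 (2 * s) x"
    by blast
  have "\<bar>heatD \<alpha> s x\<bar> \<le> (\<Prod>k\<in>UNIV. C k) * (1 / sqrt s) ^ (\<Sum>k\<in>UNIV. \<alpha> k) * heatD z3 (2 * s) x" if "s > 0" for s x
  proof -
    have "\<bar>heatD \<alpha> s x\<bar> \<le> (\<Prod>k\<in>UNIV. C k * (1 / sqrt s) ^ \<alpha> k * he 0 (2 * s) (x $ k))"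
      unfolding heatD_def abs_prod using C(2)[OF that] by (intro prod_mono) auto
    then show ?thesis by (simp add: heatD_def prod.distrib power_sum)
  qed
  then show ?thesis using that[of "\<Prod>k\<in>UNIV. C k"] C(1) by (simp add: prod_nonneg)
qed

lemma integral_heatD_0: "s > 0 \<Longrightarrow> (LINT x|lborel. heatD z3 s x) = 1"
proof -
  assume s: "s > 0"
  have "complex_of_real (LINT x|lborel. heatD z3 s x) = fourier (heatD z3 s) 0"
    by (simp add: fourier_def)
  also have "\<dots> = 1" using fourier_heatD[OF s] by (simp add: gsym_0)
  finally show ?thesis by simp
qed

lemma integral_heatD_inc: "s > 0 \<Longrightarrow> (LINT x|lborel. heatD (inc j \<alpha>) s x) = 0"
proof -
  assume s: "s > 0"
  have "complex_of_real (LINT x|lborel. heatD (inc j \<alpha>) s x) = fourier (heatD (inc j \<alpha>) s) 0"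
    by (simp add: fourier_def)
  also have "\<dots> = 0" using fourier_heatD[OF s] by (simp add: gsym_inc)
  finally show ?thesis by simp
qed

lemma heatD_has_derivative_axis:
  assumes "s > 0"
  shows "((\<lambda>h. heatD \<alpha> s (x + h *\<^sub>R axis j 1)) has_real_derivative heatD (inc j \<alpha>) s (x + r *\<^sub>R axis j 1)) (at r)"
proof -
  let ?P = "\<lambda>y. \<Prod>k\<in>UNIV - {j}. he (\<alpha> k) s (x $ k)"
  have eq: "heatD \<beta> s (x + h *\<^sub>R axis j 1) = he (\<beta> j) s (x $ j + h) * (\<Prod>k\<in>UNIV - {j}. he (\<beta> k) s (x $ k))" for \<beta> h
    unfolding heatD_def by (subst prod.remove[of _ j]) (auto simp: axis_def intro!: prod.cong)
  have *: "(\<Prod>k\<in>UNIV - {j}. he (inc j \<alpha> k) s (x $ k)) = (\<Prod>k\<in>UNIV - {j}. he (\<alpha> k) s (x $ k))"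
    by (intro prod.cong) (auto simp: inc_def)
  have "((\<lambda>h. he (\<alpha> j) s (x $ j + h)) has_real_derivative he (Suc (\<alpha> j)) s (x $ j + r)) (at r)"
    using DERIV_shift[of "he (\<alpha> j) s" _ r "x $ j"] he_has_real_derivative[OF assms, of "\<alpha> j" "x $ j + r"]
    by (simp add: add.commute)
  from DERIV_cmult_right[OF this, of "\<Prod>k\<in>UNIV - {j}. he (\<alpha> k) s (x $ k)"]
  show ?thesis unfolding eq * by (simp add: inc_def)
qed

lemma partial_heatD: "s > 0 \<Longrightarrow> partial j (heatD \<alpha> s) x = heatD (inc j \<alpha>) s x"
  unfolding partial_def using heatD_has_derivative_axis[of s \<alpha> x j 0] by (simp add: DERIV_imp_deriv)

lemma heat_kernel_eq_heatD: "s > 0 \<Longrightarrow> heat_kernel s = heatD z3 s"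
proof (rule ext)
  fix x :: "real^3" assume s: "s > 0"
  have "(4 * pi * s) powr (- 3 / 2) = 1 / (sqrt (4 * pi * s)) ^ 3"
    using s by (simp add: powr_minus_divide powr_half_sqrt[symmetric] powr_powr flip: powr_realpow)
  moreover have "exp (- (norm x)\<^sup>2 / (4 * s)) = (\<Prod>k\<in>UNIV. exp (- (x $ k)\<^sup>2 / (4 * s)))"
    by (simp add: norm_power2_vec sum_negf sum_divide_distrib flip: exp_sum)
  ultimately show "heat_kernel s x = heatD z3 s x"
    by (simp add: heat_kernel_def heatD_def he.simps prod_dividef)
qed

section \<open>Convolution and its transpose on the Fourier side\<close>

lemma Re_integral: "integrable M f \<Longrightarrow> (LINT x|M. Re (f x)) = Re (LINT x|M. f x)"
  by simp

text \<open>Fubini for \<open>m \<xi> * f y\<close>, which is integrable on the product because both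
  factors are; again no inversion theorem enters. Applied with \<open>m = ksym\<close> it turns the
  multiplier into a convolution.\<close>

lemma
  assumes m: "integrable lborel m" and f: "integrable lborel f"
  shows ift_mult_fourier: "ift (\<lambda>\<xi>. m \<xi> * fourier f \<xi>) x = (LINT y|lborel. ift m (x - y) * f y)"
    and integrable_ift_mult: "integrable lborel (\<lambda>y. ift m (x - y) * f y)"
proof -
  have [measurable]: "m \<in> borel_measurable borel" "f \<in> borel_measurable borel"
    using m f by (auto simp: integrable_iff_bounded)
  let ?g = "\<lambda>(\<xi>::real^3, y). exp (\<i> * of_real (\<xi> \<bullet> (x - y))) * m \<xi> * complex_of_real (f y)"
  have "integrable (lborel \<Otimes>\<^sub>M lborel) (\<lambda>(\<xi>, y). m \<xi> * complex_of_real (f y))"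
    using m f by (intro lborel_pair.Fubini_integrable) (auto simp: norm_mult)
  then have g: "integrable (lborel \<Otimes>\<^sub>M lborel) ?g"
    by (rule Bochner_Integration.integrable_bound) (auto simp: norm_mult)
  have gy: "(LINT \<xi>|lborel. ?g (\<xi>, y)) / of_real ((2 * pi) ^ 3) = ((LINT \<xi>|lborel. exp (\<i> * of_real (\<xi> \<bullet> (x - y))) * m \<xi>) / of_real ((2 * pi) ^ 3)) * of_real (f y)" for y
    by simp
  have "integrable lborel (\<lambda>y. LINT \<xi>|lborel. ?g (\<xi>, y))"
    using lborel_pair.integrable_snd[of "\<lambda>\<xi> y. ?g (\<xi>, y)"] g by (simp add: case_prod_beta)
  then have int: "integrable lborel (\<lambda>y. (LINT \<xi>|lborel. ?g (\<xi>, y)) / of_real ((2 * pi) ^ 3))"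
    by (rule integrable_divide_zero)
  have Re: "Re ((LINT \<xi>|lborel. ?g (\<xi>, y)) / of_real ((2 * pi) ^ 3)) = ift m (x - y) * f y" for y
    unfolding gy ift_def by simp
  show "integrable lborel (\<lambda>y. ift m (x - y) * f y)"
    using integrable_Re[OF int] unfolding Re .
  have F: "exp (\<i> * of_real (\<xi> \<bullet> x)) * (m \<xi> * fourier f \<xi>) = (LINT y|lborel. ?g (\<xi>, y))" for \<xi>
    unfolding fourier_def integral_mult_right_zero[symmetric]
    by (intro Bochner_Integration.integral_cong)
       (simp_all add: inner_diff_right exp_diff exp_minus algebra_simps divide_inverse)
  have "ift (\<lambda>\<xi>. m \<xi> * fourier f \<xi>) x = Re ((LINT \<xi>|lborel. (LINT y|lborel. ?g (\<xi>, y))) / of_real ((2 * pi) ^ 3))"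
    unfolding ift_def F ..
  also have "(LINT \<xi>|lborel. (LINT y|lborel. ?g (\<xi>, y))) = (LINT y|lborel. (LINT \<xi>|lborel. ?g (\<xi>, y)))"
    using lborel_pair.Fubini_integral[of "\<lambda>\<xi> y. ?g (\<xi>, y)"] g by (simp add: case_prod_beta)
  also have "Re (\<dots> / of_real ((2 * pi) ^ 3)) = Re (LINT y|lborel. (LINT \<xi>|lborel. ?g (\<xi>, y)) / of_real ((2 * pi) ^ 3))"
    by simp
  also have "\<dots> = (LINT y|lborel. Re ((LINT \<xi>|lborel. ?g (\<xi>, y)) / of_real ((2 * pi) ^ 3)))"
    using int by (rule Re_integral[symmetric])
  finally show "ift (\<lambda>\<xi>. m \<xi> * fourier f \<xi>) x = (LINT y|lborel. ift m (x - y) * f y)"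
    unfolding Re .
qed

lemma ift_uminus:
  assumes [measurable]: "m \<in> borel_measurable borel"
  shows "ift m (- z) = ift (\<lambda>\<xi>. m (- \<xi>)) z"
  unfolding ift_def
  using integral_lborel_uminus[of "\<lambda>\<xi>. exp (\<i> * complex_of_real (\<xi> \<bullet> - z)) * m \<xi>"] by simp

text \<open>The transpose of the convolution: the kernel is integrated in its first variable
  \<open>x\<close>, which reflects the symbol. Pairings with test functions and with the linear flow
  both have this form.\<close>

lemma integral_mult_ift:
  assumes m: "integrable lborel m" and f: "integrable lborel f"
  shows "(LINT x|lborel. f x * ift m (x - y)) = ift (\<lambda>\<xi>. m (- \<xi>) * fourier f \<xi>) y"
    and "integrable lborel (\<lambda>x. f x * ift m (x - y))"
proof -
  have [measurable]: "m \<in> borel_measurable borel" using m by (simp add: integrable_iff_bounded)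
  have "integrable lborel (\<lambda>\<xi>. m (- \<xi>))"
    using m nn_integral_lborel_uminus[of "\<lambda>\<xi>. ennreal (norm (m \<xi>))"] by (simp add: integrable_iff_bounded)
  note * = ift_mult_fourier[OF this f, of y] integrable_ift_mult[OF this f, of y]
  have "ift (\<lambda>\<xi>. m (- \<xi>)) (y - x) = ift m (x - y)" for x
    using ift_uminus[of m "y - x"] by simp
  then show "(LINT x|lborel. f x * ift m (x - y)) = ift (\<lambda>\<xi>. m (- \<xi>) * fourier f \<xi>) y"
    "integrable lborel (\<lambda>x. f x * ift m (x - y))" using * by (simp_all add: mult.commute)
qed

lemma borel_measurable_ift [measurable]:
  assumes [measurable]: "m \<in> borel_measurable borel"
  shows "ift m \<in> borel_measurable borel"
  unfolding ift_def by measurable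

lemma ift_add:
  assumes "integrable lborel m" "integrable lborel n"
  shows "ift (\<lambda>\<xi>. m \<xi> + n \<xi>) z = ift m z + ift n z"
proof -
  have *: "integrable lborel (\<lambda>\<xi>. exp (\<i> * of_real (\<xi> \<bullet> z)) * m \<xi>)" if m: "integrable lborel m" for m
  proof -
    have [measurable]: "m \<in> borel_measurable borel" using m by (simp add: integrable_iff_bounded)
    show ?thesis using m by (rule Bochner_Integration.integrable_bound) (auto simp: norm_mult)
  qed
  show ?thesis unfolding ift_def distrib_left
    by (simp only: Bochner_Integration.integral_add[OF assms[THEN *]] add_divide_distrib plus_complex.sel)
qed

lemma integrable_mult_fourier:
  assumes m: "integrable lborel m" and f: "integrable lborel f"
  shows "integrable lborel (\<lambda>\<xi>. m \<xi> * fourier f \<xi>)"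
proof -
  note [measurable] = borel_measurable_integrable[OF m] borel_measurable_integrable[OF f]
  have "norm (fourier f \<xi>) \<le> (LINT y|lborel. \<bar>f y\<bar>)" for \<xi>
    unfolding fourier_def using integral_norm_bound[of lborel "\<lambda>x. exp (- \<i> * of_real (\<xi> \<bullet> x)) * of_real (f x)"]
    by (simp add: norm_mult)
  moreover have "fourier f \<in> borel_measurable borel" unfolding fourier_def by measurable
  ultimately show ?thesis
    by (intro Bochner_Integration.integrable_bound[OF integrable_mult_left[OF integrable_norm[OF m], of "(LINT y|lborel. \<bar>f y\<bar>)"]])
      (auto simp: norm_mult abs_mult intro!: mult_left_mono intro: order_trans[OF _ abs_ge_self])
qed

lemma ift_scale: "ift (\<lambda>\<xi>. of_real a * m \<xi>) x = a * ift m x"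
proof -
  have "ift (\<lambda>\<xi>. of_real a * m \<xi>) x = Re (of_real a * ((LINT \<xi>|lborel. exp (\<i> * of_real (\<xi> \<bullet> x)) * m \<xi>) / of_real ((2 * pi) ^ 3)))"
    unfolding ift_def by (simp add: mult.left_commute[of _ "complex_of_real a"])
  moreover have "Re (of_real a * z) = a * Re z" for z by simp
  ultimately show ?thesis unfolding ift_def by metis
qed

lemma ift_sum:
  assumes "finite I" "\<And>i. i \<in> I \<Longrightarrow> integrable lborel (m i)"
  shows "ift (\<lambda>\<xi>. \<Sum>i\<in>I. m i \<xi>) x = (\<Sum>i\<in>I. ift (m i) x)"
  using assms
proof (induction I)
  case empty
  show ?case by (simp add: ift_def)
next
  case (insert i I)
  then show ?case using ift_add[of "m i" "\<lambda>\<xi>. \<Sum>i\<in>I. m i \<xi>" x] by simp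
qed

subsection \<open>The kernel of the multiplier\<close>

text \<open>The common Gaussian majorant. The kernel involves heat kernels at the times between
  \<open>\<tau>\<close> and \<open>c * \<tau>\<close>, and absorbing polynomial factors doubles the
  time; so \<open>2 * c * \<tau>\<close> dominates all of them.\<close>

definition kap :: "real \<Rightarrow> real \<Rightarrow> real^3 \<Rightarrow> real" where
  "kap c \<tau> z = heatD z3 (2 * c * \<tau>) z"

text \<open>With \<open>c = 1 + 1/\<epsilon>\<close>, the nonlocal part of the symbol is
  \<open>- \<xi>\<^sub>k \<xi>\<^sub>l / |\<xi>|\<^sup>2 (exp (- t |\<xi>|\<^sup>2) - exp (- c t |\<xi>|\<^sup>2)) = \<integral> (\<i> \<xi>\<^sub>k) (\<i> \<xi>\<^sub>l) exp (- s |\<xi>|\<^sup>2) ds\<close>, integrated over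
  \<open>t \<le> s \<le> c t\<close>; hence the kernel is an average of second derivatives of heat kernels. The extra index
  \<open>\<beta>\<close> differentiates the kernel, and \<open>ksym\<close> is the Fourier transform of \<open>ker\<close>.\<close>

definition havg :: "real \<Rightarrow> (3 \<Rightarrow> nat) \<Rightarrow> real \<Rightarrow> real^3 \<Rightarrow> real" where
  "havg c \<alpha> \<tau> z = (LINT s|lborel. indicator {\<tau>..c * \<tau>} s * heatD \<alpha> s z)"

definition gavg :: "real \<Rightarrow> (3 \<Rightarrow> nat) \<Rightarrow> real \<Rightarrow> real^3 \<Rightarrow> complex" where
  "gavg c \<alpha> \<tau> \<xi> = (LINT s|lborel. indicator {\<tau>..c * \<tau>} s *\<^sub>R gsym \<alpha> s \<xi>)"

definition ker :: "real \<Rightarrow> 3 \<Rightarrow> 3 \<Rightarrow> (3 \<Rightarrow> nat) \<Rightarrow> real \<Rightarrow> real^3 \<Rightarrow> real" where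
  "ker c k l \<beta> \<tau> z = (if k = l then heatD \<beta> \<tau> z else 0) + havg c (inc k (inc l \<beta>)) \<tau> z"

definition ksym :: "real \<Rightarrow> 3 \<Rightarrow> 3 \<Rightarrow> (3 \<Rightarrow> nat) \<Rightarrow> real \<Rightarrow> real^3 \<Rightarrow> complex" where
  "ksym c k l \<beta> \<tau> \<xi> = (if k = l then gsym \<beta> \<tau> \<xi> else 0) + gavg c (inc k (inc l \<beta>)) \<tau> \<xi>"

lemma borel_measurable_havg [measurable]:
  assumes [measurable]: "f \<in> borel_measurable M" "g \<in> borel_measurable M"
  shows "(\<lambda>p. havg c \<alpha> (f p) (g p)) \<in> borel_measurable M"
proof -
  have "havg c \<alpha> (f p) (g p) = (LINT s|lborel. (if f p \<le> s \<and> s \<le> c * f p then heatD \<alpha> s (g p) else 0))" for p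
    unfolding havg_def by (intro Bochner_Integration.integral_cong) (auto simp: indicator_def)
  then show ?thesis by simp
qed

lemma borel_measurable_gavg [measurable]:
  assumes [measurable]: "f \<in> borel_measurable M" "g \<in> borel_measurable M"
  shows "(\<lambda>p. gavg c \<alpha> (f p) (g p)) \<in> borel_measurable M"
proof -
  have "gavg c \<alpha> (f p) (g p) = (LINT s|lborel. (if f p \<le> s \<and> s \<le> c * f p then gsym \<alpha> s (g p) else 0))" for p
    unfolding gavg_def by (intro Bochner_Integration.integral_cong) (auto simp: indicator_def)
  then show ?thesis by simp
qed

lemma borel_measurable_ker [measurable]:
  assumes [measurable]: "f \<in> borel_measurable M" "g \<in> borel_measurable M"
  shows "(\<lambda>p. ker c k l \<beta> (f p) (g p)) \<in> borel_measurable M"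
  unfolding ker_def by measurable

lemma borel_measurable_kap [measurable]:
  assumes [measurable]: "f \<in> borel_measurable M" "g \<in> borel_measurable M"
  shows "(\<lambda>p. kap c (f p) (g p)) \<in> borel_measurable M"
  unfolding kap_def by measurable

lemma kap_nonneg: "c \<ge> 0 \<Longrightarrow> \<tau> \<ge> 0 \<Longrightarrow> kap c \<tau> z \<ge> 0"
  by (simp add: kap_def heatD_0_nonneg)

lemma integrable_kap: "c \<ge> 1 \<Longrightarrow> \<tau> > 0 \<Longrightarrow> integrable lborel (kap c \<tau>)"
  unfolding kap_def by (intro integrable_heatD) auto

lemma nn_integral_kap: "c \<ge> 1 \<Longrightarrow> \<tau> > 0 \<Longrightarrow> (\<integral>\<^sup>+z. ennreal (kap c \<tau> z) \<partial>lborel) = 1"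
proof -
  assume *: "c \<ge> 1" "\<tau> > 0"
  have "(LINT z|lborel. kap c \<tau> z) = 1"
    unfolding kap_def using * by (intro integral_heatD_0) auto
  then show ?thesis
    using nn_integral_eq_integral[OF integrable_kap[OF *]] * by (simp add: kap_nonneg)
qed

lemma kap_le:
  assumes "c \<ge> 1" "\<tau> > 0"
  shows "kap c \<tau> z \<le> (1 / sqrt \<tau>) ^ 3"
proof -
  have "he 0 (2 * c * \<tau>) x \<le> 1 / sqrt \<tau>" for x
  proof -
    have "1 \<le> 4 * pi * (2 * c)" using mult_mono[of 1 "4 * pi" 1 "2 * c"] pi_gt3 assms by simp
    then have "\<tau> \<le> 4 * pi * (2 * c * \<tau>)" using assms by (simp add: mult_le_cancel_right1 mult.assoc[symmetric])
    then have "sqrt \<tau> \<le> sqrt (4 * pi * (2 * c * \<tau>))" by simp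
    then show ?thesis using assms unfolding he.simps by (intro frac_le) auto
  qed
  then have "(\<Prod>k\<in>UNIV. he 0 (2 * c * \<tau>) (z $ k)) \<le> (\<Prod>k\<in>(UNIV::3 set). 1 / sqrt \<tau>)"
    using assms by (intro prod_mono) (auto simp: he.simps)
  then show ?thesis by (simp add: kap_def heatD_def)
qed

text \<open>For \<open>s \<le> c * \<tau>\<close> the exponential only grows when the time is raised
  from \<open>2 * s\<close> to \<open>2 * c * \<tau>\<close>. The normalisation shrinks, by at most
  \<open>sqrt c\<close> per coordinate since \<open>\<tau> \<le> s\<close>; hence the factor
  \<open>sqrt c ^ 3\<close>.\<close>

lemma heatD_le_kap:
  assumes c: "c \<ge> 1"
  obtains C where "C \<ge> 0" "\<And>\<tau> s z. 0 < \<tau> \<Longrightarrow> \<tau> \<le> s \<Longrightarrow> s \<le> c * \<tau> \<Longrightarrow>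
     \<bar>heatD \<alpha> s z\<bar> \<le> C * (1 / sqrt \<tau>) ^ (\<Sum>k\<in>UNIV. \<alpha> k) * kap c \<tau> z"
proof -
  obtain A where A: "A \<ge> 0" "\<And>s x. s > 0 \<Longrightarrow> \<bar>heatD \<alpha> s x\<bar> \<le> A * (1 / sqrt s) ^ (\<Sum>k\<in>UNIV. \<alpha> k) * heatD z3 (2 * s) x"
    using heatD_bound by blast
  have "\<bar>heatD \<alpha> s z\<bar> \<le> (A * sqrt c ^ 3) * (1 / sqrt \<tau>) ^ (\<Sum>k\<in>UNIV. \<alpha> k) * kap c \<tau> z"
    if \<tau>: "0 < \<tau>" "\<tau> \<le> s" "s \<le> c * \<tau>" for \<tau> s z
  proof -
    have 1: "he 0 (2 * s) x \<le> sqrt c * he 0 (2 * c * \<tau>) x" for x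
    proof -
      have "- x\<^sup>2 / (4 * (2 * s)) \<le> - x\<^sup>2 / (4 * (2 * c * \<tau>))"
        using \<tau> by (simp add: frac_le)
      then have e: "exp (- x\<^sup>2 / (4 * (2 * s))) \<le> exp (- x\<^sup>2 / (4 * (2 * c * \<tau>)))" by simp
      have "sqrt (4 * pi * (2 * c * \<tau>)) \<le> sqrt (c * (4 * pi * (2 * s)))"
        using \<tau> c by simp
      then have r: "1 / sqrt (4 * pi * (2 * s)) \<le> sqrt c / sqrt (4 * pi * (2 * c * \<tau>))"
        using \<tau> c by (simp add: real_sqrt_mult field_simps)
      show ?thesis using mult_mono[OF e r] \<tau> by (simp add: he.simps mult_ac)
    qed
    have "heatD z3 (2 * s) z \<le> (\<Prod>k\<in>UNIV. sqrt c * he 0 (2 * c * \<tau>) (z $ k))"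
      unfolding heatD_def using 1 \<tau> by (intro prod_mono) (auto simp: he.simps)
    also have "\<dots> = sqrt c ^ 3 * kap c \<tau> z" by (simp add: kap_def heatD_def prod.distrib)
    finally have 2: "heatD z3 (2 * s) z \<le> sqrt c ^ 3 * kap c \<tau> z" .
    have 3: "(1 / sqrt s) ^ n \<le> (1 / sqrt \<tau>) ^ n" for n
      using \<tau> by (intro power_mono frac_le) auto
    have "A * (1 / sqrt s) ^ (\<Sum>k\<in>UNIV. \<alpha> k) * heatD z3 (2 * s) z
      \<le> A * (1 / sqrt \<tau>) ^ (\<Sum>k\<in>UNIV. \<alpha> k) * (sqrt c ^ 3 * kap c \<tau> z)"
      using 2 3 A(1) \<tau> heatD_0_nonneg[of "2 * s"] by (intro mult_mono mult_left_mono mult_nonneg_nonneg) auto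
    then show ?thesis using A(2)[of s z] \<tau> by (simp add: mult_ac)
  qed
  moreover have "A * sqrt c ^ 3 \<ge> 0" using A(1) c by simp
  ultimately show ?thesis using that by blast
qed

lemma integrable_havg_pair:
  assumes "c \<ge> 1" "\<tau> > 0"
  shows "integrable (lborel \<Otimes>\<^sub>M lborel) (\<lambda>(s, z). indicator {\<tau>..c * \<tau>} s * heatD \<alpha> s z)"
proof -
  obtain A where A: "A \<ge> 0" "\<And>s z. \<tau> \<le> s \<Longrightarrow> s \<le> c * \<tau> \<Longrightarrow>
     \<bar>heatD \<alpha> s z\<bar> \<le> A * (1 / sqrt \<tau>) ^ (\<Sum>k\<in>UNIV. \<alpha> k) * kap c \<tau> z"
    using heatD_le_kap[OF assms(1)] assms(2) by metis
  let ?B = "A * (1 / sqrt \<tau>) ^ (\<Sum>k\<in>UNIV. \<alpha> k)"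
  have "integrable (lborel \<Otimes>\<^sub>M lborel) (\<lambda>(s, z). indicator {\<tau>..c * \<tau>} s * (?B * kap c \<tau> z))"
  proof (intro lborel_pair.Fubini_integrable)
    have i: "integrable lborel (\<lambda>s::real. indicator {\<tau>..c * \<tau>} s :: real)"
      by (rule integrable_real_indicator) (auto simp: emeasure_lborel_Icc_eq)
    have "(\<lambda>s. LINT z|lborel. norm (case (s, z) of (s, z) \<Rightarrow> indicator {\<tau>..c * \<tau>} s * (?B * kap c \<tau> z)))
       = (\<lambda>s. indicator {\<tau>..c * \<tau>} s * (LINT z|lborel. norm (?B * kap c \<tau> z)))"
      by (simp add: abs_mult)
    then show "integrable lborel (\<lambda>s. LINT z|lborel. norm (case (s, z) of (s, z) \<Rightarrow> indicator {\<tau>..c * \<tau>} s * (?B * kap c \<tau> z)))"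
      using i by (simp only: integrable_mult_left)
    show "AE s in lborel. integrable lborel (\<lambda>z. case (s, z) of (s, z) \<Rightarrow> indicator {\<tau>..c * \<tau>} s * (?B * kap c \<tau> z))"
      using integrable_kap[OF assms] by simp
  qed measurable
  then show ?thesis
    by (rule Bochner_Integration.integrable_bound)
      (auto simp: indicator_def split_beta intro!: AE_I2 order_trans[OF A(2) abs_ge_self])
qed

lemma havg_bound:
  assumes c: "c \<ge> 1"
  obtains C where "C \<ge> 0" "\<And>\<tau> z. 0 < \<tau> \<Longrightarrow>
     \<bar>havg c \<alpha> \<tau> z\<bar> \<le> C * \<tau> * (1 / sqrt \<tau>) ^ (\<Sum>k\<in>UNIV. \<alpha> k) * kap c \<tau> z"
proof -
  obtain A where A: "A \<ge> 0" "\<And>\<tau> s z. 0 < \<tau> \<Longrightarrow> \<tau> \<le> s \<Longrightarrow> s \<le> c * \<tau> \<Longrightarrow>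
     \<bar>heatD \<alpha> s z\<bar> \<le> A * (1 / sqrt \<tau>) ^ (\<Sum>k\<in>UNIV. \<alpha> k) * kap c \<tau> z"
    using heatD_le_kap[OF assms(1)] by metis
  have "\<bar>havg c \<alpha> \<tau> z\<bar> \<le> A * (c - 1) * \<tau> * (1 / sqrt \<tau>) ^ (\<Sum>k\<in>UNIV. \<alpha> k) * kap c \<tau> z" if \<tau>: "0 < \<tau>" for \<tau> z
  proof -
    let ?B = "A * (1 / sqrt \<tau>) ^ (\<Sum>k\<in>UNIV. \<alpha> k) * kap c \<tau> z"
    have B: "?B \<ge> 0" using A(1) kap_nonneg[of c \<tau> z] c \<tau> by simp
    have "norm (havg c \<alpha> \<tau> z) \<le> (LINT s|lborel. indicator {\<tau>..c * \<tau>} s * ?B)"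
      unfolding havg_def
    proof (rule order_trans[OF integral_norm_bound integral_mono'])
      show "integrable lborel (\<lambda>s. indicator {\<tau>..c * \<tau>} s * ?B)"
        by (intro integrable_mult_left integrable_real_indicator) (auto simp: emeasure_lborel_Icc_eq)
    qed (use A(2) \<tau> B in \<open>auto simp: indicator_def\<close>)
    also have "\<dots> = (c - 1) * \<tau> * ?B" using c \<tau> by (simp add: algebra_simps)
    finally show ?thesis by (simp add: mult_ac)
  qed
  then show ?thesis using that[of "A * (c - 1)"] A(1) c by simp
qed

text \<open>The nonlocal part carries two more derivatives, which cost \<open>1 / \<tau>\<close>,
  but it is an integral over a time interval of length \<open>(c - 1) * \<tau>\<close>. The two
  effects cancel, so the kernel scales exactly like the heat kernel.\<close>

lemma ker_bound:
  assumes c: "c \<ge> 1"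
  obtains C where "C \<ge> 0" "\<And>\<tau> z. 0 < \<tau> \<Longrightarrow>
     \<bar>ker c k l \<beta> \<tau> z\<bar> \<le> C * (1 / sqrt \<tau>) ^ (\<Sum>k\<in>UNIV. \<beta> k) * kap c \<tau> z"
proof -
  obtain A where A: "A \<ge> 0" "\<And>\<tau> s z. 0 < \<tau> \<Longrightarrow> \<tau> \<le> s \<Longrightarrow> s \<le> c * \<tau> \<Longrightarrow>
     \<bar>heatD \<beta> s z\<bar> \<le> A * (1 / sqrt \<tau>) ^ (\<Sum>k\<in>UNIV. \<beta> k) * kap c \<tau> z"
    using heatD_le_kap[OF assms(1)] by metis
  obtain B where B: "B \<ge> 0" "\<And>\<tau> z. 0 < \<tau> \<Longrightarrow> \<bar>havg c (inc k (inc l \<beta>)) \<tau> z\<bar>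
      \<le> B * \<tau> * (1 / sqrt \<tau>) ^ (\<Sum>j\<in>UNIV. inc k (inc l \<beta>) j) * kap c \<tau> z"
    using havg_bound[OF assms(1)] by metis
  have "\<bar>ker c k l \<beta> \<tau> z\<bar> \<le> (A + B) * (1 / sqrt \<tau>) ^ (\<Sum>k\<in>UNIV. \<beta> k) * kap c \<tau> z" if \<tau>: "0 < \<tau>" for \<tau> z
  proof -
    let ?r = "(1 / sqrt \<tau>) ^ (\<Sum>k\<in>UNIV. \<beta> k) * kap c \<tau> z"
    have "\<tau> * ((1 / sqrt \<tau>) * (1 / sqrt \<tau>)) = 1" using \<tau> by simp
    moreover have "(\<Sum>j\<in>UNIV. inc k (inc l \<beta>) j) = Suc (Suc (\<Sum>k\<in>UNIV. \<beta> k))"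
      by (rule trans[OF sum_inc]) (simp add: sum_inc)
    ultimately have eq: "B * \<tau> * (1 / sqrt \<tau>) ^ (\<Sum>j\<in>UNIV. inc k (inc l \<beta>) j) * kap c \<tau> z = B * ?r"
      using \<tau> by (simp add: mult_ac)
    have "\<bar>havg c (inc k (inc l \<beta>)) \<tau> z\<bar> \<le> B * ?r" using B(2)[OF \<tau>, of z] unfolding eq .
    moreover have "\<bar>if k = l then heatD \<beta> \<tau> z else 0\<bar> \<le> A * ?r"
      using A(2)[of \<tau> \<tau> z] \<tau> c A(1) kap_nonneg[of c \<tau> z] by (auto simp: mult_ac)
    ultimately have "\<bar>ker c k l \<beta> \<tau> z\<bar> \<le> A * ?r + B * ?r"
      unfolding ker_def by linarith
    then show ?thesis by (simp add: algebra_simps)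
  qed
  then show ?thesis using that[of "A + B"] A(1) B(1) by simp
qed

lemma integral_havg_inc:
  assumes "c \<ge> 1" "\<tau> > 0"
  shows "(LINT z|lborel. havg c (inc j \<alpha>) \<tau> z) = 0"
proof -
  have "(LINT z|lborel. havg c (inc j \<alpha>) \<tau> z) = (LINT s|lborel. (LINT z|lborel. indicator {\<tau>..c * \<tau>} s * heatD (inc j \<alpha>) s z))"
    unfolding havg_def using lborel_pair.Fubini_integral[OF integrable_havg_pair[OF assms, of "inc j \<alpha>"]] .
  also have "\<dots> = (LINT s|(lborel::real measure). 0)"
  proof (rule Bochner_Integration.integral_cong)
    fix s :: real
    show "(LINT z|lborel. indicator {\<tau>..c * \<tau>} s * heatD (inc j \<alpha>) s z) = 0"
      using integral_heatD_inc[of s j \<alpha>] assms by (cases "s > 0") (auto simp: indicator_def)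
  qed simp
  finally show ?thesis by simp
qed

lemma integrable_ker: "c \<ge> 1 \<Longrightarrow> \<tau> > 0 \<Longrightarrow> integrable lborel (ker c k l \<beta> \<tau>)"
proof -
  assume c: "c \<ge> 1" and \<tau>: "\<tau> > 0"
  obtain A where A: "A \<ge> 0" "\<And>z. \<bar>ker c k l \<beta> \<tau> z\<bar> \<le> A * (1 / sqrt \<tau>) ^ (\<Sum>k\<in>UNIV. \<beta> k) * kap c \<tau> z"
    using ker_bound[OF c] \<tau> by metis
  show ?thesis
    by (rule Bochner_Integration.integrable_bound[OF integrable_mult_right[OF integrable_kap[OF c \<tau>]]])
      (use A(2) order_trans[OF _ abs_ge_self] in auto)
qed

lemma integral_ker_0:
  assumes "c \<ge> 1" "\<tau> > 0"
  shows "(LINT z|lborel. ker c k l z3 \<tau> z) = (if k = l then 1 else 0)"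
proof -
  have 1: "integrable lborel (\<lambda>z. if k = l then heatD z3 \<tau> z else 0)"
    using integrable_heatD[OF assms(2), of "\<lambda>_. 0"] by (cases "k = l") simp_all
  have "havg c (inc k (inc l z3)) \<tau> z = ker c k l z3 \<tau> z - (if k = l then heatD z3 \<tau> z else 0)" for z
    by (simp add: ker_def)
  then have "integrable lborel (havg c (inc k (inc l z3)) \<tau>)"
    using Bochner_Integration.integrable_diff[OF integrable_ker[OF assms, of k l "\<lambda>_. 0"] 1] by (simp cong: Bochner_Integration.integrable_cong)
  then show ?thesis unfolding ker_def
    using 1 by (simp add: integral_havg_inc[OF assms] integral_heatD_0[OF assms(2)])
qed

lemma norm_gsym_mono: "\<tau> \<le> s \<Longrightarrow> norm (gsym \<alpha> s \<xi>) \<le> norm (gsym \<alpha> \<tau> \<xi>)"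
  by (auto simp: gsym_def norm_mult intro!: mult_left_mono mult_right_mono)

lemma integrable_gavg_pair:
  assumes "\<tau> > 0"
  shows "integrable (lborel \<Otimes>\<^sub>M lborel) (\<lambda>(s, \<xi>). indicator {\<tau>..c * \<tau>} s *\<^sub>R gsym \<alpha> s \<xi>)"
proof -
  have "integrable (lborel \<Otimes>\<^sub>M lborel) (\<lambda>(s, \<xi>). indicator {\<tau>..c * \<tau>} s * norm (gsym \<alpha> \<tau> \<xi>))"
  proof (intro lborel_pair.Fubini_integrable)
    have i: "integrable lborel (\<lambda>s::real. indicator {\<tau>..c * \<tau>} s :: real)"
      by (rule integrable_real_indicator) (auto simp: emeasure_lborel_Icc_eq)
    have "(\<lambda>s. LINT z|lborel. norm (case (s, z) of (s, z) \<Rightarrow> indicator {\<tau>..c * \<tau>} s * norm (gsym \<alpha> \<tau> z)))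
       = (\<lambda>s. indicator {\<tau>..c * \<tau>} s * (LINT z|lborel. norm (gsym \<alpha> \<tau> z)))"
      by (simp add: abs_mult)
    then show "integrable lborel (\<lambda>s. LINT z|lborel. norm (case (s, z) of (s, z) \<Rightarrow> indicator {\<tau>..c * \<tau>} s * norm (gsym \<alpha> \<tau> z)))"
      using i by (simp only: integrable_mult_left)
    show "AE s in lborel. integrable lborel (\<lambda>z. case (s, z) of (s, z) \<Rightarrow> indicator {\<tau>..c * \<tau>} s * norm (gsym \<alpha> \<tau> z))"
      using integrable_gsym[OF assms] by simp
  qed measurable
  then show ?thesis
    by (rule Bochner_Integration.integrable_bound)
      (auto simp: indicator_def intro!: norm_gsym_mono)
qed

lemma integrable_gavg:
  assumes "\<tau> > 0"
  shows "integrable lborel (gavg c \<alpha> \<tau>)"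
  unfolding gavg_def using lborel_pair.integrable_snd[OF integrable_gavg_pair[OF assms]] by simp

lemma integrable_ksym: "\<tau> > 0 \<Longrightarrow> integrable lborel (ksym c k l \<beta> \<tau>)"
  unfolding ksym_def using integrable_gavg[of \<tau> c] integrable_gsym[of \<tau> \<beta>] by (cases "k = l") simp_all

lemma ift_gavg:
  assumes "\<tau> > 0"
  shows "ift (gavg c \<alpha> \<tau>) z = havg c \<alpha> \<tau> z"
proof -
  let ?g = "\<lambda>(s, \<xi>). exp (\<i> * of_real (\<xi> \<bullet> z)) * (indicator {\<tau>..c * \<tau>} s *\<^sub>R gsym \<alpha> s \<xi>)"
  have g: "integrable (lborel \<Otimes>\<^sub>M lborel) ?g"
    by (rule Bochner_Integration.integrable_bound[OF integrable_gavg_pair[OF assms, of c \<alpha>]])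
      (auto simp: norm_mult)
  have "integrable lborel (\<lambda>s. LINT \<xi>|lborel. ?g (s, \<xi>))"
    using lborel_pair.integrable_fst[of "\<lambda>s \<xi>. ?g (s, \<xi>)"] g by (simp add: case_prod_beta)
  then have int: "integrable lborel (\<lambda>s. (LINT \<xi>|lborel. ?g (s, \<xi>)) / of_real ((2 * pi) ^ 3))"
    by (rule integrable_divide_zero)
  have F: "exp (\<i> * of_real (\<xi> \<bullet> z)) * gavg c \<alpha> \<tau> \<xi> = (LINT s|lborel. ?g (s, \<xi>))" for \<xi>
    unfolding gavg_def integral_mult_right_zero[symmetric] by (simp only: prod.case)
  have "ift (gavg c \<alpha> \<tau>) z = Re ((LINT \<xi>|lborel. (LINT s|lborel. ?g (s, \<xi>))) / of_real ((2 * pi) ^ 3))"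
    unfolding ift_def F ..
  also have "(LINT \<xi>|lborel. (LINT s|lborel. ?g (s, \<xi>))) = (LINT s|lborel. (LINT \<xi>|lborel. ?g (s, \<xi>)))"
    using lborel_pair.Fubini_integral[of "\<lambda>s \<xi>. ?g (s, \<xi>)"] g by (simp add: case_prod_beta)
  also have "Re (\<dots> / of_real ((2 * pi) ^ 3)) = Re (LINT s|lborel. (LINT \<xi>|lborel. ?g (s, \<xi>)) / of_real ((2 * pi) ^ 3))"
    by simp
  also have "\<dots> = (LINT s|lborel. Re ((LINT \<xi>|lborel. ?g (s, \<xi>)) / of_real ((2 * pi) ^ 3)))"
    using int by (rule Re_integral[symmetric])
  also have "\<dots> = havg c \<alpha> \<tau> z"
    unfolding havg_def
  proof (rule Bochner_Integration.integral_cong)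
    fix s :: real
    have "Re ((LINT \<xi>|lborel. ?g (s, \<xi>)) / of_real ((2 * pi) ^ 3)) = indicator {\<tau>..c * \<tau>} s * ift (gsym \<alpha> s) z"
      unfolding ift_def by (auto simp: indicator_def)
    also have "\<dots> = indicator {\<tau>..c * \<tau>} s * heatD \<alpha> s z"
      using assms by (auto simp: indicator_def ift_gsym)
    finally show "Re ((LINT \<xi>|lborel. ?g (s, \<xi>)) / of_real ((2 * pi) ^ 3)) = indicator {\<tau>..c * \<tau>} s * heatD \<alpha> s z" .
  qed simp
  finally show ?thesis .
qed

lemma ift_ksym:
  assumes "\<tau> > 0"
  shows "ift (ksym c k l \<beta> \<tau>) z = ker c k l \<beta> \<tau> z"
proof (cases "k = l")
  case True
  then have "ksym c k l \<beta> \<tau> = (\<lambda>\<xi>. gsym \<beta> \<tau> \<xi> + gavg c (inc k (inc l \<beta>)) \<tau> \<xi>)" by (auto simp: ksym_def)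
  then show ?thesis
    using ift_add[OF integrable_gsym[OF assms] integrable_gavg[OF assms]] True
    by (simp add: ker_def ift_gsym ift_gavg assms)
next
  case False
  then have "ksym c k l \<beta> \<tau> = gavg c (inc k (inc l \<beta>)) \<tau>" by (auto simp: ksym_def)
  then show ?thesis using False by (simp add: ker_def ift_gavg assms)
qed

lemma ksym_inc: "ksym c k l (inc m \<beta>) \<tau> \<xi> = \<i> * of_real (\<xi> $ m) * ksym c k l \<beta> \<tau> \<xi>"
proof -
  have "inc k (inc l (inc m \<beta>)) = inc m (inc k (inc l \<beta>))"
    by (metis inc_commute)
  moreover have "gavg c (inc m \<alpha>) \<tau> \<xi> = \<i> * of_real (\<xi> $ m) * gavg c \<alpha> \<tau> \<xi>" for \<alpha>
    unfolding gavg_def gsym_inc integral_mult_right_zero[symmetric] by simp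
  ultimately show ?thesis by (simp add: ksym_def gsym_inc algebra_simps)
qed

lemma gavg_inc_inc:
  assumes "\<tau> > 0" "c \<ge> 1"
  shows "gavg c (inc k (inc l z3)) \<tau> \<xi> = of_real (- (\<xi> $ k * \<xi> $ l / (norm \<xi>)\<^sup>2 *
     (exp (- \<tau> * (norm \<xi>)\<^sup>2) - exp (- (c * \<tau>) * (norm \<xi>)\<^sup>2))))"
proof (cases "\<xi> = 0")
  \<comment> \<open>At the origin both sides vanish: the left because of the factors
    \<open>\<xi> $ k\<close> and \<open>\<xi> $ l\<close>, the right because
    \<open>0 / 0 = 0\<close>.\<close>
  case True
  then show ?thesis by (simp add: gavg_def gsym_inc)
next
  case False
  define n where "n = (norm \<xi>)\<^sup>2"
  have n: "n > 0" using False by (simp add: n_def)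
  have "(LINT s|lborel. indicator {\<tau>..c * \<tau>} s *\<^sub>R exp (- s * n)) = - exp (- (c * \<tau>) * n) / n - (- exp (- \<tau> * n) / n)"
    by (rule integral_FTC_Icc)
      (use assms n in \<open>auto intro!: derivative_eq_intros continuous_intros
        simp: has_real_derivative_iff_has_vector_derivative[symmetric]\<close>)
  then have 1: "(LINT s|lborel. indicator {\<tau>..c * \<tau>} s * exp (- s * n)) = (exp (- \<tau> * n) - exp (- (c * \<tau>) * n)) / n"
    by (simp add: diff_divide_distrib)
  have "gavg c (inc k (inc l z3)) \<tau> \<xi> = (LINT s|lborel. complex_of_real (- (\<xi> $ k * \<xi> $ l) * (indicator {\<tau>..c * \<tau>} s * exp (- s * n))))"
    unfolding gavg_def by (intro Bochner_Integration.integral_cong)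
      (auto simp: gsym_inc gsym_0 n_def indicator_def complex_eq_iff)
  also have "\<dots> = complex_of_real (LINT s|lborel. - (\<xi> $ k * \<xi> $ l) * (indicator {\<tau>..c * \<tau>} s * exp (- s * n)))"
    by (rule integral_complex_of_real)
  finally show ?thesis unfolding integral_mult_right_zero 1 by (simp add: n_def)
qed

lemma ksym_0_eq_symbol:
  assumes "\<tau> > 0" "\<epsilon> > 0"
  shows "ksym (1 + 1 / \<epsilon>) k l z3 \<tau> \<xi> = of_real (symbol \<epsilon> \<tau> \<xi> $ k $ l)"
proof -
  have e: "exp (- ((1 + 1 / \<epsilon>) * \<tau>) * (norm \<xi>)\<^sup>2) = exp (- \<tau> * (norm \<xi>)\<^sup>2) * exp (- \<tau> * (norm \<xi>)\<^sup>2 / \<epsilon>)"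
    by (simp add: algebra_simps flip: exp_add)
  have alg: "(if b then E else 0) + - (a * (E - E * F)) = E * ((if b then 1 else 0) - a * (1 - F))"
    for a E F :: real and b by (simp add: algebra_simps)
  have "(if k = l then exp (- \<tau> * (norm \<xi>)\<^sup>2) else 0) + - (\<xi> $ k * \<xi> $ l / (norm \<xi>)\<^sup>2 *
     (exp (- \<tau> * (norm \<xi>)\<^sup>2) - exp (- ((1 + 1 / \<epsilon>) * \<tau>) * (norm \<xi>)\<^sup>2))) = symbol \<epsilon> \<tau> \<xi> $ k $ l"
    unfolding symbol_def vec_lambda_beta e alg ..
  then have eq: "of_real (symbol \<epsilon> \<tau> \<xi> $ k $ l) = complex_of_real ((if k = l then exp (- \<tau> * (norm \<xi>)\<^sup>2) else 0) + - (\<xi> $ k * \<xi> $ l / (norm \<xi>)\<^sup>2 *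
     (exp (- \<tau> * (norm \<xi>)\<^sup>2) - exp (- ((1 + 1 / \<epsilon>) * \<tau>) * (norm \<xi>)\<^sup>2))))"
    by (rule arg_cong[OF sym])
  have c: "1 + 1 / \<epsilon> \<ge> 1" using assms by simp
  show ?thesis
    unfolding eq ksym_def gsym_0 gavg_inc_inc[OF assms(1) c] of_real_add by simp
qed

subsection \<open>Test functions\<close>

lemma continuous_compact_support:
  fixes f :: "'a::euclidean_space \<Rightarrow> real"
  assumes "continuous_on UNIV f" "compact S" "\<And>x. x \<notin> S \<Longrightarrow> f x = 0"
  shows "integrable lborel f" and "\<exists>B. \<forall>x. \<bar>f x\<bar> \<le> B"
proof -
  have "(\<lambda>x. indicator S x *\<^sub>R f x) = f" using assms(3) by (auto simp: fun_eq_iff indicator_def)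
  then show "integrable lborel f"
    using borel_integrable_compact[OF assms(2), of f] continuous_on_subset[OF assms(1)] by auto
  have "compact (f ` S)" using assms(1,2) by (meson compact_continuous_image continuous_on_subset top_greatest)
  then obtain B where "\<forall>y\<in>f ` S. \<bar>y\<bar> \<le> B" using compact_imp_bounded by (metis bounded_iff real_norm_def)
  then have "\<bar>f x\<bar> \<le> max B 0" for x using assms(3)[of x] by (cases "x \<in> S") (auto simp: le_max_iff_disj)
  then show "\<exists>B. \<forall>x. \<bar>f x\<bar> \<le> B" by blast
qed

lemma integrable_bounded_scaleR:
  fixes f :: "'a::euclidean_space \<Rightarrow> 'z::euclidean_space"
  assumes f: "integrable lborel f" and [measurable]: "\<psi> \<in> borel_measurable borel" and M: "\<And>x. \<bar>\<psi> x\<bar> \<le> M"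
  shows "integrable lborel (\<lambda>x. \<psi> x *\<^sub>R f x)"
proof -
  note [measurable] = borel_measurable_integrable[OF f]
  show ?thesis
    by (rule Bochner_Integration.integrable_bound[OF integrable_scaleR_right[OF f, of M]])
      (auto intro!: AE_I2 mult_right_mono order_trans[OF M abs_ge_self])
qed

lemma test_function_imp:
  assumes "test_function \<phi>"
  shows "continuous_on UNIV \<phi>" "integrable lborel \<phi>" "\<exists>B. \<forall>x. \<bar>\<phi> x\<bar> \<le> B"
proof -
  have d: "\<phi> differentiable (at x)" for x
    using assms unfolding test_function_def by (metis foldr.simps(1) id_apply)
  show c: "continuous_on UNIV \<phi>"
    using d by (simp add: continuous_at_imp_continuous_on differentiable_imp_continuous_within)
  have *: "compact (closure {x. \<phi> x \<noteq> 0})" "\<And>x. x \<notin> closure {x. \<phi> x \<noteq> 0} \<Longrightarrow> \<phi> x = 0"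
    using assms closure_subset[of "{x. \<phi> x \<noteq> 0}"] by (auto simp: test_function_def)
  show "integrable lborel \<phi>" "\<exists>B. \<forall>x. \<bar>\<phi> x\<bar> \<le> B"
    using continuous_compact_support[OF c *] by auto
qed

lemma test_function_has_derivative_axis:
  assumes "test_function \<phi>"
  shows "((\<lambda>h. \<phi> (x + h *\<^sub>R axis j 1)) has_real_derivative partial j \<phi> (x + r *\<^sub>R axis j 1)) (at r)"
proof -
  have d: "\<phi> differentiable (at x)" for x
    using assms unfolding test_function_def by (metis foldr.simps(1) id_apply)
  have "(\<lambda>h. \<phi> (y + h *\<^sub>R axis j 1)) differentiable (at r)" for y r
    using differentiable_chain_at[of "\<lambda>h. y + h *\<^sub>R axis j 1" r \<phi>] d by (simp add: o_def)
  then have D: "((\<lambda>h. \<phi> (y + h *\<^sub>R axis j 1)) has_real_derivative deriv (\<lambda>h. \<phi> (y + h *\<^sub>R axis j 1)) r) (at r)" for y r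
    using real_differentiable_def DERIV_deriv_iff_real_differentiable by blast
  have "(\<lambda>h. \<phi> (x + r *\<^sub>R axis j 1 + h *\<^sub>R axis j 1)) = (\<lambda>h. \<phi> (x + (h + r) *\<^sub>R axis j 1))"
    by (simp add: algebra_simps)
  then have "((\<lambda>h. \<phi> (x + (h + r) *\<^sub>R axis j 1)) has_real_derivative partial j \<phi> (x + r *\<^sub>R axis j 1)) (at 0)"
    using D[of "x + r *\<^sub>R axis j 1" 0] unfolding partial_def by simp
  then show ?thesis using DERIV_at_within_shift[of "\<lambda>h. \<phi> (x + h *\<^sub>R axis j 1)" _ r 0 UNIV]
    DERIV_shift[of "\<lambda>h. \<phi> (x + h *\<^sub>R axis j 1)" _ 0 r] by simp
qed

text \<open>An extra derivative goes to the inner end of the list of directions, and the closed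
  support does not grow: off the closure, \<open>\<phi>\<close> vanishes on a whole
  neighbourhood.\<close>

lemma test_function_partial:
  assumes "test_function \<phi>"
  shows "test_function (partial j \<phi>)"
proof -
  have "foldr partial js (partial j \<phi>) = foldr partial (js @ [j]) \<phi>" for js by simp
  then have 1: "foldr partial js (partial j \<phi>) differentiable (at x)" for js x
    using assms unfolding test_function_def by presburger
  have "partial j \<phi> x = 0" if "x \<notin> closure {x. \<phi> x \<noteq> 0}" for x
  proof -
    let ?U = "- closure {x. \<phi> x \<noteq> 0}"
    have U: "open ?U" "x \<in> ?U" using that by auto
    have "open ((\<lambda>h. x + h *\<^sub>R axis j 1) -` ?U)"
      by (intro continuous_open_vimage U continuous_intros)
    then have "eventually (\<lambda>h. h \<in> (\<lambda>h. x + h *\<^sub>R axis j 1) -` ?U) (nhds 0)"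
      using U(2) by (intro eventually_nhds_in_open) auto
    then have "eventually (\<lambda>h. \<phi> (x + h *\<^sub>R axis j 1) = 0) (nhds 0)"
      by eventually_elim (use closure_subset[of "{x. \<phi> x \<noteq> 0}"] in auto)
    then show ?thesis unfolding partial_def by (simp add: deriv_cong_ev[where g="\<lambda>_. 0"])
  qed
  then have "{x. partial j \<phi> x \<noteq> 0} \<subseteq> closure {x. \<phi> x \<noteq> 0}" by auto
  then have "closure {x. partial j \<phi> x \<noteq> 0} \<subseteq> closure {x. \<phi> x \<noteq> 0}"
    by (simp add: closure_minimal)
  then have "compact (closure {x. partial j \<phi> x \<noteq> 0})"
    using assms unfolding test_function_def by (metis closed_closure compact_Int_closed inf.absorb2)
  then show ?thesis using 1 unfolding test_function_def by blast
qed

lemma fourier_partial: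
  assumes "test_function \<phi>"
  shows "fourier (partial j \<phi>) \<xi> = \<i> * of_real (\<xi> $ j) * fourier \<phi> \<xi>"
proof -
  note t = test_function_imp[OF assms] test_function_imp[OF test_function_partial[OF assms, of j]]
  let ?e = "\<lambda>x. exp (- \<i> * of_real (\<xi> \<bullet> x))"
  have int: "integrable lborel (\<lambda>x. ?e x * of_real (f x))" if f: "integrable lborel f" for f
  proof -
    have [measurable]: "f \<in> borel_measurable borel" using f by (simp add: integrable_iff_bounded)
    show ?thesis by (rule Bochner_Integration.integrable_bound[OF f]) (auto simp: norm_mult)
  qed
  have "(LINT x|lborel. ?e x * of_real (partial j \<phi> x) - (\<i> * of_real (\<xi> $ j)) * (?e x * of_real (\<phi> x))) = 0"
  proof (rule integral_directional_derivative_eq_0[where f="\<lambda>x. ?e x * of_real (\<phi> x)" and e="axis j 1"])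
    show "continuous_on UNIV (\<lambda>x. ?e x * of_real (partial j \<phi> x) - (\<i> * of_real (\<xi> $ j)) * (?e x * of_real (\<phi> x)))"
      by (intro continuous_intros t)
    fix x :: "real^3" and r :: real
    let ?y = "x + r *\<^sub>R axis j 1"
    have "((\<lambda>z. exp (- \<i> * (of_real (\<xi> \<bullet> x) + of_real (\<xi> $ j) * z))) has_field_derivative - \<i> * of_real (\<xi> $ j) * exp (- \<i> * (of_real (\<xi> \<bullet> x) + of_real (\<xi> $ j) * of_real r))) (at (of_real r))"
      by (auto intro!: derivative_eq_intros)
    from has_vector_derivative_real_field[OF this]
    have e: "((\<lambda>h. ?e (x + h *\<^sub>R axis j 1)) has_vector_derivative - \<i> * of_real (\<xi> $ j) * ?e ?y) (at r)"
      by (simp add: inner_add_right inner_axis mult.commute[of _ "\<xi> $ j"])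
    show "((\<lambda>h. ?e (x + h *\<^sub>R axis j 1) * of_real (\<phi> (x + h *\<^sub>R axis j 1))) has_vector_derivative
        (?e ?y * of_real (partial j \<phi> ?y) - (\<i> * of_real (\<xi> $ j)) * (?e ?y * of_real (\<phi> ?y)))) (at r)"
      using has_vector_derivative_mult[OF e has_vector_derivative_of_real[OF test_function_has_derivative_axis[OF assms, of x j r]]]
      by (simp add: algebra_simps)
  qed (intro Bochner_Integration.integrable_diff integrable_mult_right int t)+
  then show ?thesis unfolding fourier_def using int[OF t(2)] int[OF t(5)]
    by (simp only: Bochner_Integration.integral_diff integrable_mult_right integral_mult_right_zero) simp
qed

text \<open>Both pairings are read off on the Fourier side, where integration by parts becomes the
  identity \<open>m' (- \<xi>) = - \<i> * \<xi>\<^sub>j * m (- \<xi>)\<close>. This avoids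
  differentiating the averaged kernel under its integral.\<close>

lemma ift_weak_derivative:
  assumes \<phi>: "test_function \<phi>" and m: "integrable lborel m" "integrable lborel m'"
    and m': "\<And>\<xi>. m' \<xi> = \<i> * of_real (\<xi> $ j) * m \<xi>"
  shows "(LINT x|lborel. partial j \<phi> x * ift m (x - y)) = - (LINT x|lborel. \<phi> x * ift m' (x - y))"
proof -
  note t = test_function_imp[OF \<phi>] test_function_imp[OF test_function_partial[OF \<phi>, of j]]
  have *: "(\<lambda>\<xi>. m (- \<xi>) * fourier (partial j \<phi>) \<xi>) = (\<lambda>\<xi>. - (m' (- \<xi>) * fourier \<phi> \<xi>))"
    by (simp add: fourier_partial[OF \<phi>] m' mult_ac)
  have "ift (\<lambda>\<xi>. - f \<xi>) y = - ift f y" for f by (simp add: ift_def)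
  then show ?thesis
    unfolding integral_mult_ift(1)[OF m(1) t(5)] integral_mult_ift(1)[OF m(2) t(2)] * .
qed

lemma ker_weak_derivative:
  assumes "test_function \<phi>" "\<tau> > 0"
  shows "(LINT x|lborel. partial j \<phi> x * ker c k l \<beta> \<tau> (x - y)) = - (LINT x|lborel. \<phi> x * ker c k l (inc j \<beta>) \<tau> (x - y))"
  using ift_weak_derivative[OF assms(1) integrable_ksym[OF assms(2)] integrable_ksym[OF assms(2)] ksym_inc]
  by (simp add: ift_ksym assms)

lemma multiplier_eq_conv:
  assumes "t > 0" "\<epsilon> > 0" and f: "integrable lborel f"
  shows "multiplier \<epsilon> t f x $ k = (\<Sum>l\<in>UNIV. (LINT y|lborel. ker (1 + 1 / \<epsilon>) k l z3 t (x - y) * f y $ l))"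
proof -
  let ?c = "1 + 1 / \<epsilon>"
  let ?m = "\<lambda>l \<xi>. ksym ?c k l z3 t \<xi> * fourier (\<lambda>y. f y $ l) \<xi>"
  have fl: "integrable lborel (\<lambda>y. f y $ l)" for l
    using f by (rule integrable_bounded_linear[OF bounded_linear_vec_nth])
  have mm: "integrable lborel (?m l)" for l
    by (rule integrable_mult_fourier[OF integrable_ksym[OF assms(1)] fl])
  have "multiplier \<epsilon> t f x $ k = ift (\<lambda>\<xi>. \<Sum>l\<in>UNIV. ?m l \<xi>) x"
    unfolding multiplier_def ift_def ksym_0_eq_symbol[OF assms(1,2)] by simp
  also have "\<dots> = (\<Sum>l\<in>UNIV. ift (?m l) x)"
    by (simp add: ift_sum mm)
  also have "\<dots> = (\<Sum>l\<in>UNIV. (LINT y|lborel. ker ?c k l z3 t (x - y) * f y $ l))"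
    unfolding ift_mult_fourier[OF integrable_ksym[OF assms(1)] fl] ift_ksym[OF assms(1)] ..
  finally show ?thesis .
qed

subsection \<open>Duhamel integrals\<close>

text \<open>The weight \<open>(1 + s) powr (-3/2)\<close> of the field in the supremum norm times
  the weight \<open>1 / sqrt s\<close> of the Jacobian in \<open>L\<^sup>1\<close>: the size of a
  product of the two in \<open>L\<^sup>1\<close>. It is integrable on the half-line, singular like
  \<open>1 / sqrt s\<close> at zero and decaying like \<open>1 / s\<^sup>2\<close> at
  infinity.\<close>

definition tw :: "real \<Rightarrow> real" where
  "tw s = 1 / sqrt s * (1 + s) powr (-3/2)"

text \<open>The weights of \<open>\<F>\<close>: \<open>j = 0\<close> for the field and \<open>j = 1\<close> for its Jacobian; \<open>source\<close> describes products of the two.\<close>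

definition decay :: "nat \<Rightarrow> real \<Rightarrow> (real \<times> (real^3) \<Rightarrow> 'b::euclidean_space) \<Rightarrow> bool" where
  "decay j A f \<longleftrightarrow> f \<in> borel_measurable borel \<and>
     (\<forall>t>0. (\<integral>\<^sup>+x. ennreal (norm (f (t, x))) \<partial>lborel) \<le> ennreal (A * (1 / sqrt t) ^ j)) \<and>
     (\<forall>t>0. AE x in lborel. norm (f (t, x)) \<le> A * (1 / sqrt t) ^ j * (1 + t) powr (-3/2))"

text \<open>Here the supremum bound holds at every point. Duhamel integrals have this property, so
  Picard iterates converge at every point and their limit solves the fixed-point equations
  everywhere.\<close>

definition pdecay :: "nat \<Rightarrow> real \<Rightarrow> (real \<times> (real^3) \<Rightarrow> 'b::euclidean_space) \<Rightarrow> bool" where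
  "pdecay j A f \<longleftrightarrow> decay j A f \<and>
     (\<forall>t>0. \<forall>x. norm (f (t, x)) \<le> A * (1 / sqrt t) ^ j * (1 + t) powr (-3/2))"

definition source :: "real \<Rightarrow> (real \<times> (real^3) \<Rightarrow> real^3) \<Rightarrow> bool" where
  "source B n \<longleftrightarrow> n \<in> borel_measurable borel \<and>
     (\<forall>s>0. (\<integral>\<^sup>+y. ennreal (norm (n (s, y))) \<partial>lborel) \<le> ennreal (B * tw s)) \<and>
     (\<forall>s>0. AE y in lborel. norm (n (s, y)) \<le> B * tw s * (1 + s) powr (-3/2))"

text \<open>Isolates what the Duhamel estimates use of a kernel: linearity in the source value and a
  Gaussian majorant with \<open>j\<close> derivatives' worth of singularity. The kernel itself
  (\<open>j = 0\<close>) and its gradient (\<open>j = 1\<close>) are then treated at once.\<close>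

definition dkernel :: "real \<Rightarrow> nat \<Rightarrow> real \<Rightarrow> (real \<Rightarrow> real^3 \<Rightarrow> real^3 \<Rightarrow> 'b::euclidean_space) \<Rightarrow> bool" where
  "dkernel c j C k \<longleftrightarrow> C \<ge> 0 \<and> (\<lambda>(\<tau>, z, v). k \<tau> z v) \<in> borel_measurable borel \<and> (\<forall>\<tau> z. linear (k \<tau> z)) \<and>
     (\<forall>\<tau>>0. \<forall>z v. norm (k \<tau> z v) \<le> C * (1 / sqrt \<tau>) ^ j * kap c \<tau> z * norm v)"

lemma tw_nonneg: "s \<ge> 0 \<Longrightarrow> tw s \<ge> 0"
  by (simp add: tw_def)

lemma borel_measurable_tw [measurable]: "tw \<in> borel_measurable borel"
  unfolding tw_def by measurable

lemma nn_integral_lborel_reflect: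
  fixes f :: "'a::euclidean_space \<Rightarrow> ennreal"
  assumes [measurable]: "f \<in> borel_measurable borel"
  shows "(\<integral>\<^sup>+y. f (x - y) \<partial>lborel) = (\<integral>\<^sup>+y. f y \<partial>lborel)"
  using nn_integral_lborel_uminus[of "\<lambda>y. f (y + x)"] nn_integral_lborel_translation[of f x] by (simp add: add.commute)

lemma nn_integral_lborel_pair:
  fixes f :: "'a::euclidean_space \<times> 'b::euclidean_space \<Rightarrow> ennreal"
  assumes [measurable]: "f \<in> borel_measurable borel"
  shows "(\<integral>\<^sup>+p. f p \<partial>lborel) = (\<integral>\<^sup>+s. (\<integral>\<^sup>+y. f (s, y) \<partial>lborel) \<partial>lborel)"
    and "(\<integral>\<^sup>+p. f p \<partial>lborel) = (\<integral>\<^sup>+y. (\<integral>\<^sup>+s. f (s, y) \<partial>lborel) \<partial>lborel)"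
proof -
  have f: "f \<in> borel_measurable (lborel \<Otimes>\<^sub>M lborel)" by (simp add: lborel_prod)
  show "(\<integral>\<^sup>+p. f p \<partial>lborel) = (\<integral>\<^sup>+s. (\<integral>\<^sup>+y. f (s, y) \<partial>lborel) \<partial>lborel)"
    using lborel.nn_integral_fst[OF f] by (simp add: lborel_prod)
  show "(\<integral>\<^sup>+p. f p \<partial>lborel) = (\<integral>\<^sup>+y. (\<integral>\<^sup>+s. f (s, y) \<partial>lborel) \<partial>lborel)"
    using lborel_pair.nn_integral_snd[OF f] by (simp add: lborel_prod)
qed

section \<open>Time integrals of the weights\<close>

lemma nn_integral_rsqrt: "(\<integral>\<^sup>+s. ennreal (indicator {0<..<1} s * (1 / sqrt s)) \<partial>lborel) \<le> ennreal 2"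
proof -
  have "((\<lambda>s::real. s powr (-1/2)) has_integral 2) {0..1}"
    using has_integral_powr_from_0[of "-1/2" 1] by simp
  then have "((\<lambda>s::real. if s \<in> {0..1} then s powr (-1/2) else 0) has_integral 2) UNIV"
    by (simp only: has_integral_restrict_UNIV)
  then have "(\<integral>\<^sup>+s. ennreal (if s \<in> {0..1} then s powr (-1/2) else 0) \<partial>lborel) = ennreal 2"
    by (intro nn_integral_has_integral_lborel) auto
  moreover have "(\<integral>\<^sup>+s. ennreal (indicator {0<..<1} s * (1 / sqrt s)) \<partial>lborel)
     \<le> (\<integral>\<^sup>+s. ennreal (if s \<in> {0..1} then s powr (-1/2) else 0) \<partial>lborel)"
    by (intro nn_integral_mono ennreal_leI)
      (auto simp: indicator_def powr_minus_divide powr_half_sqrt[symmetric])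
  ultimately show ?thesis by simp
qed

lemma nn_integral_one_plus: "(\<integral>\<^sup>+s. ennreal (indicator {0..} s * (1 + s) powr (-3/2)) \<partial>lborel) = ennreal 2"
proof -
  have "(\<integral>\<^sup>+s. ennreal ((1 + s) powr (-3/2)) * indicator {0..} s \<partial>lborel) = ennreal (0 - (- 2 * (1 + 0) powr (-1/2)))"
  proof (rule nn_integral_FTC_atLeast[where F="\<lambda>s. - 2 * (1 + s) powr (-1/2)"])
    show "((\<lambda>s::real. - 2 * (1 + s) powr (-1/2)) \<longlongrightarrow> 0) at_top"
      by (intro tendsto_mult_right_zero tendsto_neg_powr filterlim_tendsto_add_at_top[OF tendsto_const] filterlim_ident) auto
  qed (auto intro!: derivative_eq_intros)
  moreover have "(\<integral>\<^sup>+s. ennreal (indicator {0..} s * (1 + s) powr (-3/2)) \<partial>lborel) = (\<integral>\<^sup>+s. ennreal ((1 + s) powr (-3/2)) * indicator {0..} s \<partial>lborel)"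
    by (intro nn_integral_cong) (auto simp: indicator_def)
  ultimately show ?thesis by simp
qed

lemma tw_le: "s > 0 \<Longrightarrow> tw s \<le> indicator {0<..<1} s * (1 / sqrt s) + indicator {0..} s * (1 + s) powr (-3/2)"
proof -
  assume s: "s > 0"
  have p: "(1 + s) powr (-3/2) \<le> 1" using s powr_mono2'[of "-3/2" 1 "1 + s"] by simp
  show ?thesis
  proof (cases "s < 1")
    case True
    then show ?thesis using s p mult_left_mono[OF p, of "1 / sqrt s"] powr_ge_zero[of "1 + s" "-3/2"]
      unfolding tw_def by (simp add: indicator_def add_increasing2)
  next
    case False
    then have "1 / sqrt s \<le> 1" by simp
    then show ?thesis using s False mult_right_mono[of "1 / sqrt s" 1 "(1 + s) powr (-3/2)"]
      unfolding tw_def by (simp add: indicator_def)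
  qed
qed

lemma nn_integral_tw: "(\<integral>\<^sup>+s. ennreal (indicator {0<..} s * tw s) \<partial>lborel) \<le> ennreal 4"
proof -
  have "(\<integral>\<^sup>+s. ennreal (indicator {0<..} s * tw s) \<partial>lborel)
    \<le> (\<integral>\<^sup>+s. ennreal (indicator {0<..<1} s * (1 / sqrt s)) + ennreal (indicator {0..} s * (1 + s) powr (-3/2)) \<partial>lborel)"
  proof (intro nn_integral_mono)
    fix s :: real
    have "indicator {0<..} s * tw s \<le> indicator {0<..<1} s * (1 / sqrt s) + indicator {0..} s * (1 + s) powr (-3/2)"
      using tw_le[of s] by (auto simp: indicator_def)
    then show "ennreal (indicator {0<..} s * tw s) \<le> ennreal (indicator {0<..<1} s * (1 / sqrt s)) + ennreal (indicator {0..} s * (1 + s) powr (-3/2))"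
      by (subst ennreal_plus[symmetric]) (auto simp: indicator_def simp del: ennreal_plus intro!: ennreal_leI)
  qed
  also have "\<dots> = (\<integral>\<^sup>+s. ennreal (indicator {0<..<1} s * (1 / sqrt s)) \<partial>lborel) + (\<integral>\<^sup>+s. ennreal (indicator {0..} s * (1 + s) powr (-3/2)) \<partial>lborel)"
    by (rule nn_integral_add) measurable
  also have "\<dots> \<le> ennreal 2 + ennreal 2"
    by (intro add_mono nn_integral_rsqrt) (simp only: nn_integral_one_plus order_refl)
  finally show ?thesis by (simp flip: ennreal_plus)
qed

text \<open>For \<open>j = 1\<close> the inequality
  \<open>sqrt t \<le> sqrt s + sqrt (t - s)\<close> gives \<open>1 / sqrt (t - s) * (1 / sqrt s)
  \<le> 1 / sqrt t * (1 / sqrt (t - s) + 1 / sqrt s)\<close>, so the two singularities never meet.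
  The three remaining integrals are bounded by \<open>2\<close>, \<open>2\<close> and
  \<open>4\<close>, which is the \<open>8\<close>.\<close>

lemma nn_integral_time:
  assumes "j \<le> 1" and t: "t > 0"
  shows "(\<integral>\<^sup>+s. ennreal (indicator {0<..<t} s * ((1 / sqrt (t - s)) ^ j * tw s)) \<partial>lborel) \<le> ennreal (8 * (1 / sqrt t) ^ j)"
proof (cases "j = 0")
  case True
  have "(\<integral>\<^sup>+s. ennreal (indicator {0<..<t} s * ((1 / sqrt (t - s)) ^ j * tw s)) \<partial>lborel) \<le> (\<integral>\<^sup>+s. ennreal (indicator {0<..} s * tw s) \<partial>lborel)"
    using True by (intro nn_integral_mono ennreal_leI) (auto simp: indicator_def tw_nonneg)
  also have "\<dots> \<le> ennreal 4" by (rule nn_integral_tw)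
  also have "\<dots> \<le> ennreal 8" by simp
  finally show ?thesis using True by simp
next
  case False
  then have j: "j = 1" using assms by simp
  let ?A = "\<lambda>s::real. ennreal (indicator {0<..<1} s * (1 / sqrt s))"
  let ?B = "\<lambda>s::real. ennreal (indicator {0..} s * (1 + s) powr (-3/2))"
  let ?W = "\<lambda>s::real. ennreal (indicator {0<..} s * tw s)"
  have "(\<integral>\<^sup>+s. ennreal (indicator {0<..<t} s * ((1 / sqrt (t - s)) ^ j * tw s)) \<partial>lborel)
    \<le> (\<integral>\<^sup>+s. ennreal (1 / sqrt t) * (?B s + ?A (t - s) + ?W s) \<partial>lborel)"
  proof (intro nn_integral_mono)
    fix s :: real
    show "ennreal (indicator {0<..<t} s * ((1 / sqrt (t - s)) ^ j * tw s)) \<le> ennreal (1 / sqrt t) * (?B s + ?A (t - s) + ?W s)"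
    proof (cases "0 < s \<and> s < t")
      case True
      let ?p = "(1 + s) powr (-3/2)"
      have p: "0 \<le> ?p" "?p \<le> 1" using True powr_mono2'[of "-3/2" 1 "1 + s"] by auto
      have "sqrt t \<le> sqrt s + sqrt (t - s)" using sqrt_add_le_add_sqrt[of s "t - s"] True by simp
      then have "(1 / sqrt (t - s)) * (1 / sqrt s) * sqrt t \<le> (1 / sqrt (t - s)) * (1 / sqrt s) * (sqrt s + sqrt (t - s))"
        using True by (intro mult_left_mono) auto
      also have "\<dots> = 1 / sqrt (t - s) + 1 / sqrt s" using True by (simp add: field_simps)
      finally have "(1 / sqrt (t - s)) * (1 / sqrt s) * sqrt t * ?p \<le> (1 / sqrt (t - s) + 1 / sqrt s) * ?p"
        using p by (intro mult_right_mono) auto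
      then have 1: "(1 / sqrt (t - s)) * tw s * sqrt t \<le> (1 / sqrt (t - s)) * ?p + tw s"
        unfolding tw_def by (simp add: algebra_simps)
      have 2: "(1 / sqrt (t - s)) * ?p \<le> ?p + indicator {0<..<1} (t - s) * (1 / sqrt (t - s))"
      proof (cases "t - s < 1")
        case t1: True
        have "(1 / sqrt (t - s)) * ?p \<le> (1 / sqrt (t - s)) * 1"
          using p True by (intro mult_left_mono) auto
        then show ?thesis using p True t1 by (simp add: indicator_def add_increasing)
      next
        case t1: False
        have "(1 / sqrt (t - s)) * ?p \<le> 1 * ?p"
          using p True t1 by (intro mult_right_mono) auto
        then show ?thesis using True t1 by (simp add: indicator_def)
      qed
      have "(1 / sqrt (t - s)) * tw s \<le> 1 / sqrt t * (?p + indicator {0<..<1} (t - s) * (1 / sqrt (t - s)) + tw s)"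
        using 1 2 t by (simp add: field_simps)
      then have "ennreal ((1 / sqrt (t - s)) * tw s) \<le> ennreal (1 / sqrt t * (?p + indicator {0<..<1} (t - s) * (1 / sqrt (t - s)) + tw s))"
        by (rule ennreal_leI)
      also have "\<dots> = ennreal (1 / sqrt t) * (?B s + ?A (t - s) + ?W s)"
        using True t tw_nonneg[of s] by (subst ennreal_mult) (auto simp: indicator_def)
      finally show ?thesis using True j by simp
    qed (auto simp: indicator_def)
  qed
  also have "\<dots> = ennreal (1 / sqrt t) * ((\<integral>\<^sup>+s. ?B s \<partial>lborel) + (\<integral>\<^sup>+s. ?A (t - s) \<partial>lborel) + (\<integral>\<^sup>+s. ?W s \<partial>lborel))"
    by (simp add: nn_integral_cmult nn_integral_add)
  also have "\<dots> \<le> ennreal (1 / sqrt t) * (ennreal 2 + ennreal 2 + ennreal 4)"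
    using nn_integral_rsqrt nn_integral_one_plus nn_integral_tw nn_integral_lborel_reflect[of ?A t]
    by (intro mult_left_mono add_mono) auto
  also have "\<dots> = ennreal (8 * (1 / sqrt t) ^ j)"
  proof -
    have "ennreal 2 + ennreal 2 + ennreal 4 = ennreal 8" by (simp flip: ennreal_plus)
    then show ?thesis using t j ennreal_mult[of "1 / sqrt t" 8] by simp
  qed
  finally show ?thesis .
qed

lemma powr_half_le:
  fixes a t :: real
  assumes "(1 + t) / 2 \<le> a" "t \<ge> 0"
  shows "a powr (-3/2) \<le> 3 * (1 + t) powr (-3/2)"
proof -
  have "sqrt 2 \<le> 3 / 2" by (rule real_le_lsqrt) (auto simp: power2_eq_square)
  moreover have "(2::real) powr (3/2) = 2 * sqrt 2"
    using powr_add[of "2::real" 1 "1/2"] by (simp add: powr_half_sqrt)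
  ultimately have 2: "(2::real) powr (3/2) \<le> 3" by simp
  have "a powr (-3/2) \<le> ((1 + t) / 2) powr (-3/2)"
    using assms by (intro powr_mono2') auto
  also have "\<dots> = 2 powr (3/2) * (1 + t) powr (-3/2)"
    using assms by (simp add: powr_divide powr_minus_divide)
  also have "\<dots> \<le> 3 * (1 + t) powr (-3/2)" using 2 by (intro mult_right_mono) auto
  finally show ?thesis .
qed

lemma borel_measurable_dkernel:
  assumes "dkernel c j C k" and [measurable]: "f \<in> borel_measurable M" "g \<in> borel_measurable M" "h \<in> borel_measurable M"
  shows "(\<lambda>p. k (f p) (g p) (h p)) \<in> borel_measurable M"
proof -
  have [measurable]: "(\<lambda>(\<tau>, z, v). k \<tau> z v) \<in> borel_measurable (borel \<Otimes>\<^sub>M borel \<Otimes>\<^sub>M borel)"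
    using assms(1) by (simp add: dkernel_def borel_prod)
  have "(\<lambda>p. (\<lambda>(\<tau>, z, v). k \<tau> z v) (f p, g p, h p)) \<in> borel_measurable M" by measurable
  then show ?thesis by simp
qed

definition dint :: "(real \<Rightarrow> real^3 \<Rightarrow> real^3 \<Rightarrow> 'b::euclidean_space) \<Rightarrow> (real \<times> (real^3) \<Rightarrow> real^3) \<Rightarrow> real \<times> (real^3) \<Rightarrow> real \<times> (real^3) \<Rightarrow> 'b" where
  "dint k n q p = indicator {0<..<fst q} (fst p) *\<^sub>R k (fst q - fst p) (snd q - snd p) (n p)"

text \<open>One integral over space-time, with \<open>p = (s, y)\<close> and
  \<open>q = (t, x)\<close>, instead of an iterated one, so that Fubini is needed only where an
  order of integration really changes. For \<open>t \<le> 0\<close> the time interval is empty and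
  the value is \<open>0\<close>.\<close>

definition duhamel :: "(real \<Rightarrow> real^3 \<Rightarrow> real^3 \<Rightarrow> 'b::euclidean_space) \<Rightarrow> (real \<times> (real^3) \<Rightarrow> real^3) \<Rightarrow> real \<times> (real^3) \<Rightarrow> 'b" where
  "duhamel k n q = (LINT p|lborel. dint k n q p)"

context
  fixes c :: real and j :: nat and C B :: real and k :: "real \<Rightarrow> real^3 \<Rightarrow> real^3 \<Rightarrow> 'b::euclidean_space"
    and n :: "real \<times> (real^3) \<Rightarrow> real^3"
  assumes c: "c \<ge> 1" and k: "dkernel c j C k" and n: "source B n" and j: "j \<le> 1" and B: "B \<ge> 0"
begin

lemma dkernel_C: "C \<ge> 0" using k by (simp add: dkernel_def)

lemma source_meas [measurable]: "n \<in> borel_measurable borel" using n by (simp add: source_def)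

lemma dkernel_meas [measurable]: "f \<in> borel_measurable M \<Longrightarrow> g \<in> borel_measurable M \<Longrightarrow> h \<in> borel_measurable M \<Longrightarrow>
    (\<lambda>p. k (f p) (g p) (h p)) \<in> borel_measurable M"
  by (rule borel_measurable_dkernel[OF k])

lemma dint_meas2 [measurable]:
  assumes "f \<in> borel_measurable M" "g \<in> borel_measurable M"
  shows "(\<lambda>x. dint k n (f x) (g x)) \<in> borel_measurable M"
proof -
  have [measurable]: "n \<in> borel_measurable (borel \<Otimes>\<^sub>M borel)" using source_meas by (simp add: borel_prod)
  have [measurable]: "f \<in> measurable M (borel \<Otimes>\<^sub>M borel)" "g \<in> measurable M (borel \<Otimes>\<^sub>M borel)"
    using assms by (simp_all add: borel_prod)
  have eq: "dint k n (f x) (g x) = (if 0 < fst (g x) \<and> fst (g x) < fst (f x)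
      then k (fst (f x) - fst (g x)) (snd (f x) - snd (g x)) (n (g x)) else 0)" for x
    by (auto simp: dint_def indicator_def)
  show ?thesis unfolding eq by measurable
qed

lemma dkernel_le: "\<tau> > 0 \<Longrightarrow> norm (k \<tau> z v) \<le> C * (1 / sqrt \<tau>) ^ j * kap c \<tau> z * norm v"
  using k by (simp add: dkernel_def)

text \<open>Since \<open>(1 + s) + (t - s) = 1 + t\<close>, one of \<open>1 + s\<close> and \<open>t - s\<close> is at least \<open>(1 + t)/2\<close>. In the first case
  use the \<open>L\<^sup>1\<close> norm of the kernel and the supremum of the source, in the second case the converse.\<close>

lemma slice_sup:
  assumes s: "0 < s" "s < t"
  shows "(\<integral>\<^sup>+y. ennreal (norm (k (t - s) (x - y) (n (s, y)))) \<partial>lborel) \<le>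
    ennreal (3 * C * B * (1 + t) powr (-3/2)) * ennreal ((1 / sqrt (t - s)) ^ j * tw s)"
proof -
  define \<tau> where "\<tau> = t - s"
  have \<tau>: "\<tau> > 0" using s by (simp add: \<tau>_def)
  let ?a = "C * (1 / sqrt \<tau>) ^ j"
  have a: "?a \<ge> 0" using dkernel_C \<tau> by simp
  have tw: "tw s \<ge> 0" using s by (simp add: tw_nonneg)
  have kap0: "kap c \<tau> z \<ge> 0" for z using c \<tau> by (simp add: kap_nonneg)
  have *: "ennreal (?a * M * (B * tw s)) \<le> ennreal (3 * C * B * (1 + t) powr (-3/2)) * ennreal ((1 / sqrt (t - s)) ^ j * tw s)"
    if M: "M \<le> 3 * (1 + t) powr (-3/2)" for M
  proof -
    have "?a * M * (B * tw s) \<le> ?a * (3 * (1 + t) powr (-3/2)) * (B * tw s)"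
      using M a B tw by (intro mult_right_mono mult_left_mono) auto
    then have "ennreal (?a * M * (B * tw s)) \<le> ennreal ((3 * C * B * (1 + t) powr (-3/2)) * ((1 / sqrt (t - s)) ^ j * tw s))"
      by (intro ennreal_leI) (simp add: \<tau>_def mult_ac)
    then show ?thesis using dkernel_C B tw \<tau> by (subst ennreal_mult[symmetric]) (auto simp: \<tau>_def)
  qed
  show ?thesis
  proof (cases "(1 + t) / 2 \<le> 1 + s")
    case True
    have AE: "AE y in lborel. norm (n (s, y)) \<le> B * tw s * (1 + s) powr (-3/2)"
      using n s by (simp add: source_def)
    have "(\<integral>\<^sup>+y. ennreal (norm (k \<tau> (x - y) (n (s, y)))) \<partial>lborel)
      \<le> (\<integral>\<^sup>+y. ennreal (?a * (1 + s) powr (-3/2) * (B * tw s)) * ennreal (kap c \<tau> (x - y)) \<partial>lborel)"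
    proof (rule nn_integral_mono_AE, use AE in eventually_elim)
      case (elim y)
      have "norm (k \<tau> (x - y) (n (s, y))) \<le> ?a * kap c \<tau> (x - y) * (B * tw s * (1 + s) powr (-3/2))"
        using dkernel_le[OF \<tau>, of "x - y" "n (s, y)"] elim a kap0[of "x - y"]
        by (elim order_trans) (intro mult_left_mono, auto)
      then have "norm (k \<tau> (x - y) (n (s, y))) \<le> ?a * (1 + s) powr (-3/2) * (B * tw s) * kap c \<tau> (x - y)"
        by (simp add: mult_ac)
      then show ?case using a B tw kap0
        by (subst ennreal_mult[symmetric]) (auto intro!: ennreal_leI mult_nonneg_nonneg)
    qed
    also have "\<dots> = ennreal (?a * (1 + s) powr (-3/2) * (B * tw s)) * 1"
      using nn_integral_lborel_reflect[of "\<lambda>y. ennreal (kap c \<tau> y)" x] c \<tau>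
      by (subst nn_integral_cmult) (auto simp: nn_integral_kap)
    also have "\<dots> \<le> ennreal (3 * C * B * (1 + t) powr (-3/2)) * ennreal ((1 / sqrt (t - s)) ^ j * tw s)"
      using *[OF powr_half_le[OF True]] s by simp
    finally show ?thesis by (simp add: \<tau>_def)
  next
    case False
    then have "(1 + t) / 2 \<le> \<tau>" by (simp add: \<tau>_def field_simps)
    then have p: "\<tau> powr (-3/2) \<le> 3 * (1 + t) powr (-3/2)" using s by (intro powr_half_le) auto
    have "\<tau> powr (-3/2) = 1 / (\<tau> powr (1/2)) powr 3" by (simp add: powr_powr powr_minus_divide)
    then have p3: "(1 / sqrt \<tau>) ^ 3 = \<tau> powr (-3/2)"
      using \<tau> by (simp add: powr_half_sqrt power_divide)
    have "(\<integral>\<^sup>+y. ennreal (norm (k \<tau> (x - y) (n (s, y)))) \<partial>lborel)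
      \<le> (\<integral>\<^sup>+y. ennreal (?a * \<tau> powr (-3/2)) * ennreal (norm (n (s, y))) \<partial>lborel)"
    proof (rule nn_integral_mono)
      fix y
      have "?a * kap c \<tau> (x - y) * norm (n (s, y)) \<le> ?a * \<tau> powr (-3/2) * norm (n (s, y))"
        using kap_le[OF c \<tau>] a unfolding p3[symmetric] by (intro mult_right_mono mult_left_mono) auto
      then have "norm (k \<tau> (x - y) (n (s, y))) \<le> ?a * \<tau> powr (-3/2) * norm (n (s, y))"
        using dkernel_le[OF \<tau>, of "x - y" "n (s, y)"] by linarith
      then show "ennreal (norm (k \<tau> (x - y) (n (s, y)))) \<le> ennreal (?a * \<tau> powr (-3/2)) * ennreal (norm (n (s, y)))"
        using a by (subst ennreal_mult[symmetric]) (auto intro!: ennreal_leI mult_nonneg_nonneg)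
    qed
    also have "\<dots> = ennreal (?a * \<tau> powr (-3/2)) * (\<integral>\<^sup>+y. ennreal (norm (n (s, y))) \<partial>lborel)"
      by (rule nn_integral_cmult) measurable
    also have "\<dots> \<le> ennreal (?a * \<tau> powr (-3/2)) * ennreal (B * tw s)"
      using n s by (intro mult_left_mono) (auto simp: source_def)
    also have "\<dots> = ennreal (?a * \<tau> powr (-3/2) * (B * tw s))"
      using a B tw by (subst ennreal_mult) auto
    also have "\<dots> \<le> ennreal (3 * C * B * (1 + t) powr (-3/2)) * ennreal ((1 / sqrt (t - s)) ^ j * tw s)"
      by (rule *[OF p])
    finally show ?thesis by (simp add: \<tau>_def)
  qed
qed

text \<open>The constant is \<open>24 = 3 * 8\<close>: the factor of the slice estimate times that
  of the time integral.\<close>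

lemma dint_sup:
  assumes t: "t > 0"
  shows "(\<integral>\<^sup>+p. ennreal (norm (dint k n (t, x) p)) \<partial>lborel) \<le> ennreal (24 * C * B * (1 / sqrt t) ^ j * (1 + t) powr (-3/2))"
proof -
  have "(\<integral>\<^sup>+p. ennreal (norm (dint k n (t, x) p)) \<partial>lborel) = (\<integral>\<^sup>+s. (\<integral>\<^sup>+y. ennreal (norm (dint k n (t, x) (s, y))) \<partial>lborel) \<partial>lborel)"
    by (rule nn_integral_lborel_pair) measurable
  also have "\<dots> \<le> (\<integral>\<^sup>+s. ennreal (3 * C * B * (1 + t) powr (-3/2)) * ennreal (indicator {0<..<t} s * ((1 / sqrt (t - s)) ^ j * tw s)) \<partial>lborel)"
  proof (rule nn_integral_mono)
    fix s :: real
    show "(\<integral>\<^sup>+y. ennreal (norm (dint k n (t, x) (s, y))) \<partial>lborel) \<le>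
      ennreal (3 * C * B * (1 + t) powr (-3/2)) * ennreal (indicator {0<..<t} s * ((1 / sqrt (t - s)) ^ j * tw s))"
      using slice_sup[of s t x] by (cases "0 < s \<and> s < t") (auto simp: dint_def)
  qed
  also have "\<dots> = ennreal (3 * C * B * (1 + t) powr (-3/2)) * (\<integral>\<^sup>+s. ennreal (indicator {0<..<t} s * ((1 / sqrt (t - s)) ^ j * tw s)) \<partial>lborel)"
    by (rule nn_integral_cmult) measurable
  also have "\<dots> \<le> ennreal (3 * C * B * (1 + t) powr (-3/2)) * ennreal (8 * (1 / sqrt t) ^ j)"
    by (intro mult_left_mono nn_integral_time j t) auto
  also have "\<dots> = ennreal (24 * C * B * (1 / sqrt t) ^ j * (1 + t) powr (-3/2))"
    using dkernel_C B t by (subst ennreal_mult[symmetric]) (auto simp: mult_ac)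
  finally show ?thesis .
qed

lemma integrable_dint: "t > 0 \<Longrightarrow> integrable lborel (dint k n (t, x))"
  using dint_sup[of t x] by (auto simp: integrable_iff_bounded le_less_trans[OF _ ennreal_less_top])

text \<open>With \<open>x\<close> integrated before \<open>p\<close>, the majorant
  \<open>kap\<close> contributes \<open>1\<close> and only the \<open>L\<^sup>1\<close> size of the
  source and the time weights remain.\<close>

lemma dint_L1:
  assumes t: "t > 0"
  shows "(\<integral>\<^sup>+x. (\<integral>\<^sup>+p. ennreal (norm (dint k n (t, x) p)) \<partial>lborel) \<partial>lborel) \<le> ennreal (8 * C * B * (1 / sqrt t) ^ j)"
proof -
  have m: "(\<lambda>(x, p). ennreal (norm (dint k n (t, x) p))) \<in> borel_measurable (lborel \<Otimes>\<^sub>M lborel)"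
    by (simp add: split_beta) measurable
  have "(\<integral>\<^sup>+x. (\<integral>\<^sup>+p. ennreal (norm (dint k n (t, x) p)) \<partial>lborel) \<partial>lborel) = (\<integral>\<^sup>+p. (\<integral>\<^sup>+x. ennreal (norm (dint k n (t, x) p)) \<partial>lborel) \<partial>lborel)"
    using lborel_pair.Fubini'[OF m] by simp
  also have "\<dots> \<le> (\<integral>\<^sup>+p. ennreal (indicator {0<..<t} (fst p) * (C * (1 / sqrt (t - fst p)) ^ j)) * ennreal (norm (n p)) \<partial>lborel)"
  proof (rule nn_integral_mono)
    fix p :: "real \<times> (real^3)"
    obtain s y where p: "p = (s, y)" by (cases p)
    show "(\<integral>\<^sup>+x. ennreal (norm (dint k n (t, x) p)) \<partial>lborel) \<le> ennreal (indicator {0<..<t} (fst p) * (C * (1 / sqrt (t - fst p)) ^ j)) * ennreal (norm (n p))"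
    proof (cases "0 < s \<and> s < t")
      case True
      define a where "a = C * (1 / sqrt (t - s)) ^ j * norm (n p)"
      have a: "a \<ge> 0" using dkernel_C True by (simp add: a_def)
      have "(\<integral>\<^sup>+x. ennreal (norm (dint k n (t, x) p)) \<partial>lborel) \<le> (\<integral>\<^sup>+x. ennreal a * ennreal (kap c (t - s) (x + - y)) \<partial>lborel)"
      proof (rule nn_integral_mono)
        fix x
        have "norm (dint k n (t, x) p) = norm (k (t - s) (x - y) (n p))"
          using True by (simp add: p dint_def)
        also have "\<dots> \<le> C * (1 / sqrt (t - s)) ^ j * kap c (t - s) (x - y) * norm (n p)"
          using True by (intro dkernel_le) simp
        also have "\<dots> = a * kap c (t - s) (x + - y)" by (simp add: a_def)
        finally have "ennreal (norm (dint k n (t, x) p)) \<le> ennreal (a * kap c (t - s) (x + - y))" by (rule ennreal_leI)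
        also have "\<dots> = ennreal a * ennreal (kap c (t - s) (x + - y))"
          using a True c by (intro ennreal_mult kap_nonneg) auto
        finally show "ennreal (norm (dint k n (t, x) p)) \<le> ennreal a * ennreal (kap c (t - s) (x + - y))" .
      qed
      also have "\<dots> = ennreal a"
        using nn_integral_lborel_translation[of "\<lambda>x. ennreal (kap c (t - s) x)" "- y"] c True
        by (subst nn_integral_cmult) (auto simp: nn_integral_kap)
      also have "\<dots> = ennreal (indicator {0<..<t} (fst p) * (C * (1 / sqrt (t - fst p)) ^ j)) * ennreal (norm (n p))"
        using True dkernel_C by (simp add: p a_def ennreal_mult)
      finally show ?thesis .
    qed (auto simp: p dint_def)
  qed
  also have "\<dots> = (\<integral>\<^sup>+s. (\<integral>\<^sup>+y. ennreal (indicator {0<..<t} s * (C * (1 / sqrt (t - s)) ^ j)) * ennreal (norm (n (s, y))) \<partial>lborel) \<partial>lborel)"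
  proof (subst nn_integral_lborel_pair(1))
    have [measurable]: "n \<in> borel_measurable (borel \<Otimes>\<^sub>M borel)" using source_meas by (simp add: borel_prod)
    have "(\<lambda>p. ennreal (indicator {0<..<t} (fst p) * (C * (1 / sqrt (t - fst p)) ^ j)) * ennreal (norm (n p))) \<in> borel_measurable (borel \<Otimes>\<^sub>M borel)"
      by measurable
    then show "(\<lambda>p. ennreal (indicator {0<..<t} (fst p) * (C * (1 / sqrt (t - fst p)) ^ j)) * ennreal (norm (n p))) \<in> borel_measurable borel"
      by (simp add: borel_prod)
  qed simp
  also have "\<dots> \<le> (\<integral>\<^sup>+s. ennreal (C * B) * ennreal (indicator {0<..<t} s * ((1 / sqrt (t - s)) ^ j * tw s)) \<partial>lborel)"
  proof (rule nn_integral_mono)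
    fix s :: real
    show "(\<integral>\<^sup>+y. ennreal (indicator {0<..<t} s * (C * (1 / sqrt (t - s)) ^ j)) * ennreal (norm (n (s, y))) \<partial>lborel)
      \<le> ennreal (C * B) * ennreal (indicator {0<..<t} s * ((1 / sqrt (t - s)) ^ j * tw s))"
    proof (cases "0 < s \<and> s < t")
      case True
      have "(\<integral>\<^sup>+y. ennreal (indicator {0<..<t} s * (C * (1 / sqrt (t - s)) ^ j)) * ennreal (norm (n (s, y))) \<partial>lborel)
        = ennreal (C * (1 / sqrt (t - s)) ^ j) * (\<integral>\<^sup>+y. ennreal (norm (n (s, y))) \<partial>lborel)"
        using True by (subst nn_integral_cmult) auto
      also have "\<dots> \<le> ennreal (C * (1 / sqrt (t - s)) ^ j) * ennreal (B * tw s)"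
        using n True by (intro mult_left_mono) (auto simp: source_def)
      also have "\<dots> = ennreal (C * B) * ennreal (indicator {0<..<t} s * ((1 / sqrt (t - s)) ^ j * tw s))"
        using True dkernel_C B tw_nonneg[of s] by (simp add: mult_ac flip: ennreal_mult)
      finally show ?thesis .
    qed auto
  qed
  also have "\<dots> = ennreal (C * B) * (\<integral>\<^sup>+s. ennreal (indicator {0<..<t} s * ((1 / sqrt (t - s)) ^ j * tw s)) \<partial>lborel)"
    by (rule nn_integral_cmult) measurable
  also have "\<dots> \<le> ennreal (C * B) * ennreal (8 * (1 / sqrt t) ^ j)"
    by (intro mult_left_mono nn_integral_time j t) auto
  also have "\<dots> = ennreal (8 * C * B * (1 / sqrt t) ^ j)"
    using dkernel_C B t by (subst ennreal_mult[symmetric]) (auto simp: mult_ac)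
  finally show ?thesis .
qed

lemma norm_duhamel_le: "t > 0 \<Longrightarrow> ennreal (norm (duhamel k n (t, x))) \<le> (\<integral>\<^sup>+p. ennreal (norm (dint k n (t, x) p)) \<partial>lborel)"
proof -
  assume t: "t > 0"
  show ?thesis unfolding duhamel_def
    using nn_integral_eq_integral[OF integrable_norm[OF integrable_dint[OF t, of x]]]
      integral_norm_bound[of lborel "dint k n (t, x)"] by (simp add: ennreal_leI)
qed

lemma borel_measurable_duhamel: "duhamel k n \<in> borel_measurable borel"
  unfolding duhamel_def by measurable

lemma pdecay_duhamel: "pdecay j (24 * C * B) (duhamel k n)"
proof -
  have "norm (duhamel k n (t, x)) \<le> 24 * C * B * (1 / sqrt t) ^ j * (1 + t) powr (-3/2)" if t: "t > 0" for t x
    using order_trans[OF norm_duhamel_le[OF t] dint_sup[OF t]] dkernel_C B t by (simp add: ennreal_le_iff)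
  moreover have "(\<integral>\<^sup>+x. ennreal (norm (duhamel k n (t, x))) \<partial>lborel) \<le> ennreal (24 * C * B * (1 / sqrt t) ^ j)" if t: "t > 0" for t
  proof -
    have "(\<integral>\<^sup>+x. ennreal (norm (duhamel k n (t, x))) \<partial>lborel) \<le> ennreal (8 * C * B * (1 / sqrt t) ^ j)"
      by (rule order_trans[OF nn_integral_mono dint_L1[OF t]]) (rule norm_duhamel_le[OF t])
    also have "\<dots> \<le> ennreal (24 * C * B * (1 / sqrt t) ^ j)"
      using dkernel_C B t by (intro ennreal_leI mult_right_mono) auto
    finally show ?thesis .
  qed
  ultimately show ?thesis
    unfolding pdecay_def decay_def using borel_measurable_duhamel by auto
qed

end

declare dkernel_meas [measurable del] dint_meas2 [measurable del] source_meas [measurable del]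

subsection \<open>Decay classes\<close>

lemma decay_mono:
  assumes "decay j A f" "A \<le> B" shows "decay j B f"
proof -
  have 1: "A * (1 / sqrt t) ^ j \<le> B * (1 / sqrt t) ^ j" if "t > 0" for t
    using assms(2) that by (intro mult_right_mono) auto
  have 2: "A * (1 / sqrt t) ^ j * (1 + t) powr (-3/2) \<le> B * (1 / sqrt t) ^ j * (1 + t) powr (-3/2)" if "t > 0" for t
    using 1[OF that] by (rule mult_right_mono) auto
  show ?thesis unfolding decay_def
  proof (intro conjI allI impI)
    show "f \<in> borel_measurable borel" using assms(1) by (simp add: decay_def)
    fix t :: real assume t: "t > 0"
    show "(\<integral>\<^sup>+x. ennreal (norm (f (t, x))) \<partial>lborel) \<le> ennreal (B * (1 / sqrt t) ^ j)"
      using assms(1) t order_trans[OF _ ennreal_leI[OF 1[OF t]]] by (simp add: decay_def)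
    have "AE x in lborel. norm (f (t, x)) \<le> A * (1 / sqrt t) ^ j * (1 + t) powr (-3/2)"
      using assms(1) t by (simp add: decay_def)
    then show "AE x in lborel. norm (f (t, x)) \<le> B * (1 / sqrt t) ^ j * (1 + t) powr (-3/2)"
      by eventually_elim (rule order_trans[OF _ 2[OF t]])
  qed
qed

lemma pdecay_mono:
  assumes "pdecay j A f" "A \<le> B" shows "pdecay j B f"
proof -
  have "A * (1 / sqrt t) ^ j * (1 + t) powr (-3/2) \<le> B * (1 / sqrt t) ^ j * (1 + t) powr (-3/2)" if "t > 0" for t
    using assms(2) that by (intro mult_right_mono) auto
  then show ?thesis using assms decay_mono[of j A f B] unfolding pdecay_def by (meson order_trans)
qed

lemma decay_imp_norm: "decay j A f \<Longrightarrow> t > 0 \<Longrightarrow> AE x in lborel. norm (f (t, x)) \<le> A * (1 / sqrt t) ^ j * (1 + t) powr (-3/2)"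
  by (simp add: decay_def)

lemma decay_imp_L1: "decay j A f \<Longrightarrow> t > 0 \<Longrightarrow> (\<integral>\<^sup>+x. ennreal (norm (f (t, x))) \<partial>lborel) \<le> ennreal (A * (1 / sqrt t) ^ j)"
  by (simp add: decay_def)

lemma decay_meas: "decay j A f \<Longrightarrow> f \<in> borel_measurable borel"
  by (simp add: decay_def)

lemma pdecay_imp_decay: "pdecay j A f \<Longrightarrow> decay j A f"
  by (simp add: pdecay_def)

lemma pdecay_imp_norm: "pdecay j A f \<Longrightarrow> t > 0 \<Longrightarrow> norm (f (t, x)) \<le> A * (1 / sqrt t) ^ j * (1 + t) powr (-3/2)"
  by (simp add: pdecay_def)

lemma borel_measurable_slice:
  fixes f :: "'a::second_countable_topology \<times> 'b::second_countable_topology \<Rightarrow> 'c::topological_space"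
  assumes "f \<in> borel_measurable borel"
  shows "(\<lambda>x. f (t, x)) \<in> borel_measurable borel"
  by (rule measurable_compose[OF _ assms]) (auto intro!: borel_measurable_continuous_onI continuous_intros)

lemma decay_bound:
  fixes h :: "real \<times> (real^3) \<Rightarrow> 'b::euclidean_space" and f :: "real \<times> (real^3) \<Rightarrow> 'c::euclidean_space"
    and g :: "real \<times> (real^3) \<Rightarrow> 'd::euclidean_space"
  assumes f: "decay j A f" and g: "decay j B g" and A: "A \<ge> 0" and B: "B \<ge> 0"
    and h: "h \<in> borel_measurable borel"
    and le: "\<And>t. t > 0 \<Longrightarrow> AE x in lborel. norm (h (t, x)) \<le> norm (f (t, x)) + norm (g (t, x))"
  shows "decay j (A + B) h"
  unfolding decay_def
proof (intro conjI allI impI h)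
  fix t :: real assume t: "t > 0"
  note [measurable] = borel_measurable_slice[OF decay_meas[OF f], of t] borel_measurable_slice[OF decay_meas[OF g], of t]
  have "(\<integral>\<^sup>+x. ennreal (norm (h (t, x))) \<partial>lborel) \<le> (\<integral>\<^sup>+x. ennreal (norm (f (t, x))) + ennreal (norm (g (t, x))) \<partial>lborel)"
    using le[OF t] by (intro nn_integral_mono_AE) (auto elim!: AE_mp intro!: AE_I2 ennreal_leI simp flip: ennreal_plus)
  also have "\<dots> = (\<integral>\<^sup>+x. ennreal (norm (f (t, x))) \<partial>lborel) + (\<integral>\<^sup>+x. ennreal (norm (g (t, x))) \<partial>lborel)"
    by (rule nn_integral_add) measurable
  also have "\<dots> \<le> ennreal (A * (1 / sqrt t) ^ j) + ennreal (B * (1 / sqrt t) ^ j)"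
    by (intro add_mono decay_imp_L1 f g t)
  also have "\<dots> = ennreal ((A + B) * (1 / sqrt t) ^ j)"
    using A B t by (simp add: algebra_simps flip: ennreal_plus)
  finally show "(\<integral>\<^sup>+x. ennreal (norm (h (t, x))) \<partial>lborel) \<le> ennreal ((A + B) * (1 / sqrt t) ^ j)" .
  show "AE x in lborel. norm (h (t, x)) \<le> (A + B) * (1 / sqrt t) ^ j * (1 + t) powr (-3/2)"
    using le[OF t] decay_imp_norm[OF f t] decay_imp_norm[OF g t]
  proof eventually_elim
    case (elim x)
    then have "norm (h (t, x)) \<le> A * (1 / sqrt t) ^ j * (1 + t) powr (-3/2) + B * (1 / sqrt t) ^ j * (1 + t) powr (-3/2)"
      by linarith
    then show ?case by (simp add: distrib_right)
  qed
qed

lemma decay_add: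
  assumes "decay j A f" "decay j B g" "A \<ge> 0" "B \<ge> 0"
  shows "decay j (A + B) (\<lambda>p. f p + g p)"
proof (rule decay_bound[OF assms])
  note [measurable] = decay_meas[OF assms(1)] decay_meas[OF assms(2)]
  show "(\<lambda>p. f p + g p) \<in> borel_measurable borel" by measurable
qed (auto intro: norm_triangle_ineq)

lemma decay_diff:
  assumes "decay j A f" "decay j B g" "A \<ge> 0" "B \<ge> 0"
  shows "decay j (A + B) (\<lambda>p. f p - g p)"
proof (rule decay_bound[OF assms])
  note [measurable] = decay_meas[OF assms(1)] decay_meas[OF assms(2)]
  show "(\<lambda>p. f p - g p) \<in> borel_measurable borel" by measurable
qed (auto intro: norm_triangle_ineq4)

lemma pdecay_add:
  assumes "pdecay j A f" "pdecay j B g" "A \<ge> 0" "B \<ge> 0"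
  shows "pdecay j (A + B) (\<lambda>p. f p + g p)"
proof -
  have "norm (f (t, x) + g (t, x)) \<le> (A + B) * (1 / sqrt t) ^ j * (1 + t) powr (-3/2)" if "t > 0" for t x
    using norm_triangle_ineq[of "f (t, x)" "g (t, x)"] pdecay_imp_norm[OF assms(1) that, of x] pdecay_imp_norm[OF assms(2) that, of x]
    by (simp add: distrib_right)
  then show ?thesis using assms decay_add[of j A f B g] unfolding pdecay_def by blast
qed

lemma pdecay_uminus: "pdecay j A f \<Longrightarrow> pdecay j A (\<lambda>p. - f p)"
  by (auto simp: pdecay_def decay_def)

lemma pdecay_diff:
  assumes "pdecay j A f" "pdecay j B g" "A \<ge> 0" "B \<ge> 0"
  shows "pdecay j (A + B) (\<lambda>p. f p - g p)"
  using pdecay_add[OF assms(1) pdecay_uminus[OF assms(2)] assms(3,4)] by simp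

lemma decay_cong_AE:
  assumes "decay j A f" "g \<in> borel_measurable borel" "\<And>t. t > 0 \<Longrightarrow> AE x in lborel. g (t, x) = f (t, x)"
  shows "decay j A g"
proof -
  note norms = decay_imp_norm[OF assms(1)] and L1s = decay_imp_L1[OF assms(1)]
  have "(\<integral>\<^sup>+x. ennreal (norm (g (t, x))) \<partial>lborel) = (\<integral>\<^sup>+x. ennreal (norm (f (t, x))) \<partial>lborel)" if "t > 0" for t
    using assms(3)[OF that] by (intro nn_integral_cong_AE) auto
  moreover have "AE x in lborel. norm (g (t, x)) \<le> A * (1 / sqrt t) ^ j * (1 + t) powr (-3/2)" if "t > 0" for t
    using assms(3)[OF that] norms[OF that] by eventually_elim simp
  ultimately show ?thesis using L1s assms(2) unfolding decay_def by simp
qed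

lemma decay_scaleR:
  assumes "decay j A f" "a \<ge> 0"
  shows "decay j (a * A) (\<lambda>p. a *\<^sub>R f p)"
  unfolding decay_def
proof (intro conjI allI impI)
  note [measurable] = decay_meas[OF assms(1)]
  show "(\<lambda>p. a *\<^sub>R f p) \<in> borel_measurable borel" by measurable
  fix t :: real assume t: "t > 0"
  note [measurable] = borel_measurable_slice[OF decay_meas[OF assms(1)], of t]
  have "(\<integral>\<^sup>+x. ennreal (norm (a *\<^sub>R f (t, x))) \<partial>lborel) = ennreal a * (\<integral>\<^sup>+x. ennreal (norm (f (t, x))) \<partial>lborel)"
    using assms(2) by (subst nn_integral_cmult[symmetric]) (auto simp: ennreal_mult)
  also have "\<dots> \<le> ennreal a * ennreal (A * (1 / sqrt t) ^ j)"
    by (intro mult_left_mono decay_imp_L1[OF assms(1)] t) auto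
  also have "\<dots> = ennreal (a * A * (1 / sqrt t) ^ j)"
    using assms(2) by (simp add: ennreal_mult' mult.assoc)
  finally show "(\<integral>\<^sup>+x. ennreal (norm (a *\<^sub>R f (t, x))) \<partial>lborel) \<le> ennreal (a * A * (1 / sqrt t) ^ j)" .
  show "AE x in lborel. norm (a *\<^sub>R f (t, x)) \<le> a * A * (1 / sqrt t) ^ j * (1 + t) powr (-3/2)"
    using decay_imp_norm[OF assms(1) t]
  proof eventually_elim
    case (elim x)
    from mult_left_mono[OF this assms(2)] show ?case using assms(2) by (simp add: mult_ac)
  qed
qed

lemma pdecay_scaleR:
  assumes "pdecay j A f" "a \<ge> 0"
  shows "pdecay j (a * A) (\<lambda>p. a *\<^sub>R f p)"
proof -
  have "norm (a *\<^sub>R f (t, x)) \<le> a * A * (1 / sqrt t) ^ j * (1 + t) powr (-3/2)" if "t > 0" for t x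
    using mult_left_mono[OF pdecay_imp_norm[OF assms(1) that, of x] assms(2)] assms(2) by (simp add: mult_ac)
  then show ?thesis using assms decay_scaleR[of j A f a] unfolding pdecay_def by blast
qed

text \<open>The supremum bound passes to the limit pointwise, the \<open>L\<^sup>1\<close> bound by
  Fatou's lemma.\<close>

lemma pdecay_limit:
  assumes f: "\<And>n. pdecay j A (f n)" and lim: "\<And>p. (\<lambda>n. f n p) \<longlonglongrightarrow> g p"
  shows "pdecay j A g"
proof -
  have m: "f n \<in> borel_measurable borel" for n using f[of n] by (simp add: pdecay_def decay_def)
  have g: "g \<in> borel_measurable borel" by (rule borel_measurable_LIMSEQ_metric[OF m lim])
  have norm: "norm (g (t, x)) \<le> A * (1 / sqrt t) ^ j * (1 + t) powr (-3/2)" if "t > 0" for t x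
    by (rule Lim_norm_ubound[OF _ lim]) (use pdecay_imp_norm[OF f that] in \<open>auto intro!: always_eventually\<close>)
  have "(\<integral>\<^sup>+x. ennreal (norm (g (t, x))) \<partial>lborel) \<le> ennreal (A * (1 / sqrt t) ^ j)" if t: "t > 0" for t
  proof -
    note [measurable] = borel_measurable_slice[OF m, where t=t]
    have "(\<lambda>n. ennreal (norm (f n (t, x)))) \<longlonglongrightarrow> ennreal (norm (g (t, x)))" for x
      by (intro tendsto_ennrealI tendsto_norm lim)
    then have "(\<integral>\<^sup>+x. ennreal (norm (g (t, x))) \<partial>lborel) = (\<integral>\<^sup>+x. liminf (\<lambda>n. ennreal (norm (f n (t, x)))) \<partial>lborel)"
      by (intro nn_integral_cong) (metis lim_imp_Liminf sequentially_bot)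
    also have "\<dots> \<le> liminf (\<lambda>n. \<integral>\<^sup>+x. ennreal (norm (f n (t, x))) \<partial>lborel)"
      by (rule nn_integral_liminf) measurable
    also have "\<dots> \<le> ennreal (A * (1 / sqrt t) ^ j)"
      using decay_imp_L1[OF pdecay_imp_decay[OF f] t] by (intro Liminf_le) (auto intro!: always_eventually)
    finally show ?thesis .
  qed
  then show ?thesis using g norm unfolding pdecay_def decay_def by auto
qed

text \<open>Completeness, by hand, for geometrically small increments. For \<open>t > 0\<close> the
  supremum bound makes the sequence converge at every point; for \<open>t \<le> 0\<close> it is
  constant by \<open>const\<close>. The rate comes from finite differences and
  \<open>pdecay_limit\<close>.\<close>

lemma pdecay_geometric_limit:
  fixes f :: "nat \<Rightarrow> real \<times> (real^3) \<Rightarrow> 'b::euclidean_space"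
  assumes d: "\<And>n. pdecay j (A * (1/2) ^ n) (\<lambda>p. f n p - f (Suc n) p)" and A: "A \<ge> 0"
    and const: "\<And>n p. fst p \<le> 0 \<Longrightarrow> f (Suc n) p = f n p"
  obtains g where "\<And>p. (\<lambda>n. f n p) \<longlonglongrightarrow> g p" "\<And>n. pdecay j (2 * A * (1/2) ^ n) (\<lambda>p. f n p - g p)"
proof -
  have "\<exists>l. (\<lambda>n. f n p) \<longlonglongrightarrow> l" for p
  proof (cases "fst p > 0")
    case True
    define M where "M = A * (1 / sqrt (fst p)) ^ j * (1 + fst p) powr (-3/2)"
    have "norm (f (Suc n) p - f n p) \<le> M * (1/2) ^ n" for n
      using pdecay_imp_norm[OF d[of n] True, of "snd p"] by (simp add: M_def norm_minus_commute mult_ac)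
    moreover have "summable (\<lambda>n. M * (1/2::real) ^ n)" by (intro summable_mult summable_geometric) simp
    ultimately have "summable (\<lambda>n. f (Suc n) p - f n p)" by (rule summable_comparison_test'[rotated])
    from summable_LIMSEQ[OF this] have "(\<lambda>n. f n p - f 0 p) \<longlonglongrightarrow> (\<Sum>n. f (Suc n) p - f n p)"
      by (simp only: sum_lessThan_telescope[of "\<lambda>n. f n p"])
    from tendsto_add[OF this tendsto_const[of "f 0 p"]] show ?thesis by auto
  next
    case False
    then have "f n p = f 0 p" for n by (induction n) (auto simp: const)
    then have "(\<lambda>n. f n p) = (\<lambda>n. f 0 p)" by (rule ext)
    from arg_cong[where f="\<lambda>h. h \<longlonglongrightarrow> f 0 p", OF this] have "(\<lambda>n. f n p) \<longlonglongrightarrow> f 0 p" by simp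
    then show ?thesis ..
  qed
  then obtain g where g: "\<And>p. (\<lambda>n. f n p) \<longlonglongrightarrow> g p" by metis
  \<comment> \<open>Subtracting the tail of the geometric series that has not been reached yet lets
    the induction close with equality: with \<open>q = A * (1/2) ^ (n + m)\<close> the step reads
    \<open>- 2 * q + q = - q\<close>, and \<open>q\<close> is the tail at
    \<open>Suc m\<close>.\<close>
  have part: "pdecay j (2 * A * (1/2) ^ n - 2 * A * (1/2) ^ (n + m)) (\<lambda>p. f n p - f (n + m) p)" for n m
  proof (induction m)
    case 0
    show ?case by (simp add: pdecay_def decay_def)
  next
    case (Suc m)
    have "(1/2::real) ^ (n + m) \<le> (1/2) ^ n" by (rule power_decreasing) auto
    then have "2 * A * (1/2) ^ (n + m) \<le> 2 * A * (1/2) ^ n" using A by (intro mult_left_mono) auto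
    then have "pdecay j (2 * A * (1/2) ^ n - 2 * A * (1/2) ^ (n + m) + A * (1/2) ^ (n + m)) (\<lambda>p. (f n p - f (n + m) p) + (f (n + m) p - f (Suc (n + m)) p))"
      using A by (intro pdecay_add Suc.IH d) auto
    then show ?case by (simp add: algebra_simps)
  qed
  have "pdecay j (2 * A * (1/2) ^ n) (\<lambda>p. f n p - g p)" for n
  proof (rule pdecay_limit)
    show "pdecay j (2 * A * (1/2) ^ n) (\<lambda>p. f n p - f (n + m) p)" for m
      using A by (intro pdecay_mono[OF part]) auto
    show "(\<lambda>m. f n p - f (n + m) p) \<longlonglongrightarrow> f n p - g p" for p
      using LIMSEQ_ignore_initial_segment[OF g[of p], of n] by (intro tendsto_intros) (simp add: add.commute)
  qed
  then show ?thesis using g that by blast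
qed

subsection \<open>The nonlinearity and the kernels\<close>

definition Nl :: "real^3 \<Rightarrow> real^3^3 \<Rightarrow> real^3" where
  "Nl u J = J *v u + (1/2 * trace J) *\<^sub>R u"

lemma nonlinearity_eq_Nl: "nonlinearity f J x = Nl (f x) (J x)"
  by (simp add: nonlinearity_def Nl_def)

lemma Nl_nth: "Nl u J $ k = (\<Sum>m\<in>UNIV. J $ k $ m * u $ m) + 1/2 * (\<Sum>m\<in>UNIV. J $ m $ m) * u $ k"
  by (simp add: Nl_def matrix_vector_mult_def trace_def)

lemma Nl_diff_left: "Nl (u - v) J = Nl u J - Nl v J"
  and Nl_diff_right: "Nl u (J - L) = Nl u J - Nl u L"
  and Nl_add_left: "Nl (u + v) J = Nl u J + Nl v J"
  and Nl_add_right: "Nl u (J + L) = Nl u J + Nl u L"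
  and Nl_scaleR_left: "Nl (a *\<^sub>R u) J = a *\<^sub>R Nl u J"
  and Nl_scaleR_right: "Nl u (a *\<^sub>R J) = a *\<^sub>R Nl u J"
  by (simp_all add: vec_eq_iff Nl_nth sum_3 algebra_simps add_divide_distrib diff_divide_distrib)

lemma abs_matrix_nth_le: "\<bar>(J::real^3^3) $ i $ k\<bar> \<le> norm J"
  using component_le_norm_cart[of "J $ i" k] Finite_Cartesian_Product.norm_nth_le[of J i] by linarith

text \<open>Each component is at most \<open>3 + 3/2\<close> times the product of the norms, and
  there are three of them; \<open>27/2\<close> is rounded up to \<open>14\<close>.\<close>

lemma norm_Nl: "norm (Nl u J) \<le> 14 * norm u * norm J"
proof -
  have u: "\<bar>u $ m\<bar> \<le> norm u" for m by (rule component_le_norm_cart)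
  have Ju: "\<bar>J $ i $ m * u $ l\<bar> \<le> norm J * norm u" for i m l
    unfolding abs_mult using u abs_matrix_nth_le by (intro mult_mono) auto
  have "\<bar>Nl u J $ k\<bar> \<le> (\<Sum>m\<in>(UNIV::3 set). norm J * norm u) + 1/2 * (\<Sum>m\<in>(UNIV::3 set). norm J * norm u)" for k
  proof -
    have "Nl u J $ k = (\<Sum>m\<in>UNIV. J $ k $ m * u $ m) + 1/2 * (\<Sum>m\<in>UNIV. J $ m $ m * u $ k)"
      by (simp add: Nl_nth sum_distrib_right)
    also have "\<bar>\<dots>\<bar> \<le> (\<Sum>m\<in>UNIV. \<bar>J $ k $ m * u $ m\<bar>) + 1/2 * (\<Sum>m\<in>UNIV. \<bar>J $ m $ m * u $ k\<bar>)"
      using sum_abs[of "\<lambda>m. J $ k $ m * u $ m" UNIV] sum_abs[of "\<lambda>m. J $ m $ m * u $ k" UNIV] by linarith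
    also have "\<dots> \<le> (\<Sum>m\<in>(UNIV::3 set). norm J * norm u) + 1/2 * (\<Sum>m\<in>(UNIV::3 set). norm J * norm u)"
      by (intro add_mono mult_left_mono sum_mono Ju) auto
    finally show ?thesis .
  qed
  then have "(\<Sum>k\<in>UNIV. \<bar>Nl u J $ k\<bar>) \<le> (\<Sum>k\<in>(UNIV::3 set). 9/2 * (norm J * norm u))"
    by (intro sum_mono) (simp add: mult.commute)
  then have "norm (Nl u J) \<le> 27/2 * (norm J * norm u)" using norm_le_l1_cart[of "Nl u J"] by simp
  moreover have "0 \<le> norm J * norm u" by simp
  ultimately have "norm (Nl u J) \<le> 14 * (norm J * norm u)" by linarith
  then show ?thesis by (simp add: mult_ac)
qed

lemma continuous_Nl: "continuous_on UNIV (\<lambda>(u, J). Nl u J)"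
  unfolding Nl_def trace_def matrix_vector_mult_def split_beta
  by (intro continuous_intros continuous_on_vec_lambda)

lemma borel_measurable_Nl [measurable]:
  assumes "f \<in> borel_measurable M" "g \<in> borel_measurable M"
  shows "(\<lambda>p. Nl (f p) (g p)) \<in> borel_measurable M"
  using borel_measurable_continuous_Pair[OF assms continuous_Nl[unfolded split_beta]] by (simp add: split_beta)

lemma source_Nl:
  assumes u: "decay 0 A u" and J: "decay 1 B J" and A: "A \<ge> 0" and B: "B \<ge> 0"
  shows "source (14 * A * B) (\<lambda>p. Nl (u p) (J p))"
  unfolding source_def
proof (intro conjI allI impI)
  note [measurable] = decay_meas[OF u] decay_meas[OF J]
  show "(\<lambda>p. Nl (u p) (J p)) \<in> borel_measurable borel" by measurable
  fix s :: real assume s: "s > 0"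
  note [measurable] = borel_measurable_slice[OF decay_meas[OF J], of s]
  let ?p = "(1 + s) powr (-3/2)"
  have ub: "AE y in lborel. norm (u (s, y)) \<le> A * ?p" using decay_imp_norm[OF u s] by simp
  have Jb: "AE y in lborel. norm (J (s, y)) \<le> B * (1 / sqrt s) * ?p" using decay_imp_norm[OF J s] by simp
  have "(\<integral>\<^sup>+y. ennreal (norm (Nl (u (s, y)) (J (s, y)))) \<partial>lborel) \<le> (\<integral>\<^sup>+y. ennreal (14 * (A * ?p)) * ennreal (norm (J (s, y))) \<partial>lborel)"
  proof (rule nn_integral_mono_AE, use ub in eventually_elim)
    case (elim y)
    have "14 * norm (u (s, y)) * norm (J (s, y)) \<le> 14 * (A * ?p) * norm (J (s, y))"
      using elim by (intro mult_right_mono mult_left_mono) auto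
    then have "norm (Nl (u (s, y)) (J (s, y))) \<le> 14 * (A * ?p) * norm (J (s, y))"
      using norm_Nl[of "u (s, y)" "J (s, y)"] by linarith
    then show ?case using A by (subst ennreal_mult[symmetric]) (auto intro!: ennreal_leI)
  qed
  also have "\<dots> = ennreal (14 * (A * ?p)) * (\<integral>\<^sup>+y. ennreal (norm (J (s, y))) \<partial>lborel)"
    by (rule nn_integral_cmult) measurable
  also have "\<dots> \<le> ennreal (14 * (A * ?p)) * ennreal (B * (1 / sqrt s) ^ 1)"
    by (intro mult_left_mono decay_imp_L1[OF J s]) auto
  also have "\<dots> = ennreal (14 * A * B * tw s)"
    using A B s by (subst ennreal_mult[symmetric]) (auto simp: tw_def mult_ac)
  finally show "(\<integral>\<^sup>+y. ennreal (norm (Nl (u (s, y)) (J (s, y)))) \<partial>lborel) \<le> ennreal (14 * A * B * tw s)" .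
  show "AE y in lborel. norm (Nl (u (s, y)) (J (s, y))) \<le> 14 * A * B * tw s * ?p"
    using ub Jb
  proof eventually_elim
    case (elim y)
    have "14 * (norm (u (s, y)) * norm (J (s, y))) \<le> 14 * ((A * ?p) * (B * (1 / sqrt s) * ?p))"
      using elim A B s by (intro mult_left_mono mult_mono) auto
    then show ?case using norm_Nl[of "u (s, y)" "J (s, y)"] by (simp add: tw_def mult_ac)
  qed
qed

text \<open>Matrix kernel applied to a vector, written as a sum over axis vectors so that
  measurability and integrability follow from those of the scalar coefficients. In \<open>kJ\<close>
  the extra index \<open>m\<close> is the direction of differentiation.\<close>

definition kU :: "real \<Rightarrow> real \<Rightarrow> real^3 \<Rightarrow> real^3 \<Rightarrow> real^3" where
  "kU c \<tau> z v = (\<Sum>k\<in>UNIV. (\<Sum>l\<in>UNIV. ker c k l z3 \<tau> z * v $ l) *\<^sub>R axis k 1)"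

definition kJ :: "real \<Rightarrow> real \<Rightarrow> real^3 \<Rightarrow> real^3 \<Rightarrow> real^3^3" where
  "kJ c \<tau> z v = (\<Sum>k\<in>UNIV. \<Sum>m\<in>UNIV. (\<Sum>l\<in>UNIV. ker c k l (inc m z3) \<tau> z * v $ l) *\<^sub>R axis k (axis m 1))"

lemma kU_nth: "kU c \<tau> z v $ k = (\<Sum>l\<in>UNIV. ker c k l z3 \<tau> z * v $ l)"
  unfolding kU_def by (simp add: axis_def if_distrib cong: if_cong)

lemma kJ_nth: "kJ c \<tau> z v $ k $ m = (\<Sum>l\<in>UNIV. ker c k l (inc m z3) \<tau> z * v $ l)"
proof -
  have "(\<Sum>k'\<in>UNIV. \<Sum>m'\<in>UNIV. a k' m' *\<^sub>R axis k' (axis m' 1)) $ k $ m = a k m" for a :: "3 \<Rightarrow> 3 \<Rightarrow> real"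
  proof -
    have "\<forall>k m. (\<Sum>k'\<in>UNIV. \<Sum>m'\<in>UNIV. a k' m' *\<^sub>R axis k' (axis m' 1)) $ k $ m = a k m"
      unfolding forall_3 sum_3 by (simp add: axis_def)
    then show ?thesis by blast
  qed
  then show ?thesis unfolding kJ_def .
qed

lemma dkernel_kU:
  assumes c: "c \<ge> 1"
  shows "\<exists>C. dkernel c 0 C (kU c)"
proof -
  have "\<exists>C. \<forall>i. C i \<ge> 0 \<and> (\<forall>\<tau> z. \<tau> > 0 \<longrightarrow> \<bar>ker c (fst i) (snd i) (\<lambda>_. 0) \<tau> z\<bar> \<le> C i * kap c \<tau> z)"
    by (rule choice) (metis ker_bound[OF c, of _ _ "\<lambda>_. 0"] mult_1_right power_0 sum.neutral_const)
  then obtain C where C: "\<And>i. C i \<ge> 0" "\<And>k l \<tau> z. \<tau> > 0 \<Longrightarrow> \<bar>ker c k l z3 \<tau> z\<bar> \<le> C (k, l) * kap c \<tau> z"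
    by (metis fst_conv snd_conv)
  have "norm (kU c \<tau> z v) \<le> (\<Sum>k\<in>UNIV. \<Sum>l\<in>UNIV. C (k, l)) * kap c \<tau> z * norm v" if \<tau>: "\<tau> > 0" for \<tau> z v
  proof -
    have "norm (kU c \<tau> z v) \<le> (\<Sum>k\<in>UNIV. \<bar>\<Sum>l\<in>UNIV. ker c k l z3 \<tau> z * v $ l\<bar>)"
      using norm_le_l1_cart[of "kU c \<tau> z v"] by (simp add: kU_nth)
    also have "\<dots> \<le> (\<Sum>k\<in>UNIV. \<Sum>l\<in>UNIV. C (k, l) * kap c \<tau> z * norm v)"
    proof (intro sum_mono order_trans[OF sum_abs])
      fix k l
      show "\<bar>ker c k l z3 \<tau> z * v $ l\<bar> \<le> C (k, l) * kap c \<tau> z * norm v"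
        unfolding abs_mult using C(1)[of "(k, l)"] C(2)[OF \<tau>, of k l z] component_le_norm_cart[of v l]
        by (intro mult_mono) auto
    qed
    finally show ?thesis by (simp add: sum_distrib_right)
  qed
  moreover have "linear (kU c \<tau> z)" for \<tau> z
    by (rule linearI) (simp_all add: vec_eq_iff kU_nth algebra_simps sum.distrib sum_distrib_left)
  moreover have "(\<lambda>(\<tau>, z, v). kU c \<tau> z v) \<in> borel_measurable (borel \<Otimes>\<^sub>M borel \<Otimes>\<^sub>M borel)"
    unfolding kU_def split_beta by measurable
  ultimately show ?thesis
    using C(1) unfolding dkernel_def borel_prod by (intro exI[of _ "\<Sum>k\<in>UNIV. \<Sum>l\<in>UNIV. C (k, l)"]) (auto intro!: sum_nonneg)
qed

lemma dkernel_kJ: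
  assumes c: "c \<ge> 1"
  shows "\<exists>C. dkernel c 1 C (kJ c)"
proof -
  have s1: "(\<Sum>k\<in>UNIV. inc m z3 k) = 1" for m by (simp add: sum_inc)
  have "\<exists>C. C \<ge> 0 \<and> (\<forall>\<tau> z. \<tau> > 0 \<longrightarrow> \<bar>ker c k l (inc m z3) \<tau> z\<bar> \<le> C * (1 / sqrt \<tau>) * kap c \<tau> z)" for k l m
    using ker_bound[OF c, of k l "inc m z3"] unfolding s1 power_one_right by metis
  then obtain C where C: "\<And>k l m. C k l m \<ge> 0" "\<And>k l m \<tau> z. \<tau> > 0 \<Longrightarrow> \<bar>ker c k l (inc m z3) \<tau> z\<bar> \<le> C k l m * (1 / sqrt \<tau>) * kap c \<tau> z"
    by metis
  let ?C = "\<Sum>k\<in>UNIV. \<Sum>m\<in>UNIV. \<Sum>l\<in>UNIV. C k l m"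
  have "norm (kJ c \<tau> z v) \<le> ?C * (1 / sqrt \<tau>) ^ 1 * kap c \<tau> z * norm v" if \<tau>: "\<tau> > 0" for \<tau> z v
  proof -
    have "norm (kJ c \<tau> z v) \<le> (\<Sum>k\<in>UNIV. norm (kJ c \<tau> z v $ k))"
      unfolding norm_vec_def by (rule L2_set_le_sum) simp
    also have "\<dots> \<le> (\<Sum>k\<in>UNIV. \<Sum>m\<in>UNIV. \<bar>kJ c \<tau> z v $ k $ m\<bar>)"
      by (intro sum_mono norm_le_l1_cart)
    also have "\<dots> \<le> (\<Sum>k\<in>UNIV. \<Sum>m\<in>UNIV. \<Sum>l\<in>UNIV. C k l m * (1 / sqrt \<tau>) * kap c \<tau> z * norm v)"
      unfolding kJ_nth
    proof (intro sum_mono order_trans[OF sum_abs])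
      fix k m l
      show "\<bar>ker c k l (inc m z3) \<tau> z * v $ l\<bar> \<le> C k l m * (1 / sqrt \<tau>) * kap c \<tau> z * norm v"
        unfolding abs_mult using C(1)[of k l m] C(2)[OF \<tau>, of k l m z] component_le_norm_cart[of v l]
        by (intro mult_mono) auto
    qed
    finally show ?thesis by (simp add: sum_distrib_right sum_divide_distrib)
  qed
  moreover have "linear (kJ c \<tau> z)" for \<tau> z
    by (rule linearI) (simp_all add: vec_eq_iff kJ_nth algebra_simps sum.distrib sum_distrib_left)
  moreover have "(\<lambda>(\<tau>, z, v). kJ c \<tau> z v) \<in> borel_measurable (borel \<Otimes>\<^sub>M borel \<Otimes>\<^sub>M borel)"
    unfolding kJ_def split_beta by measurable
  ultimately show ?thesis
    using C(1) unfolding dkernel_def borel_prod by (intro exI[of _ ?C]) (auto intro!: sum_nonneg)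
qed

lemma dkernel_mono: "dkernel c j C k \<Longrightarrow> C \<le> C' \<Longrightarrow> c \<ge> 1 \<Longrightarrow> dkernel c j C' k"
proof -
  assume k: "dkernel c j C k" and C: "C \<le> C'" and c: "c \<ge> 1"
  have "C * (1 / sqrt \<tau>) ^ j * kap c \<tau> z * norm v \<le> C' * (1 / sqrt \<tau>) ^ j * kap c \<tau> z * norm v" if "\<tau> > 0" for \<tau> z v
    using C c that by (intro mult_right_mono) (auto simp: kap_nonneg)
  then show ?thesis using k C unfolding dkernel_def by (meson order_trans)
qed

lemma dint_diff: "dkernel c j C k \<Longrightarrow> dint k (\<lambda>p. n p - n' p) q p = dint k n q p - dint k n' q p"
  by (simp add: dint_def dkernel_def linear_diff scaleR_diff_right)

lemma duhamel_nonpos: "fst q \<le> 0 \<Longrightarrow> duhamel k n q = 0"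
proof -
  assume "fst q \<le> 0"
  then have "dint k n q p = 0" for p by (auto simp: dint_def indicator_def)
  then show ?thesis by (simp add: duhamel_def)
qed

lemma duhamel_diff:
  assumes c: "c \<ge> 1" and k: "dkernel c j C k" and j: "j \<le> 1"
    and n: "source B n" "B \<ge> 0" and n': "source B' n'" "B' \<ge> 0"
  shows "duhamel k (\<lambda>p. n p - n' p) q = duhamel k n q - duhamel k n' q"
proof (cases "fst q > 0")
  case True
  then show ?thesis unfolding duhamel_def dint_diff[OF k]
    using integrable_dint[OF c k n(1) j n(2), of "fst q" "snd q"] integrable_dint[OF c k n'(1) j n'(2), of "fst q" "snd q"] by simp
qed (simp add: duhamel_nonpos)

subsection \<open>The fixed point\<close>

definition BU :: "real \<Rightarrow> (real \<times> (real^3) \<Rightarrow> real^3) \<Rightarrow> (real \<times> (real^3) \<Rightarrow> real^3^3) \<Rightarrow> real \<times> (real^3) \<Rightarrow> real^3" where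
  "BU c u J = duhamel (kU c) (\<lambda>p. Nl (u p) (J p))"

definition BJ :: "real \<Rightarrow> (real \<times> (real^3) \<Rightarrow> real^3) \<Rightarrow> (real \<times> (real^3) \<Rightarrow> real^3^3) \<Rightarrow> real \<times> (real^3) \<Rightarrow> real^3^3" where
  "BJ c u J = duhamel (kJ c) (\<lambda>p. Nl (u p) (J p))"

definition dec :: "real \<Rightarrow> (real \<times> (real^3) \<Rightarrow> real^3) \<Rightarrow> (real \<times> (real^3) \<Rightarrow> real^3^3) \<Rightarrow> bool" where
  "dec A u J \<longleftrightarrow> decay 0 A u \<and> decay 1 A J"

definition pdec :: "real \<Rightarrow> (real \<times> (real^3) \<Rightarrow> real^3) \<Rightarrow> (real \<times> (real^3) \<Rightarrow> real^3^3) \<Rightarrow> bool" where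
  "pdec A u J \<longleftrightarrow> pdecay 0 A u \<and> pdecay 1 A J"

lemma pdec_imp_dec: "pdec A u J \<Longrightarrow> dec A u J"
  by (simp add: pdec_def dec_def pdecay_def)

lemma pdec_mono: "pdec A u J \<Longrightarrow> A \<le> B \<Longrightarrow> pdec B u J"
  using pdecay_mono[of 0 A u B] pdecay_mono[of 1 A J B] by (simp add: pdec_def)

lemma dec_mono: "dec A u J \<Longrightarrow> A \<le> B \<Longrightarrow> dec B u J"
  using decay_mono[of 0 A u B] decay_mono[of 1 A J B] by (simp add: dec_def)

lemma pdec_add: "pdec A u J \<Longrightarrow> pdec B v L \<Longrightarrow> A \<ge> 0 \<Longrightarrow> B \<ge> 0 \<Longrightarrow> pdec (A + B) (\<lambda>p. u p + v p) (\<lambda>p. J p + L p)"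
  by (simp add: pdec_def pdecay_add)

lemma pdec_diff: "pdec A u J \<Longrightarrow> pdec B v L \<Longrightarrow> A \<ge> 0 \<Longrightarrow> B \<ge> 0 \<Longrightarrow> pdec (A + B) (\<lambda>p. u p - v p) (\<lambda>p. J p - L p)"
  by (simp add: pdec_def pdecay_diff)

lemma dec_diff: "dec A u J \<Longrightarrow> dec B v L \<Longrightarrow> A \<ge> 0 \<Longrightarrow> B \<ge> 0 \<Longrightarrow> dec (A + B) (\<lambda>p. u p - v p) (\<lambda>p. J p - L p)"
  by (simp add: dec_def decay_diff)

lemma pdec_uminus: "pdec A u J \<Longrightarrow> pdec A (\<lambda>p. - u p) (\<lambda>p. - J p)"
  by (simp add: pdec_def pdecay_uminus)

lemma pdec_scaleR: "pdec A u J \<Longrightarrow> a \<ge> 0 \<Longrightarrow> pdec (a * A) (\<lambda>p. a *\<^sub>R u p) (\<lambda>p. a *\<^sub>R J p)"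
  by (simp add: pdec_def pdecay_scaleR)

text \<open>A single \<open>C\<close> for the kernel and for its gradient, so that one constant
  \<open>K\<close> governs the bilinear map on pairs.\<close>

locale bilin =
  fixes c C :: real
  assumes c: "c \<ge> 1" and kU: "dkernel c 0 C (kU c)" and kJ: "dkernel c 1 C (kJ c)"
begin

lemma C_nonneg: "C \<ge> 0"
  using kU by (simp add: dkernel_def)

text \<open>\<open>336 = 24 * 14\<close>: the Duhamel estimate times the bound of the
  nonlinearity.\<close>

definition "K = 336 * C"

lemma K_nonneg: "K \<ge> 0" using C_nonneg by (simp add: K_def)

lemma source_dec: "dec A u J \<Longrightarrow> dec B v L \<Longrightarrow> A \<ge> 0 \<Longrightarrow> B \<ge> 0 \<Longrightarrow> source (14 * A * B) (\<lambda>p. Nl (u p) (L p))"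
  unfolding dec_def by (intro source_Nl) auto

lemma pdec_B:
  assumes "dec A u J" "dec B v L" "A \<ge> 0" "B \<ge> 0"
  shows "pdec (K * A * B) (BU c u L) (BJ c u L)"
  using pdecay_duhamel[OF c kU source_dec[OF assms]] pdecay_duhamel[OF c kJ source_dec[OF assms]] assms(3,4)
  by (simp add: pdec_def BU_def BJ_def K_def mult_ac)

lemma B_diff:
  assumes "dec A u J" "dec B v L" "A \<ge> 0" "B \<ge> 0"
  shows "BU c u J p - BU c v L p = BU c (\<lambda>p. u p - v p) J p + BU c v (\<lambda>p. J p - L p) p"
    and "BJ c u J p - BJ c v L p = BJ c (\<lambda>p. u p - v p) J p + BJ c v (\<lambda>p. J p - L p) p"
proof -
  have s: "source (14 * A * A) (\<lambda>p. Nl (u p) (J p))" "source (14 * B * A) (\<lambda>p. Nl (v p) (J p))" "source (14 * B * B) (\<lambda>p. Nl (v p) (L p))"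
    using source_dec assms by blast+
  have p: "0 \<le> 14 * A * A" "0 \<le> 14 * B * A" "0 \<le> 14 * B * B" using assms by auto
  show "BU c u J p - BU c v L p = BU c (\<lambda>p. u p - v p) J p + BU c v (\<lambda>p. J p - L p) p"
    unfolding BU_def Nl_diff_left Nl_diff_right
    by (simp add: duhamel_diff[OF c kU _ s(1) p(1) s(2) p(2)] duhamel_diff[OF c kU _ s(2) p(2) s(3) p(3)])
  show "BJ c u J p - BJ c v L p = BJ c (\<lambda>p. u p - v p) J p + BJ c v (\<lambda>p. J p - L p) p"
    unfolding BJ_def Nl_diff_left Nl_diff_right
    by (simp add: duhamel_diff[OF c kJ _ s(1) p(1) s(2) p(2)] duhamel_diff[OF c kJ _ s(2) p(2) s(3) p(3)])
qed

lemma pdec_B_diff: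
  assumes "dec A u J" "dec B v L" "dec \<delta> (\<lambda>p. u p - v p) (\<lambda>p. J p - L p)" "A \<ge> 0" "B \<ge> 0" "\<delta> \<ge> 0"
  shows "pdec (K * (A + B) * \<delta>) (\<lambda>p. BU c u J p - BU c v L p) (\<lambda>p. BJ c u J p - BJ c v L p)"
proof -
  have "K * \<delta> * A + K * B * \<delta> = K * (A + B) * \<delta>" by (simp add: algebra_simps)
  then show ?thesis
    using pdec_add[OF pdec_B[OF assms(3,1)] pdec_B[OF assms(2,3)]] assms(4-6) K_nonneg
    by (simp add: B_diff[OF assms(1,2,4,5)])
qed

primrec picard :: "(real \<times> (real^3) \<Rightarrow> real^3) \<Rightarrow> (real \<times> (real^3) \<Rightarrow> real^3^3) \<Rightarrow> nat \<Rightarrow>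
    (real \<times> (real^3) \<Rightarrow> real^3) \<times> (real \<times> (real^3) \<Rightarrow> real^3^3)" where
  "picard u0 J0 0 = (u0, J0)"
| "picard u0 J0 (Suc n) = (\<lambda>p. u0 p - BU c (fst (picard u0 J0 n)) (snd (picard u0 J0 n)) p,
     \<lambda>p. J0 p - BJ c (fst (picard u0 J0 n)) (snd (picard u0 J0 n)) p)"

text \<open>\<open>8 * K * A \<le> 1\<close> serves twice: the ball of radius \<open>2 * A\<close>
  is preserved since \<open>A + K * (2 * A)\<^sup>2 \<le> 3/2 * A\<close>, and differences contract
  by \<open>K * (2 * A + 2 * A) \<le> 1/2\<close>. The Jacobian is an independent unknown here; its
  relation to the field is established separately.\<close>

lemma fixpoint_exists:
  assumes U0: "pdec A u0 J0" and A: "A \<ge> 0" and small: "8 * K * A \<le> 1"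
  obtains u J where "pdec (2 * A) u J"
    "\<And>p. u p = u0 p - BU c u J p" "\<And>p. J p = J0 p - BJ c u J p"
proof -
  define us where "us n = fst (picard u0 J0 n)" for n
  define Js where "Js n = snd (picard u0 J0 n)" for n
  have us: "us (Suc n) p = u0 p - BU c (us n) (Js n) p" "Js (Suc n) p = J0 p - BJ c (us n) (Js n) p"
    and us0: "us 0 = u0" "Js 0 = J0" for n p
    by (simp_all add: us_def Js_def)
  have KA: "K * A * A \<le> A / 8"
    using mult_right_mono[OF small A] by simp
  have b: "pdec (2 * A) (us n) (Js n)" for n
  proof (induction n)
    case 0
    then show ?case using A by (auto simp: us0 intro: pdec_mono[OF U0])
  next
    case (Suc n)
    have "pdec (A + K * (2 * A) * (2 * A)) (us (Suc n)) (Js (Suc n))"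
      unfolding us using A K_nonneg
      by (intro pdec_diff U0 pdec_B[OF pdec_imp_dec[OF Suc] pdec_imp_dec[OF Suc]]) auto
    then show ?case by (rule pdec_mono) (use KA A in simp)
  qed
  have d: "pdec (A * (1/2) ^ n) (\<lambda>p. us n p - us (Suc n) p) (\<lambda>p. Js n p - Js (Suc n) p)" for n
  proof (induction n)
    case 0
    have "pdec (K * A * A) (\<lambda>p. us 0 p - us (Suc 0) p) (\<lambda>p. Js 0 p - Js (Suc 0) p)"
      using pdec_B[OF pdec_imp_dec[OF U0] pdec_imp_dec[OF U0] A A] by (simp add: us us0)
    then show ?case by (rule pdec_mono) (use KA A in simp)
  next
    case (Suc n)
    have "pdec (K * (2 * A + 2 * A) * (A * (1/2) ^ n))
      (\<lambda>p. BU c (us n) (Js n) p - BU c (us (Suc n)) (Js (Suc n)) p) (\<lambda>p. BJ c (us n) (Js n) p - BJ c (us (Suc n)) (Js (Suc n)) p)"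
      using A by (intro pdec_B_diff pdec_imp_dec b Suc) auto
    from pdec_uminus[OF this]
    have "pdec (4 * (K * A * A) * (1/2) ^ n) (\<lambda>p. us (Suc n) p - us (Suc (Suc n)) p) (\<lambda>p. Js (Suc n) p - Js (Suc (Suc n)) p)"
      by (simp add: us algebra_simps)
    moreover have "4 * (K * A * A) * (1/2) ^ n \<le> 4 * (A / 8) * (1/2) ^ n"
      using KA by (intro mult_right_mono mult_left_mono) auto
    ultimately show ?case by (elim pdec_mono) (simp add: mult_ac)
  qed
  \<comment> \<open>For \<open>t \<le> 0\<close> every Duhamel term is zero, so the iterates are
    constant and the pointwise limit exists on all of space-time.\<close>
  have cu: "us (Suc n) p = us n p" if "fst p \<le> 0" for n p
    using that by (cases n) (simp_all add: us us0 BU_def duhamel_nonpos)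
  have cJ: "Js (Suc n) p = Js n p" if "fst p \<le> 0" for n p
    using that by (cases n) (simp_all add: us us0 BJ_def duhamel_nonpos)
  have d0: "pdecay 0 (A * (1/2) ^ n) (\<lambda>p. us n p - us (Suc n) p)"
    and d1: "pdecay 1 (A * (1/2) ^ n) (\<lambda>p. Js n p - Js (Suc n) p)" for n
    using d[of n] by (simp_all add: pdec_def)
  obtain u where u: "\<And>p. (\<lambda>n. us n p) \<longlonglongrightarrow> u p" "\<And>n. pdecay 0 (2 * A * (1/2) ^ n) (\<lambda>p. us n p - u p)"
    using pdecay_geometric_limit[OF d0 A cu] by blast
  obtain J where J: "\<And>p. (\<lambda>n. Js n p) \<longlonglongrightarrow> J p" "\<And>n. pdecay 1 (2 * A * (1/2) ^ n) (\<lambda>p. Js n p - J p)"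
    using pdecay_geometric_limit[OF d1 A cJ] by blast
  have uJ: "pdec (2 * A) u J"
    using pdecay_limit[OF _ u(1), of 0 "2 * A"] pdecay_limit[OF _ J(1), of 1 "2 * A"] b by (simp add: pdec_def)
  have dd: "pdec (2 * A * (1/2) ^ n) (\<lambda>p. us n p - u p) (\<lambda>p. Js n p - J p)" for n
    using u(2) J(2) by (simp add: pdec_def)
  have B: "pdec (K * (2 * A + 2 * A) * (2 * A * (1/2) ^ n)) (\<lambda>p. BU c (us n) (Js n) p - BU c u J p) (\<lambda>p. BJ c (us n) (Js n) p - BJ c u J p)" for n
    using A by (intro pdec_B_diff pdec_imp_dec b uJ dd) auto
  have lim0: "(\<lambda>n. K * (2 * A + 2 * A) * (2 * A * (1/2) ^ n) * r) \<longlonglongrightarrow> 0" for r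
    by (intro tendsto_mult_left_zero tendsto_mult_right_zero LIMSEQ_power_zero) simp
  have BUl: "(\<lambda>n. BU c (us n) (Js n) p) \<longlonglongrightarrow> BU c u J p" for p
  proof (cases "fst p > 0")
    case True
    have "(\<lambda>n. BU c (us n) (Js n) p - BU c u J p) \<longlonglongrightarrow> 0"
    proof (rule Lim_null_comparison[OF _ lim0])
      show "\<forall>\<^sub>F n in sequentially. norm (BU c (us n) (Js n) p - BU c u J p) \<le> K * (2 * A + 2 * A) * (2 * A * (1/2) ^ n) * ((1 / sqrt (fst p)) ^ 0 * (1 + fst p) powr (-3/2))"
        using pdecay_imp_norm[OF B[unfolded pdec_def, THEN conjunct1] True, of _ "snd p"]
        by (auto intro!: always_eventually simp: mult_ac)
    qed
    then show ?thesis by (simp add: LIM_zero_iff)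
  qed (simp add: BU_def duhamel_nonpos)
  have BJl: "(\<lambda>n. BJ c (us n) (Js n) p) \<longlonglongrightarrow> BJ c u J p" for p
  proof (cases "fst p > 0")
    case True
    have "(\<lambda>n. BJ c (us n) (Js n) p - BJ c u J p) \<longlonglongrightarrow> 0"
    proof (rule Lim_null_comparison[OF _ lim0])
      show "\<forall>\<^sub>F n in sequentially. norm (BJ c (us n) (Js n) p - BJ c u J p) \<le> K * (2 * A + 2 * A) * (2 * A * (1/2) ^ n) * ((1 / sqrt (fst p)) ^ 1 * (1 + fst p) powr (-3/2))"
        using pdecay_imp_norm[OF B[unfolded pdec_def, THEN conjunct2] True, of _ "snd p"]
        by (auto intro!: always_eventually simp: mult_ac)
    qed
    then show ?thesis by (simp add: LIM_zero_iff)
  qed (simp add: BJ_def duhamel_nonpos)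
  have "u p = u0 p - BU c u J p" for p
    by (rule LIMSEQ_unique[OF LIMSEQ_Suc[OF u(1)]]) (auto simp: us intro!: tendsto_intros BUl)
  moreover have "J p = J0 p - BJ c u J p" for p
    by (rule LIMSEQ_unique[OF LIMSEQ_Suc[OF J(1)]]) (auto simp: us intro!: tendsto_intros BJl)
  ultimately show ?thesis using uJ that by blast
qed

text \<open>\<open>4 * K * R \<le> 1\<close> makes the contraction factor \<open>K * (R + R)\<close>
  at most \<open>1/2\<close>. The difference, at first bounded by \<open>2 * R\<close>, is fed back
  into its own equation and is therefore bounded by \<open>2 * R * (1/2) ^ n\<close> for all
  \<open>n\<close>. The equations are assumed almost everywhere, as a mild solution provides
  them.\<close>

lemma fixpoint_unique:
  assumes u: "dec R u J" and v: "dec R v L" and R: "R \<ge> 0" and small: "4 * K * R \<le> 1"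
    and fu: "\<And>t. t > 0 \<Longrightarrow> AE x in lborel. u (t, x) = u0 (t, x) - BU c u J (t, x)"
    and fJ: "\<And>t. t > 0 \<Longrightarrow> AE x in lborel. J (t, x) = J0 (t, x) - BJ c u J (t, x)"
    and fv: "\<And>t. t > 0 \<Longrightarrow> AE x in lborel. v (t, x) = u0 (t, x) - BU c v L (t, x)"
    and fL: "\<And>t. t > 0 \<Longrightarrow> AE x in lborel. L (t, x) = J0 (t, x) - BJ c v L (t, x)"
    and t: "t > 0"
  shows "AE x in lborel. u (t, x) = v (t, x)"
proof -
  let ?d = "\<lambda>p. u p - v p" and ?dJ = "\<lambda>p. J p - L p"
  have m: "?d \<in> borel_measurable borel" "?dJ \<in> borel_measurable borel"
    using dec_diff[OF u v R R] by (auto simp: dec_def decay_def)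
  have "dec (2 * R * (1/2) ^ n) ?d ?dJ" for n
  proof (induction n)
    case 0
    show ?case using dec_diff[OF u v R R] by simp
  next
    case (Suc n)
    have "pdec (K * (R + R) * (2 * R * (1/2) ^ n)) (\<lambda>p. BU c u J p - BU c v L p) (\<lambda>p. BJ c u J p - BJ c v L p)"
      using R by (intro pdec_B_diff u v Suc) auto
    from pdec_imp_dec[OF pdec_uminus[OF this]]
    have "dec (K * (R + R) * (2 * R * (1/2) ^ n)) ?d ?dJ"
      unfolding dec_def
    proof (elim conjE, intro conjI)
      assume 1: "decay 0 (K * (R + R) * (2 * R * (1/2) ^ n)) (\<lambda>p. - (BU c u J p - BU c v L p))"
      show "decay 0 (K * (R + R) * (2 * R * (1/2) ^ n)) ?d"
      proof (rule decay_cong_AE[OF 1 m(1)])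
        fix t :: real assume "t > 0"
        from fu[OF this] fv[OF this] show "AE x in lborel. u (t, x) - v (t, x) = - (BU c u J (t, x) - BU c v L (t, x))"
          by eventually_elim simp
      qed
      assume 2: "decay 1 (K * (R + R) * (2 * R * (1/2) ^ n)) (\<lambda>p. - (BJ c u J p - BJ c v L p))"
      show "decay 1 (K * (R + R) * (2 * R * (1/2) ^ n)) ?dJ"
      proof (rule decay_cong_AE[OF 2 m(2)])
        fix t :: real assume "t > 0"
        from fJ[OF this] fL[OF this] show "AE x in lborel. J (t, x) - L (t, x) = - (BJ c u J (t, x) - BJ c v L (t, x))"
          by eventually_elim simp
      qed
    qed
    moreover have "K * (R + R) * (2 * R * (1/2) ^ n) \<le> 2 * R * (1/2) ^ Suc n"
      using mult_right_mono[OF small, of "R * (1/2) ^ n"] R by (simp add: mult_ac)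
    ultimately show ?case by (rule dec_mono)
  qed
  then have "AE x in lborel. norm (?d (t, x)) \<le> 2 * R * (1/2) ^ n * (1 / sqrt t) ^ 0 * (1 + t) powr (-3/2)" for n
    unfolding dec_def by (intro decay_imp_norm t) blast
  \<comment> \<open>Each \<open>n\<close> has its own null set; countably many are discarded
    together before \<open>n\<close> tends to infinity.\<close>
  then have "AE x in lborel. \<forall>n. norm (?d (t, x)) \<le> 2 * R * (1/2) ^ n * (1 / sqrt t) ^ 0 * (1 + t) powr (-3/2)"
    by (simp add: AE_all_countable)
  then show ?thesis
  proof eventually_elim
    case (elim x)
    have "(\<lambda>n. 2 * R * (1/2) ^ n * (1 / sqrt t) ^ 0 * (1 + t) powr (-3/2)) \<longlonglongrightarrow> 0"
      by (intro tendsto_mult_left_zero tendsto_mult_right_zero LIMSEQ_power_zero) simp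
    then have "norm (?d (t, x)) \<le> 0"
      by (rule Lim_bounded2) (use elim in auto)
    then show ?case by simp
  qed
qed

end

lemma bilin_exists: "c \<ge> 1 \<Longrightarrow> \<exists>C. bilin c C"
proof -
  assume c: "c \<ge> 1"
  obtain A where A: "dkernel c 0 A (kU c)" using dkernel_kU[OF c] by blast
  obtain B where B: "dkernel c 1 B (kJ c)" using dkernel_kJ[OF c] by blast
  have "bilin c (max A B)"
    using c dkernel_mono[OF A _ c, of "max A B"] dkernel_mono[OF B _ c, of "max A B"] by unfold_locales auto
  then show ?thesis ..
qed

subsection \<open>Uniqueness of weak derivatives\<close>

text \<open>The classical smooth functions that vanish to infinite order at \<open>0\<close>.
  Allowing a polynomial in \<open>1 / y\<close> as a factor makes the family closed under
  differentiation.\<close>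

definition flat :: "real poly \<Rightarrow> real \<Rightarrow> real" where
  "flat p y = (if y > 0 then poly p (1 / y) * exp (- (1 / y)) else 0)"

lemma tendsto_poly_exp: "((\<lambda>z::real. poly p z * exp (- z)) \<longlongrightarrow> 0) at_top"
proof -
  have "((\<lambda>z. \<Sum>i\<le>degree p. coeff p i * (z ^ i / exp z)) \<longlongrightarrow> (\<Sum>i\<le>degree p. coeff p i * 0)) at_top"
    by (intro tendsto_intros tendsto_power_div_exp_0)
  then show ?thesis by (simp add: poly_altdef sum_distrib_right sum_divide_distrib exp_minus field_simps)
qed

text \<open>With \<open>z = 1 / y\<close> one has \<open>dz/dy = - z\<^sup>2\<close>, so
  \<open>P(z) exp (- z)\<close> has derivative \<open>z\<^sup>2 (P(z) - P'(z)) exp (- z)\<close>;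
  the factor \<open>[:0, 0, 1:]\<close> is \<open>z\<^sup>2\<close>. At \<open>y = 0\<close> the
  difference quotient is again of this type, with \<open>pCons 0 p\<close> in place of
  \<open>p\<close>, and tends to \<open>0\<close>.\<close>

lemma flat_has_real_derivative:
  "(flat p has_real_derivative flat ([:0, 0, 1:] * (p - pderiv p)) y) (at y)"
proof -
  consider "y > 0" | "y < 0" | "y = 0" by linarith
  then show ?thesis
  proof cases
    case 1
    have d: "((\<lambda>y. poly p (1 / y) * exp (- (1 / y))) has_real_derivative flat ([:0, 0, 1:] * (p - pderiv p)) y) (at y)"
      using 1 by (auto intro!: derivative_eq_intros DERIV_chain2[OF poly_DERIV] simp: flat_def power2_eq_square algebra_simps divide_simps)
    have "\<forall>\<^sub>F x in nhds y. x > 0" using 1 by (intro eventually_nhds_in_open[of "{0<..}", simplified]) auto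
    then have ev: "\<forall>\<^sub>F x in nhds y. poly p (1 / x) * exp (- (1 / x)) = flat p x"
      by eventually_elim (simp add: flat_def)
    show ?thesis by (rule DERIV_cong_ev[OF refl ev refl, THEN iffD1, OF d])
  next
    case 2
    have "\<forall>\<^sub>F x in nhds y. x < 0" using 2 by (intro eventually_nhds_in_open[of "{..<0}", simplified]) auto
    then have ev: "\<forall>\<^sub>F x in nhds y. 0 = flat p x" by eventually_elim (simp add: flat_def)
    have "((\<lambda>_. 0) has_real_derivative 0) (at y)" by simp
    then have "(flat p has_real_derivative 0) (at y)" by (rule DERIV_cong_ev[OF refl ev refl, THEN iffD1])
    then show ?thesis using 2 by (simp add: flat_def)
  next
    case 3
    have r: "((\<lambda>h. flat p h / h) \<longlongrightarrow> 0) (at_right 0)"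
    proof -
      have "((\<lambda>h::real. poly (pCons 0 p) (inverse h) * exp (- inverse h)) \<longlongrightarrow> 0) (at_right 0)"
        by (rule filterlim_compose[OF tendsto_poly_exp filterlim_inverse_at_top_right])
      moreover have "\<forall>\<^sub>F h::real in at_right 0. h > 0" by (rule eventually_at_right_less)
      then have "\<forall>\<^sub>F h::real in at_right 0. poly (pCons 0 p) (inverse h) * exp (- inverse h) = flat p h / h"
        by eventually_elim (simp add: flat_def divide_simps)
      ultimately show ?thesis by (rule Lim_transform_eventually)
    qed
    have l: "((\<lambda>h. flat p h / h) \<longlongrightarrow> 0) (at_left 0)"
    proof -
      have "\<forall>\<^sub>F h::real in at_left 0. h < 0" by (auto simp: eventually_at_filter)
      then have "\<forall>\<^sub>F h::real in at_left 0. 0 = flat p h / h"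
        by eventually_elim (simp add: flat_def)
      from Lim_transform_eventually[OF tendsto_const this] show ?thesis .
    qed
    have "((\<lambda>h. flat p h / h) \<longlongrightarrow> 0) (at 0)"
      using filterlim_split_at[OF l r] by simp
    then show ?thesis using 3 by (simp add: DERIV_def flat_def)
  qed
qed

text \<open>A class of functions generated by rules under which derivatives stay inside the class.
  Since \<open>test_function\<close> asks for all iterated partial derivatives, this closure reduces
  the matter to an induction on the list of directions.\<close>

inductive iter_diff :: "(real \<Rightarrow> real) \<Rightarrow> bool" where
  const: "iter_diff (\<lambda>_. a)"
| flat: "iter_diff (\<lambda>y. flat p (a * y + b))"
| mult: "iter_diff f \<Longrightarrow> iter_diff g \<Longrightarrow> iter_diff (\<lambda>y. f y * g y)"
| add: "iter_diff f \<Longrightarrow> iter_diff g \<Longrightarrow> iter_diff (\<lambda>y. f y + g y)"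

lemma iter_diff_derivative: "iter_diff f \<Longrightarrow> \<exists>f'. iter_diff f' \<and> (\<forall>y. (f has_real_derivative f' y) (at y))"
proof (induction rule: iter_diff.induct)
  case (const a)
  show ?case by (rule exI[of _ "\<lambda>_. 0"]) (auto intro: iter_diff.intros)
next
  case (flat p a b)
  let ?q = "[:0, 0, 1:] * (p - pderiv p)"
  have "((\<lambda>y. flat p (a * y + b)) has_real_derivative a * flat ?q (a * y + b)) (at y)" for y
  proof -
    have "((\<lambda>y. a * y + b) has_real_derivative a) (at y)" by (auto intro!: derivative_eq_intros)
    from DERIV_chain2[where f="flat p" and g="\<lambda>y. a * y + b" and x=y, OF flat_has_real_derivative this]
    show ?thesis by (simp add: mult.commute)
  qed
  moreover have "iter_diff (\<lambda>y. a * flat ?q (a * y + b))" by (intro iter_diff.intros)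
  ultimately show ?case by blast
next
  case (mult f g)
  then obtain f' g' where *: "iter_diff f'" "iter_diff g'" "\<And>y. (f has_real_derivative f' y) (at y)" "\<And>y. (g has_real_derivative g' y) (at y)"
    by blast
  have "((\<lambda>y. f y * g y) has_real_derivative f' y * g y + g' y * f y) (at y)" for y
    by (rule DERIV_mult) (rule *)+
  moreover have "iter_diff (\<lambda>y. f' y * g y + g' y * f y)" by (intro iter_diff.intros mult.hyps *)
  ultimately show ?case by blast
next
  case (add f g)
  then obtain f' g' where *: "iter_diff f'" "iter_diff g'" "\<And>y. (f has_real_derivative f' y) (at y)" "\<And>y. (g has_real_derivative g' y) (at y)"
    by blast
  have "((\<lambda>y. f y + g y) has_real_derivative f' y + g' y) (at y)" for y
    by (rule DERIV_add) (rule *)+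
  moreover have "iter_diff (\<lambda>y. f' y + g' y)" by (intro iter_diff.intros *)
  ultimately show ?case by blast
qed

lemma partial_prod:
  assumes "\<And>k. iter_diff (f k)"
  shows "\<exists>g. (\<forall>k. iter_diff (g k)) \<and> partial j (\<lambda>x. \<Prod>k\<in>UNIV. f k (x $ k)) = (\<lambda>x. \<Prod>k\<in>UNIV. g k (x $ k))"
proof -
  obtain f' where f': "iter_diff f'" "\<And>y. (f j has_real_derivative f' y) (at y)"
    using iter_diff_derivative[OF assms[of j]] by blast
  have "partial j (\<lambda>x. \<Prod>k\<in>UNIV. f k (x $ k)) x = (\<Prod>k\<in>UNIV. (f(j := f')) k (x $ k))" for x
  proof -
    have eq: "(\<Prod>k\<in>UNIV. f k ((x + h *\<^sub>R axis j 1) $ k)) = f j (x $ j + h) * (\<Prod>k\<in>UNIV - {j}. f k (x $ k))" for h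
      by (subst prod.remove[of _ j]) (auto simp: axis_def intro!: prod.cong)
    have eq': "(\<Prod>k\<in>UNIV. (f(j := f')) k (x $ k)) = f' (x $ j) * (\<Prod>k\<in>UNIV - {j}. f k (x $ k))"
      by (subst prod.remove[of _ j]) (auto intro!: prod.cong)
    have "((\<lambda>h. f j (x $ j + h)) has_real_derivative f' (x $ j)) (at 0)"
      using DERIV_shift[of "f j" "f' (x $ j)" 0 "x $ j"] f'(2)[of "x $ j"] by (simp add: add.commute)
    from DERIV_cmult_right[OF this, of "\<Prod>k\<in>UNIV - {j}. f k (x $ k)"]
    show ?thesis unfolding partial_def eq eq' by (rule DERIV_imp_deriv)
  qed
  moreover have "\<forall>k. iter_diff ((f(j := f')) k)" using assms f' by simp
  ultimately show ?thesis by blast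
qed

lemma foldr_partial_prod:
  assumes "\<And>k. iter_diff (f k)"
  shows "\<exists>g. (\<forall>k. iter_diff (g k)) \<and> foldr partial js (\<lambda>x. \<Prod>k\<in>UNIV. f k (x $ k)) = (\<lambda>x. \<Prod>k\<in>UNIV. g k (x $ k))"
proof (induction js)
  case Nil
  show ?case using assms by auto
next
  case (Cons j js)
  then obtain g where g: "\<And>k. iter_diff (g k)" "foldr partial js (\<lambda>x. \<Prod>k\<in>UNIV. f k (x $ k)) = (\<lambda>x. \<Prod>k\<in>UNIV. g k (x $ k))"
    by blast
  then show ?case using partial_prod[of g j, OF g(1)] by simp
qed

lemma differentiable_prod_coords:
  assumes "\<And>k. iter_diff (f k)"
  shows "(\<lambda>x::real^3. \<Prod>k\<in>UNIV. f k (x $ k)) differentiable (at x)"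
proof -
  have "(\<lambda>x::real^3. f k (x $ k)) differentiable (at x)" for k
  proof -
    obtain f' where "\<And>y. (f k has_real_derivative f' y) (at y)"
      using iter_diff_derivative[OF assms[of k]] by blast
    then have "f k differentiable (at (x $ k))"
      using real_differentiable_def by blast
    moreover have "(\<lambda>x::real^3. x $ k) differentiable (at x)"
      by (rule bounded_linear_imp_differentiable[OF bounded_linear_vec_nth])
    ultimately show ?thesis using differentiable_chain_at[of "\<lambda>x. x $ k" x "f k"] by (simp add: o_def)
  qed
  then obtain F where F: "\<And>k. ((\<lambda>x::real^3. f k (x $ k)) has_derivative F k) (at x)"
    unfolding differentiable_def by metis
  have "((\<lambda>x::real^3. \<Prod>k\<in>UNIV. f k (x $ k)) has_derivative
      (\<lambda>y. \<Sum>i\<in>UNIV. F i y * (\<Prod>k\<in>UNIV - {i}. f k (x $ k)))) (at x)"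
    by (rule has_derivative_prod) (rule F)
  then show ?thesis unfolding differentiable_def by blast
qed

text \<open>Smooth approximations of the indicator of the open box:
  \<open>exp (- 1 / (Suc n * d))\<close> tends to \<open>1\<close> for \<open>d > 0\<close>, and
  \<open>flat\<close> is \<open>0\<close> for \<open>d \<le> 0\<close>. The arguments keep the shape
  \<open>a * y + b\<close> required by \<open>iter_diff.flat\<close>.\<close>

definition bump :: "nat \<Rightarrow> real^3 \<Rightarrow> real^3 \<Rightarrow> real^3 \<Rightarrow> real" where
  "bump n a b x = (\<Prod>k\<in>UNIV. flat 1 (real (Suc n) * x $ k + - real (Suc n) * a $ k) *
     flat 1 (- real (Suc n) * x $ k + real (Suc n) * b $ k))"

lemma test_function_bump: "test_function (bump n a b)"
proof -
  let ?f = "\<lambda>k y. flat 1 (real (Suc n) * y + - real (Suc n) * a $ k) * flat 1 (- real (Suc n) * y + real (Suc n) * b $ k)"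
  have f: "iter_diff (?f k)" for k by (intro iter_diff.intros)
  have "foldr partial js (bump n a b) differentiable (at x)" for js x
    using foldr_partial_prod[of ?f js, OF f] differentiable_prod_coords
    unfolding bump_def[abs_def] by metis
  moreover have "{x. bump n a b x \<noteq> 0} \<subseteq> cbox a b"
  proof safe
    fix x assume "bump n a b x \<noteq> 0"
    then have "flat 1 (real (Suc n) * x $ k + - real (Suc n) * a $ k) \<noteq> 0" "flat 1 (- real (Suc n) * x $ k + real (Suc n) * b $ k) \<noteq> 0" for k
      by (auto simp: bump_def)
    then have pos: "0 < real (Suc n) * x $ k + - real (Suc n) * a $ k" "0 < - real (Suc n) * x $ k + real (Suc n) * b $ k" for k
      unfolding flat_def by meson+
    have e: "real (Suc n) * x $ k + - real (Suc n) * a $ k = real (Suc n) * (x $ k - a $ k)"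
      "- real (Suc n) * x $ k + real (Suc n) * b $ k = real (Suc n) * (b $ k - x $ k)" for k
      by (simp_all add: algebra_simps)
    have "0 < real (Suc n) * (x $ k - a $ k)" "0 < real (Suc n) * (b $ k - x $ k)" for k
      using pos[of k] unfolding e by blast+
    then have "a $ k \<le> x $ k \<and> x $ k \<le> b $ k" for k
      by (auto simp: zero_less_mult_iff intro: less_imp_le)
    then show "x \<in> cbox a b" by (simp add: mem_box_cart)
  qed
  then have "compact (closure {x. bump n a b x \<noteq> 0})"
    by (metis compact_cbox compact_closure bounded_subset bounded_cbox)
  ultimately show ?thesis unfolding test_function_def by blast
qed

lemma flat_1_bounds: "0 \<le> flat 1 y" "flat 1 y \<le> 1"
  by (auto simp: flat_def)

lemma bump_bounds: "0 \<le> bump n a b x" "bump n a b x \<le> 1"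
  unfolding bump_def by (auto intro!: prod_nonneg prod_le_1 mult_nonneg_nonneg mult_le_one flat_1_bounds)

lemma flat_limit: "(\<lambda>n. flat 1 (real (Suc n) * d)) \<longlonglongrightarrow> (if d > 0 then 1 else 0)"
proof (cases "d > 0")
  case True
  have "(\<lambda>n. exp (- (inverse (real (Suc n)) * (1 / d)))) \<longlonglongrightarrow> exp (- (0 * (1 / d)))"
    by (intro tendsto_intros LIMSEQ_inverse_real_of_nat)
  moreover have "exp (- (inverse (real (Suc n)) * (1 / d))) = flat 1 (real (Suc n) * d)" for n
    using True by (simp add: flat_def divide_simps)
  ultimately show ?thesis using True by simp
next
  case False
  then have "flat 1 (real (Suc n) * d) = 0" for n by (simp add: flat_def mult_le_0_iff not_less)
  then show ?thesis using False by simp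
qed

lemma bump_limit: "(\<lambda>n. bump n a b x) \<longlonglongrightarrow> indicator (box a b) x"
proof -
  have "(\<lambda>n. bump n a b x) \<longlonglongrightarrow> (\<Prod>k\<in>UNIV. (if x $ k - a $ k > 0 then 1 else 0) * (if b $ k - x $ k > 0 then 1 else 0))"
  proof -
    have eq: "bump n a b x = (\<Prod>k\<in>UNIV. flat 1 (real (Suc n) * (x $ k - a $ k)) * flat 1 (real (Suc n) * (b $ k - x $ k)))" for n
      unfolding bump_def by (intro prod.cong arg_cong2[where f="(*)"] arg_cong[where f="flat 1"]) (auto simp: algebra_simps)
    show ?thesis unfolding eq by (intro tendsto_intros flat_limit)
  qed
  also have "(\<Prod>k\<in>UNIV. (if x $ k - a $ k > 0 then 1 else 0 :: real) * (if b $ k - x $ k > 0 then 1 else 0)) = indicator (box a b) x"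
  proof (cases "x \<in> box a b")
    case True
    then show ?thesis by (simp add: mem_box_cart)
  next
    case False
    then obtain i where "\<not> (a $ i < x $ i \<and> x $ i < b $ i)" by (auto simp: mem_box_cart)
    then have "\<exists>k\<in>UNIV. (if x $ k - a $ k > 0 then 1 else 0) * (if b $ k - x $ k > 0 then 1 else 0 :: real) = 0"
      by (intro bexI[of _ i]) auto
    note eq = prod_zero[OF finite_class.finite_UNIV this]
    show ?thesis unfolding eq using False by simp
  qed
  finally show ?thesis .
qed

text \<open>Open boxes form an intersection-stable generator of the Borel sets, and the sets over
  which \<open>g\<close> integrates to zero form a Dynkin system; so \<open>g\<close> has integral
  zero over every Borel set.\<close>

lemma AE_zero_if_boxes:
  fixes g :: "'a::euclidean_space \<Rightarrow> real"
  assumes g: "integrable lborel g" and box: "\<And>a b. (LINT x|lborel. indicator (box a b) x * g x) = 0"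
  shows "AE x in lborel. g x = 0"
proof (rule sigma_finite_measure.density_zero[OF lborel.sigma_finite_measure_axioms g])
  note [measurable] = borel_measurable_integrable[OF g]
  have int: "integrable lborel (\<lambda>x. indicator A x * g x)" if "A \<in> sets lborel" for A
    using integrable_mult_indicator[OF that g] by simp
  \<comment> \<open>Complements in the Dynkin argument require the integral over the whole space to
    vanish; it is the limit over growing boxes.\<close>
  have tot: "(LINT x|lborel. g x) = 0"
  proof -
    let ?A = "\<lambda>n::nat. box (- (real n *\<^sub>R One)) (real n *\<^sub>R One) :: 'a set"
    have "(\<lambda>n. LINT x|lborel. indicator (?A n) x * g x) \<longlonglongrightarrow> (LINT x|lborel. g x)"
    proof (rule integral_dominated_convergence[where w="\<lambda>x. norm (g x)"])
      show "AE x in lborel. (\<lambda>n. indicator (?A n) x * g x) \<longlonglongrightarrow> g x"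
      proof (rule AE_I2)
        fix x :: 'a
        have "\<forall>\<^sub>F n in sequentially. x \<in> ?A n"
        proof -
          obtain N where N: "x \<in> ?A N" using UN_box_eq_UNIV by blast
          have "x \<in> ?A n" if "n \<ge> N" for n
          proof -
            have "?A N \<subseteq> ?A n" using that by (intro subset_box_imp) auto
            then show ?thesis using N by blast
          qed
          then show ?thesis by (auto simp: eventually_sequentially)
        qed
        then have "\<forall>\<^sub>F n in sequentially. g x = indicator (?A n) x * g x"
          by eventually_elim simp
        from Lim_transform_eventually[OF tendsto_const this]
        show "(\<lambda>n. indicator (?A n) x * g x) \<longlonglongrightarrow> g x" .
      qed
    qed (use g in \<open>auto simp: indicator_def\<close>)
    then show ?thesis by (simp add: box LIMSEQ_const_iff)
  qed
  fix A :: "'a set" assume "A \<in> sets lborel"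
  then have A: "A \<in> sigma_sets UNIV (range (\<lambda>(a, b). box a b))" by (simp add: borel_eq_box)
  have "(LINT x|lborel. indicator A x * g x) = 0"
  proof (rule sigma_sets_induct_disjoint[OF _ _ A, where P="\<lambda>A. (LINT x|lborel. indicator A x * g x) = 0"])
    show "Int_stable (range (\<lambda>(a, b). box a b::'a set))"
      by (auto simp: Int_stable_def box_Int_box)
    show "(LINT x|lborel. indicator B x * g x) = 0" if "B \<in> range (\<lambda>(a, b). box a b)" for B
      using that box by auto
    show "(LINT x|lborel. indicator {} x * g x) = 0" by simp
  next
    fix B :: "'a set" assume B: "B \<in> sigma_sets UNIV (range (\<lambda>(a, b). box a b))" and z: "(LINT x|lborel. indicator B x * g x) = 0"
    have "B \<in> sets lborel" using B by (simp add: borel_eq_box)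
    moreover have "indicator (UNIV - B) x * g x = g x - indicator B x * g x" for x by (auto simp: indicator_def)
    ultimately show "(LINT x|lborel. indicator (UNIV - B) x * g x) = 0"
      using int[of B] g tot z by simp
  next
    fix B :: "nat \<Rightarrow> 'a set" assume d: "disjoint_family B" and B: "range B \<subseteq> sigma_sets UNIV (range (\<lambda>(a, b). box a b))"
      and z: "\<And>i. (LINT x|lborel. indicator (B i) x * g x) = 0"
    have Bs: "B i \<in> sets lborel" for i using B by (auto simp: borel_eq_box)
    have "set_integrable lborel (\<Union>i. B i) g" using int[of "\<Union>i. B i"] Bs by (simp add: set_integrable_def)
    from lebesgue_integral_countable_add[OF Bs _ this]
    have "(LINT x:(\<Union>i. B i)|lborel. g x) = (\<Sum>i. LINT x:(B i)|lborel. g x)"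
      using d by (auto simp: disjoint_family_on_def)
    then show "(LINT x|lborel. indicator (\<Union>i. B i) x * g x) = 0"
      using z by (simp add: set_lebesgue_integral_def)
  qed auto
  then show "set_lebesgue_integral lborel A g = 0" by (simp add: set_lebesgue_integral_def)
qed

lemma AE_zero_if_test_functions:
  assumes g: "integrable lborel g" and test: "\<And>\<phi>. test_function \<phi> \<Longrightarrow> (LINT x|lborel. g x * \<phi> x) = 0"
  shows "AE x in lborel. g x = 0"
proof (rule AE_zero_if_boxes[OF g])
  note [measurable] = borel_measurable_integrable[OF g]
  fix a b :: "real^3"
  have [measurable]: "bump n a b \<in> borel_measurable borel" for n
    using test_function_imp(1)[OF test_function_bump] by (rule borel_measurable_continuous_onI)
  have "(\<lambda>n. LINT x|lborel. bump n a b x * g x) \<longlonglongrightarrow> (LINT x|lborel. indicator (box a b) x * g x)"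
  proof (rule integral_dominated_convergence[where w="\<lambda>x. norm (g x)"])
    show "AE x in lborel. norm (bump n a b x * g x) \<le> norm (g x)" for n
      using bump_bounds[of n a b] by (auto simp: abs_mult intro!: mult_left_le_one_le)
    show "AE x in lborel. (\<lambda>n. bump n a b x * g x) \<longlonglongrightarrow> indicator (box a b) x * g x"
      by (intro AE_I2 tendsto_intros bump_limit)
  qed (use g in auto)
  moreover have "(LINT x|lborel. bump n a b x * g x) = 0" for n
    using test[OF test_function_bump, of n a b] by (simp add: mult.commute)
  ultimately show "(LINT x|lborel. indicator (box a b) x * g x) = 0" by (simp add: LIMSEQ_const_iff)
qed

text \<open>Membership in the solution space allows any weak Jacobian. This lemma pins it down by
  the field, and so converts an equation between fields, valid almost everywhere, into one between
  Jacobians.\<close>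

lemma weak_jacobian_unique:
  assumes J: "weak_jacobian f J" and L: "weak_jacobian f' L" and eq: "AE x in lborel. f x = f' x"
  shows "AE x in lborel. J x = L x"
proof -
  have int: "integrable lborel (\<lambda>x. J x $ i $ j)" if "integrable lborel J" for J :: "real^3 \<Rightarrow> real^3^3" and i j
    using integrable_bounded_linear[OF bounded_linear_vec_nth integrable_bounded_linear[OF bounded_linear_vec_nth that]] .
  have iJ: "integrable lborel (\<lambda>x. J x $ i $ j)" and iL: "integrable lborel (\<lambda>x. L x $ i $ j)" for i j
    using J L int by (auto simp: weak_jacobian_def)
  have "AE x in lborel. J x $ i $ j - L x $ i $ j = 0" for i j
  proof (rule AE_zero_if_test_functions)
    show "integrable lborel (\<lambda>x. J x $ i $ j - L x $ i $ j)" using iJ iL by simp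
    fix \<phi> assume \<phi>: "test_function \<phi>"
    have pm [measurable]: "\<phi> \<in> borel_measurable borel" "partial j \<phi> \<in> borel_measurable borel"
      using test_function_imp(1)[OF \<phi>] test_function_imp(1)[OF test_function_partial[OF \<phi>]] by (auto intro: borel_measurable_continuous_onI)
    obtain B where B: "\<And>x. \<bar>\<phi> x\<bar> \<le> B" using test_function_imp(3)[OF \<phi>] by blast
    have m: "integrable lborel (\<lambda>x. h x * \<phi> x)" if "integrable lborel h" for h :: "real^3 \<Rightarrow> real"
      using integrable_bounded_scaleR[OF that pm(1) B] by (simp add: mult.commute)
    have ff: "integrable lborel f" "integrable lborel f'" using J L by (auto simp: weak_jacobian_def)
    note [measurable] = borel_measurable_integrable[OF ff(1)] borel_measurable_integrable[OF ff(2)]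
    have "(LINT x|lborel. f x $ i * partial j \<phi> x) = (LINT x|lborel. f' x $ i * partial j \<phi> x)"
      using eq by (intro integral_cong_AE) auto
    then have "(LINT x|lborel. J x $ i $ j * \<phi> x) = (LINT x|lborel. L x $ i $ j * \<phi> x)"
      using J L \<phi> by (simp add: weak_jacobian_def)
    then show "(LINT x|lborel. (J x $ i $ j - L x $ i $ j) * \<phi> x) = 0"
      using m[OF iJ] m[OF iL] by (simp add: left_diff_distrib)
  qed
  then have "AE x in lborel. \<forall>i j. J x $ i $ j - L x $ i $ j = 0" by (simp add: AE_all_countable)
  then show ?thesis by eventually_elim (simp add: vec_eq_iff)
qed

section \<open>Pairing Duhamel integrals with bounded functions\<close>

lemma integrable_vec_nth: "integrable M f \<Longrightarrow> integrable M (\<lambda>x. f x $ i)"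
  for f :: "'a \<Rightarrow> 'b::euclidean_space ^ 'n"
  by (rule integrable_bounded_linear[OF bounded_linear_vec_nth])

lemma integral_vec_nth: "integrable M f \<Longrightarrow> (LINT x|M. f x) $ i = (LINT x|M. f x $ i)"
  for f :: "'a \<Rightarrow> 'b::euclidean_space ^ 'n"
  by (rule integral_bounded_linear[OF bounded_linear_vec_nth, symmetric])

lemma decay_integrable:
  assumes "decay j A f" "t > 0"
  shows "integrable lborel (\<lambda>x. f (t, x))"
  unfolding integrable_iff_bounded
  using borel_measurable_slice[OF decay_meas[OF assms(1)], of t] decay_imp_L1[OF assms]
  by (auto simp: le_less_trans[OF _ ennreal_less_top])

lemma source_integrable:
  assumes "source B n" "s > 0"
  shows "integrable lborel (\<lambda>y. n (s, y))"
  unfolding integrable_iff_bounded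
  using borel_measurable_slice[of n s] assms by (auto simp: source_def le_less_trans[OF _ ennreal_less_top])

text \<open>A bounded \<open>\<psi>\<close> suffices for Fubini, because \<open>dint_L1\<close>
  already bounds the absolute integral over \<open>x\<close> and \<open>p\<close>. It is used with
  \<open>\<psi>\<close> a test function or its derivative, a component of the linear flow or of its
  Jacobian, and the constant \<open>1\<close>.\<close>

lemma
  assumes c: "c \<ge> 1" and k: "dkernel c j C k" and n: "source B n" and j: "j \<le> 1" and B: "B \<ge> 0"
    and [measurable]: "\<psi> \<in> borel_measurable borel" and M: "\<And>x. \<bar>\<psi> x\<bar> \<le> M" and t: "t > 0"
  shows duhamel_test: "(LINT x|lborel. \<psi> x *\<^sub>R duhamel k n (t, x)) = (LINT p|lborel. (LINT x|lborel. \<psi> x *\<^sub>R dint k n (t, x) p))"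
    and integrable_duhamel_test: "integrable lborel (\<lambda>p. (LINT x|lborel. \<psi> x *\<^sub>R dint k n (t, x) p))"
proof -
  note [measurable] = dint_meas2[OF c k n j B]
  have m: "(\<lambda>(x, p). \<psi> x *\<^sub>R dint k n (t, x) p) \<in> borel_measurable (lborel \<Otimes>\<^sub>M lborel)"
    unfolding split_beta by measurable
  have m1: "(\<lambda>x. \<integral>\<^sup>+p. ennreal (norm (dint k n (t, x) p)) \<partial>lborel) \<in> borel_measurable lborel"
    by measurable
  have "(\<integral>\<^sup>+z. ennreal (norm (case z of (x, p) \<Rightarrow> \<psi> x *\<^sub>R dint k n (t, x) p)) \<partial>(lborel \<Otimes>\<^sub>M lborel))
    = (\<integral>\<^sup>+x. (\<integral>\<^sup>+p. ennreal (norm (\<psi> x *\<^sub>R dint k n (t, x) p)) \<partial>lborel) \<partial>lborel)"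
    using m by (subst lborel.nn_integral_fst[symmetric]) auto
  also have "\<dots> \<le> (\<integral>\<^sup>+x. ennreal M * (\<integral>\<^sup>+p. ennreal (norm (dint k n (t, x) p)) \<partial>lborel) \<partial>lborel)"
  proof (rule nn_integral_mono)
    fix x
    have "(\<integral>\<^sup>+p. ennreal (norm (\<psi> x *\<^sub>R dint k n (t, x) p)) \<partial>lborel) \<le> (\<integral>\<^sup>+p. ennreal M * ennreal (norm (dint k n (t, x) p)) \<partial>lborel)"
      using M[of x] by (intro nn_integral_mono) (auto simp flip: ennreal_mult' intro!: ennreal_leI mult_right_mono)
    also have "\<dots> = ennreal M * (\<integral>\<^sup>+p. ennreal (norm (dint k n (t, x) p)) \<partial>lborel)"
      by (rule nn_integral_cmult) measurable
    finally show "(\<integral>\<^sup>+p. ennreal (norm (\<psi> x *\<^sub>R dint k n (t, x) p)) \<partial>lborel) \<le> ennreal M * (\<integral>\<^sup>+p. ennreal (norm (dint k n (t, x) p)) \<partial>lborel)" .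
  qed
  also have "\<dots> = ennreal M * (\<integral>\<^sup>+x. (\<integral>\<^sup>+p. ennreal (norm (dint k n (t, x) p)) \<partial>lborel) \<partial>lborel)"
    by (rule nn_integral_cmult[OF m1])
  also have "\<dots> < \<infinity>"
    using dint_L1[OF c k n j B t] by (simp add: ennreal_mult_less_top le_less_trans[OF _ ennreal_less_top])
  finally have int: "integrable (lborel \<Otimes>\<^sub>M lborel) (\<lambda>(x, p). \<psi> x *\<^sub>R dint k n (t, x) p)"
    using m by (simp add: integrable_iff_bounded)
  have "(LINT x|lborel. \<psi> x *\<^sub>R duhamel k n (t, x)) = (LINT x|lborel. (LINT p|lborel. \<psi> x *\<^sub>R dint k n (t, x) p))"
    by (simp add: duhamel_def)
  also have "\<dots> = (LINT p|lborel. (LINT x|lborel. \<psi> x *\<^sub>R dint k n (t, x) p))"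
    using lborel_pair.Fubini_integral[OF int] by simp
  finally show "(LINT x|lborel. \<psi> x *\<^sub>R duhamel k n (t, x)) = (LINT p|lborel. (LINT x|lborel. \<psi> x *\<^sub>R dint k n (t, x) p))" .
  show "integrable lborel (\<lambda>p. (LINT x|lborel. \<psi> x *\<^sub>R dint k n (t, x) p))"
    using lborel_pair.integrable_snd[OF int] .
qed

lemma integrable_test_ker:
  assumes c: "c \<ge> 1" "\<tau> > 0" and [measurable]: "\<psi> \<in> borel_measurable borel" and M: "\<And>x. \<bar>\<psi> x\<bar> \<le> M"
  shows "integrable lborel (\<lambda>x. \<psi> x * ker c k l \<beta> \<tau> (x - y))"
proof -
  have i: "integrable lborel (\<lambda>x. ker c k l \<beta> \<tau> (x + - y))"
    unfolding integrable_lborel_translation by (rule integrable_ker[OF c])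
  then show ?thesis
    by (intro Bochner_Integration.integrable_bound[OF integrable_mult_right[OF i, of M]])
      (auto simp: abs_mult intro!: AE_I2 mult_right_mono order_trans[OF M abs_ge_self])
qed

lemma
  assumes c: "c \<ge> 1" "\<tau> > 0" and [measurable]: "\<psi> \<in> borel_measurable borel" and M: "\<And>x. \<bar>\<psi> x\<bar> \<le> M"
  shows integral_kU: "(LINT x|lborel. \<psi> x *\<^sub>R kU c \<tau> (x - y) v) $ k = (\<Sum>l\<in>UNIV. (LINT x|lborel. \<psi> x * ker c k l z3 \<tau> (x - y)) * v $ l)"
    and integral_kJ: "(LINT x|lborel. \<psi> x *\<^sub>R kJ c \<tau> (x - y) v) $ k $ m = (\<Sum>l\<in>UNIV. (LINT x|lborel. \<psi> x * ker c k l (inc m z3) \<tau> (x - y)) * v $ l)"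
proof -
  note I = integrable_test_ker[OF c assms(3) M]
  have eU: "\<psi> x *\<^sub>R kU c \<tau> (x - y) v = (\<Sum>k\<in>UNIV. (\<Sum>l\<in>UNIV. \<psi> x * ker c k l z3 \<tau> (x - y) * v $ l) *\<^sub>R axis k 1)" for x
    unfolding kU_def by (simp add: scaleR_sum_right sum_distrib_left mult.assoc)
  have iU: "integrable lborel (\<lambda>x. \<psi> x *\<^sub>R kU c \<tau> (x - y) v)"
    unfolding eU by (intro Bochner_Integration.integrable_sum integrable_scaleR_left integrable_mult_left I)
  have eJ: "\<psi> x *\<^sub>R kJ c \<tau> (x - y) v = (\<Sum>k\<in>UNIV. \<Sum>m\<in>UNIV. (\<Sum>l\<in>UNIV. \<psi> x * ker c k l (inc m z3) \<tau> (x - y) * v $ l) *\<^sub>R axis k (axis m 1))" for x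
    unfolding kJ_def by (simp add: scaleR_sum_right sum_distrib_left mult.assoc)
  have iJ: "integrable lborel (\<lambda>x. \<psi> x *\<^sub>R kJ c \<tau> (x - y) v)"
    unfolding eJ by (intro Bochner_Integration.integrable_sum integrable_scaleR_left integrable_mult_left I)
  have "(LINT x|lborel. \<psi> x *\<^sub>R kU c \<tau> (x - y) v) $ k = (LINT x|lborel. (\<Sum>l\<in>UNIV. \<psi> x * ker c k l z3 \<tau> (x - y) * v $ l))"
    unfolding integral_vec_nth[OF iU] by (simp add: kU_nth sum_distrib_left mult.assoc)
  then show "(LINT x|lborel. \<psi> x *\<^sub>R kU c \<tau> (x - y) v) $ k = (\<Sum>l\<in>UNIV. (LINT x|lborel. \<psi> x * ker c k l z3 \<tau> (x - y)) * v $ l)"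
    using I by (simp add: Bochner_Integration.integral_sum)
  have "(LINT x|lborel. \<psi> x *\<^sub>R kJ c \<tau> (x - y) v) $ k $ m = (LINT x|lborel. (\<Sum>l\<in>UNIV. \<psi> x * ker c k l (inc m z3) \<tau> (x - y) * v $ l))"
    unfolding integral_vec_nth[OF iJ] integral_vec_nth[OF integrable_vec_nth[OF iJ]]
    by (simp add: kJ_nth sum_distrib_left mult.assoc)
  then show "(LINT x|lborel. \<psi> x *\<^sub>R kJ c \<tau> (x - y) v) $ k $ m = (\<Sum>l\<in>UNIV. (LINT x|lborel. \<psi> x * ker c k l (inc m z3) \<tau> (x - y)) * v $ l)"
    using I by (simp add: Bochner_Integration.integral_sum)
qed

subsection \<open>Weak derivatives of Duhamel integrals\<close>

context bilin
begin

text \<open>After Fubini the test function meets the kernel at a fixed source point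
  \<open>p\<close>, where the derivative can be moved by \<open>ker_weak_derivative\<close>; a
  second application of Fubini restores the Duhamel integral, now with the differentiated
  kernel.\<close>

lemma weak_jacobian_duhamel:
  assumes n: "source B n" "B \<ge> 0" and t: "t > 0"
  shows "weak_jacobian (\<lambda>x. duhamel (kU c) n (t, x)) (\<lambda>x. duhamel (kJ c) n (t, x))"
  unfolding weak_jacobian_def
proof (intro conjI allI impI)
  show iU: "integrable lborel (\<lambda>x. duhamel (kU c) n (t, x))"
    using decay_integrable[OF pdecay_imp_decay[OF pdecay_duhamel[OF c kU n(1) _ n(2)]] t] by simp
  show iJ: "integrable lborel (\<lambda>x. duhamel (kJ c) n (t, x))"
    using decay_integrable[OF pdecay_imp_decay[OF pdecay_duhamel[OF c kJ n(1) _ n(2)]] t] by simp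
  fix \<phi> i j assume \<phi>: "test_function \<phi>"
  have m [measurable]: "\<phi> \<in> borel_measurable borel" "partial j \<phi> \<in> borel_measurable borel"
    using test_function_imp(1)[OF \<phi>] test_function_imp(1)[OF test_function_partial[OF \<phi>]] by (auto intro: borel_measurable_continuous_onI)
  obtain M where M: "\<And>x. \<bar>\<phi> x\<bar> \<le> M" using test_function_imp(3)[OF \<phi>] by blast
  obtain M' where M': "\<And>x. \<bar>partial j \<phi> x\<bar> \<le> M'" using test_function_imp(3)[OF test_function_partial[OF \<phi>, of j]] by blast
  note i1 = integrable_bounded_scaleR[OF iU m(2) M'] and i2 = integrable_bounded_scaleR[OF iJ m(1) M]
  have "(LINT x|lborel. duhamel (kU c) n (t, x) $ i * partial j \<phi> x) = (LINT x|lborel. partial j \<phi> x *\<^sub>R duhamel (kU c) n (t, x)) $ i"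
    unfolding integral_vec_nth[OF i1] by (simp add: mult.commute)
  also have "\<dots> = (LINT p|lborel. (LINT x|lborel. partial j \<phi> x *\<^sub>R dint (kU c) n (t, x) p)) $ i"
    using duhamel_test[OF c kU n(1) _ n(2) m(2) M' t] by simp
  also have "\<dots> = (LINT p|lborel. (LINT x|lborel. partial j \<phi> x *\<^sub>R dint (kU c) n (t, x) p) $ i)"
    using integrable_duhamel_test[OF c kU n(1) _ n(2) m(2) M' t] by (intro integral_vec_nth) simp
  also have "\<dots> = (LINT p|lborel. - ((LINT x|lborel. \<phi> x *\<^sub>R dint (kJ c) n (t, x) p) $ i $ j))"
  proof (rule Bochner_Integration.integral_cong)
    fix p :: "real \<times> (real^3)"
    obtain s y where p: "p = (s, y)" by (cases p)
    show "(LINT x|lborel. partial j \<phi> x *\<^sub>R dint (kU c) n (t, x) p) $ i = - ((LINT x|lborel. \<phi> x *\<^sub>R dint (kJ c) n (t, x) p) $ i $ j)"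
    proof (cases "0 < s \<and> s < t")
      case True
      then have \<tau>: "t - s > 0" by simp
      show ?thesis using True
        by (simp add: p dint_def integral_kU[OF c \<tau> m(2) M'] integral_kJ[OF c \<tau> m(1) M] ker_weak_derivative[OF \<phi> \<tau>] sum_negf)
    qed (auto simp: p dint_def)
  qed simp
  also have "\<dots> = - (LINT p|lborel. (LINT x|lborel. \<phi> x *\<^sub>R dint (kJ c) n (t, x) p)) $ i $ j"
  proof -
    have I: "integrable lborel (\<lambda>p. (LINT x|lborel. \<phi> x *\<^sub>R dint (kJ c) n (t, x) p))"
      using integrable_duhamel_test[OF c kJ n(1) _ n(2) m(1) M t] by simp
    show ?thesis unfolding integral_vec_nth[OF I] integral_vec_nth[OF integrable_vec_nth[OF I]] by simp
  qed
  also have "\<dots> = - (LINT x|lborel. \<phi> x *\<^sub>R duhamel (kJ c) n (t, x)) $ i $ j"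
    using duhamel_test[OF c kJ n(1) _ n(2) m(1) M t] by simp
  also have "\<dots> = - (LINT x|lborel. duhamel (kJ c) n (t, x) $ i $ j * \<phi> x)"
    unfolding integral_vec_nth[OF i2] integral_vec_nth[OF integrable_vec_nth[OF i2]] by (simp add: mult.commute)
  finally show "(LINT x|lborel. duhamel (kU c) n (t, x) $ i * partial j \<phi> x) = - (LINT x|lborel. duhamel (kJ c) n (t, x) $ i $ j * \<phi> x)" .
qed

end

lemma weak_jacobian_diff:
  assumes f: "weak_jacobian f J" and g: "weak_jacobian g L"
  shows "weak_jacobian (\<lambda>x. f x - g x) (\<lambda>x. J x - L x)"
  unfolding weak_jacobian_def
proof (intro conjI allI impI)
  note i = f[unfolded weak_jacobian_def, THEN conjunct1] f[unfolded weak_jacobian_def, THEN conjunct2, THEN conjunct1]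
    g[unfolded weak_jacobian_def, THEN conjunct1] g[unfolded weak_jacobian_def, THEN conjunct2, THEN conjunct1]
  show "integrable lborel (\<lambda>x. f x - g x)" "integrable lborel (\<lambda>x. J x - L x)" using i by auto
  fix \<phi> i' j assume \<phi>: "test_function \<phi>"
  have [measurable]: "\<phi> \<in> borel_measurable borel" "partial j \<phi> \<in> borel_measurable borel"
    using test_function_imp(1)[OF \<phi>] test_function_imp(1)[OF test_function_partial[OF \<phi>]] by (auto intro: borel_measurable_continuous_onI)
  obtain M where M: "\<And>x. \<bar>\<phi> x\<bar> \<le> M" using test_function_imp(3)[OF \<phi>] by blast
  obtain M' where M': "\<And>x. \<bar>partial j \<phi> x\<bar> \<le> M'" using test_function_imp(3)[OF test_function_partial[OF \<phi>, of j]] by blast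
  have bd: "integrable lborel (\<lambda>x. f x * \<psi> x)" if "integrable lborel f" "\<psi> \<in> borel_measurable borel" "\<And>x. \<bar>\<psi> x\<bar> \<le> M"
    for f \<psi> :: "real^3 \<Rightarrow> real" and M
    using integrable_bounded_scaleR[OF that] by (simp add: mult.commute)
  have "integrable lborel (\<lambda>x. f x $ i' * partial j \<phi> x)" "integrable lborel (\<lambda>x. g x $ i' * partial j \<phi> x)"
    "integrable lborel (\<lambda>x. J x $ i' $ j * \<phi> x)" "integrable lborel (\<lambda>x. L x $ i' $ j * \<phi> x)"
    by (rule bd[OF _ _ M'] bd[OF _ _ M], use i in \<open>auto intro!: integrable_vec_nth\<close>)+
  then show "(LINT x|lborel. (f x - g x) $ i' * partial j \<phi> x) = - (LINT x|lborel. (J x - L x) $ i' $ j * \<phi> x)"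
    using f g \<phi> by (simp add: weak_jacobian_def left_diff_distrib)
qed

lemma weak_jacobian_scaleR:
  assumes f: "weak_jacobian f J"
  shows "weak_jacobian (\<lambda>x. a *\<^sub>R f x) (\<lambda>x. a *\<^sub>R J x)"
  using f unfolding weak_jacobian_def by (simp add: mult.assoc)

subsection \<open>The linear evolution\<close>

abbreviation "a22 \<equiv> inc 2 (inc 2 z3)"
abbreviation "a12 \<equiv> inc 1 (inc 2 z3)"

text \<open>The linear evolution with \<open>\<eta>\<close> divided out. The initial field is built
  from the heat kernel at time \<open>1\<close>, so at time \<open>t\<close> the kernel has age
  \<open>1 + t\<close>.\<close>

definition u1 :: "real \<times> (real^3) \<Rightarrow> real^3" where
  "u1 q = (- heatD a22 (1 + fst q) (snd q)) *\<^sub>R axis 1 1 + heatD a12 (1 + fst q) (snd q) *\<^sub>R axis 2 1"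

definition J1 :: "real \<times> (real^3) \<Rightarrow> real^3^3" where
  "J1 q = (\<Sum>m\<in>UNIV. (- heatD (inc m a22) (1 + fst q) (snd q)) *\<^sub>R axis 1 (axis m 1) + heatD (inc m a12) (1 + fst q) (snd q) *\<^sub>R axis 2 (axis m 1))"

lemma u1_nth: "u1 q $ 1 = - heatD a22 (1 + fst q) (snd q)" "u1 q $ 2 = heatD a12 (1 + fst q) (snd q)" "u1 q $ 3 = 0"
  by (simp_all add: u1_def axis_def)

lemma J1_nth: "J1 q $ 1 $ m = - heatD (inc m a22) (1 + fst q) (snd q)" "J1 q $ 2 $ m = heatD (inc m a12) (1 + fst q) (snd q)" "J1 q $ 3 $ m = 0"
proof -
  have "\<forall>m. J1 q $ 1 $ m = - heatD (inc m a22) (1 + fst q) (snd q) \<and> J1 q $ 2 $ m = heatD (inc m a12) (1 + fst q) (snd q) \<and> J1 q $ 3 $ m = 0"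
    unfolding forall_3 J1_def sum_3 by (simp add: axis_def)
  then show "J1 q $ 1 $ m = - heatD (inc m a22) (1 + fst q) (snd q)" "J1 q $ 2 $ m = heatD (inc m a12) (1 + fst q) (snd q)" "J1 q $ 3 $ m = 0"
    by blast+
qed

lemma pdecay_scaleR_left:
  assumes f: "pdecay j A f" and A: "A \<ge> 0"
  shows "pdecay j (A * norm v) (\<lambda>q. f q *\<^sub>R v)"
  unfolding pdecay_def decay_def
proof (intro conjI allI impI)
  note [measurable] = decay_meas[OF pdecay_imp_decay[OF f]]
  show "(\<lambda>q. f q *\<^sub>R v) \<in> borel_measurable borel" by measurable
  fix t :: real assume t: "t > 0"
  show n: "norm (f (t, x) *\<^sub>R v) \<le> A * norm v * (1 / sqrt t) ^ j * (1 + t) powr (-3/2)" for x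
    using mult_right_mono[OF pdecay_imp_norm[OF f t, of x] norm_ge_zero[of v]] by (simp add: mult_ac)
  then show "AE x in lborel. norm (f (t, x) *\<^sub>R v) \<le> A * norm v * (1 / sqrt t) ^ j * (1 + t) powr (-3/2)" by simp
  note [measurable] = borel_measurable_slice[OF decay_meas[OF pdecay_imp_decay[OF f]], of t]
  have "(\<integral>\<^sup>+x. ennreal (norm (f (t, x) *\<^sub>R v)) \<partial>lborel) = (\<integral>\<^sup>+x. ennreal (norm v) * ennreal (norm (f (t, x))) \<partial>lborel)"
    by (simp add: mult.commute flip: ennreal_mult')
  also have "\<dots> = ennreal (norm v) * (\<integral>\<^sup>+x. ennreal (norm (f (t, x))) \<partial>lborel)"
    by (rule nn_integral_cmult) measurable
  also have "\<dots> \<le> ennreal (norm v) * ennreal (A * (1 / sqrt t) ^ j)"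
    by (intro mult_left_mono decay_imp_L1[OF pdecay_imp_decay[OF f] t]) auto
  also have "\<dots> = ennreal (A * norm v * (1 / sqrt t) ^ j)" by (simp add: mult_ac flip: ennreal_mult')
  finally show "(\<integral>\<^sup>+x. ennreal (norm (f (t, x) *\<^sub>R v)) \<partial>lborel) \<le> ennreal (A * norm v * (1 / sqrt t) ^ j)" .
qed

text \<open>The age \<open>1 + t\<close> removes the singularity at \<open>t = 0\<close>: since
  \<open>1 / sqrt (1 + t)\<close> is below both \<open>1\<close> and \<open>1 / sqrt t\<close>, a
  derivative of any order at least \<open>j\<close> fits the weight with index
  \<open>j\<close>.\<close>

lemma pdecay_heatD:
  assumes j: "j \<le> (\<Sum>k\<in>UNIV. \<alpha> k)"
  obtains A where "A \<ge> 0" "pdecay j A (\<lambda>q. heatD \<alpha> (1 + fst q) (snd q))"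
proof -
  obtain A where A: "A \<ge> 0" "\<And>\<tau> s z. 0 < \<tau> \<Longrightarrow> \<tau> \<le> s \<Longrightarrow> s \<le> 1 * \<tau> \<Longrightarrow>
     \<bar>heatD \<alpha> s z\<bar> \<le> A * (1 / sqrt \<tau>) ^ (\<Sum>k\<in>UNIV. \<alpha> k) * kap 1 \<tau> z"
    using heatD_le_kap[of 1 \<alpha>] by (metis order_refl)
  have le: "\<bar>heatD \<alpha> (1 + t) z\<bar> \<le> A * (1 / sqrt t) ^ j * kap 1 (1 + t) z" if t: "t > 0" for t z
  proof -
    have "(1 / sqrt (1 + t)) ^ (\<Sum>k\<in>UNIV. \<alpha> k) \<le> (1 / sqrt (1 + t)) ^ j"
      using t by (intro power_decreasing j) auto
    also have "\<dots> \<le> (1 / sqrt t) ^ j" using t by (intro power_mono frac_le) auto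
    finally have "A * (1 / sqrt (1 + t)) ^ (\<Sum>k\<in>UNIV. \<alpha> k) * kap 1 (1 + t) z \<le> A * (1 / sqrt t) ^ j * kap 1 (1 + t) z"
      using A(1) t kap_nonneg[of 1 "1 + t" z] by (intro mult_right_mono mult_left_mono) auto
    then show ?thesis using A(2)[of "1 + t" "1 + t" z] t by simp
  qed
  have "pdecay j A (\<lambda>q. heatD \<alpha> (1 + fst q) (snd q))"
    unfolding pdecay_def decay_def
  proof (intro conjI allI impI)
    have "(\<lambda>q. heatD \<alpha> (1 + fst q) (snd q)) \<in> borel_measurable (borel \<Otimes>\<^sub>M borel)" by measurable
    then show "(\<lambda>q. heatD \<alpha> (1 + fst q) (snd q)) \<in> borel_measurable borel" by (simp add: borel_prod)
    fix t :: real assume t: "t > 0"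
    have "(\<integral>\<^sup>+x. ennreal (norm (heatD \<alpha> (1 + fst (t, x)) (snd (t, x)))) \<partial>lborel) \<le> (\<integral>\<^sup>+x. ennreal (A * (1 / sqrt t) ^ j) * ennreal (kap 1 (1 + t) x) \<partial>lborel)"
      using le[OF t] A(1) t by (intro nn_integral_mono) (auto simp flip: ennreal_mult' intro!: ennreal_leI)
    also have "\<dots> = ennreal (A * (1 / sqrt t) ^ j)"
      using t by (subst nn_integral_cmult) (auto simp: nn_integral_kap)
    finally show "(\<integral>\<^sup>+x. ennreal (norm (heatD \<alpha> (1 + fst (t, x)) (snd (t, x)))) \<partial>lborel) \<le> ennreal (A * (1 / sqrt t) ^ j)" .
    have p3: "(1 / sqrt (1 + t)) ^ 3 = (1 + t) powr (-3/2)"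
    proof -
      have "(1 + t) powr (-3/2) = 1 / ((1 + t) powr (1/2)) powr 3" by (simp add: powr_powr powr_minus_divide)
      then show ?thesis using t by (simp add: powr_half_sqrt power_divide)
    qed
    show n: "norm (heatD \<alpha> (1 + fst (t, x)) (snd (t, x))) \<le> A * (1 / sqrt t) ^ j * (1 + t) powr (-3/2)" for x
    proof -
      have "A * (1 / sqrt t) ^ j * kap 1 (1 + t) x \<le> A * (1 / sqrt t) ^ j * (1 + t) powr (-3/2)"
        using kap_le[of 1 "1 + t" x] t A(1) unfolding p3[symmetric] by (intro mult_left_mono) auto
      then show ?thesis using le[OF t, of x] by simp
    qed
    then show "AE x in lborel. norm (heatD \<alpha> (1 + fst (t, x)) (snd (t, x))) \<le> A * (1 / sqrt t) ^ j * (1 + t) powr (-3/2)" by simp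
  qed
  then show ?thesis using A(1) that by blast
qed

lemma pdec_u1: "\<exists>A\<ge>0. pdec A u1 J1"
proof -
  have add: "\<exists>A\<ge>0. pdecay j A (\<lambda>q. f q + g q)" if "\<exists>A\<ge>0. pdecay j A f" "\<exists>A\<ge>0. pdecay j A g"
    for j and f g :: "real \<times> (real^3) \<Rightarrow> 'z::euclidean_space"
    using that pdecay_add by (metis add_nonneg_nonneg)
  have neg: "\<exists>A\<ge>0. pdecay j A (\<lambda>q. (- f q) *\<^sub>R v)" if "\<exists>A\<ge>0. pdecay j A f" for j f and v :: "'z::euclidean_space"
    using that pdecay_scaleR_left[OF pdecay_uminus, of j _ f v] by (metis mult_nonneg_nonneg norm_ge_zero)
  have pos: "\<exists>A\<ge>0. pdecay j A (\<lambda>q. f q *\<^sub>R v)" if "\<exists>A\<ge>0. pdecay j A f" for j f and v :: "'z::euclidean_space"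
    using that pdecay_scaleR_left[of j _ f v] by (metis mult_nonneg_nonneg norm_ge_zero)
  have h: "\<exists>A\<ge>0. pdecay j A (\<lambda>q. heatD \<alpha> (1 + fst q) (snd q))" if "j \<le> (\<Sum>k\<in>UNIV. \<alpha> k)" for j \<alpha>
    using pdecay_heatD[OF that] by metis
  have s: "(\<Sum>k\<in>UNIV. inc i (inc j z3) k) = 2" "(\<Sum>k\<in>UNIV. inc m (inc i (inc j z3)) k) = 3" for i j m
    by (simp_all only: sum_inc) simp_all
  have "\<exists>A\<ge>0. pdecay 0 A u1"
    unfolding u1_def by (intro add neg pos h) auto
  moreover have "\<exists>A\<ge>0. pdecay 1 A J1"
    unfolding J1_def sum_3 by (intro add neg pos h ord_le_eq_trans[OF _ s(2)[symmetric]]) simp_all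
  ultimately obtain A B where "A \<ge> 0" "pdecay 0 A u1" "B \<ge> 0" "pdecay 1 B J1" by blast
  then have "pdec (max A B) u1 J1" unfolding pdec_def using pdecay_mono[of 0 A u1 "max A B"] pdecay_mono[of 1 B J1 "max A B"] by simp
  then show ?thesis using \<open>A \<ge> 0\<close> by (metis max.coboundedI1)
qed

lemma heatD_weak_derivative:
  assumes "test_function \<phi>" "s > 0"
  shows "(LINT x|lborel. heatD \<alpha> s x * partial j \<phi> x) = - (LINT x|lborel. heatD (inc j \<alpha>) s x * \<phi> x)"
  using ift_weak_derivative[OF assms(1) integrable_gsym[OF assms(2), of \<alpha>] integrable_gsym[OF assms(2), of "inc j \<alpha>"] gsym_inc, of 0]
  by (simp add: ift_gsym assms(2) mult.commute)

lemma weak_jacobian_u1: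
  assumes t: "t > 0"
  shows "weak_jacobian (\<lambda>x. u1 (t, x)) (\<lambda>x. J1 (t, x))"
proof -
  obtain A where "pdec A u1 J1" using pdec_u1 by blast
  then have "integrable lborel (\<lambda>x. u1 (t, x))" "integrable lborel (\<lambda>x. J1 (t, x))"
    using t by (auto simp: pdec_def dest!: pdecay_imp_decay intro: decay_integrable)
  moreover have "\<forall>i. (LINT x|lborel. u1 (t, x) $ i * partial j \<phi> x) = - (LINT x|lborel. J1 (t, x) $ i $ j * \<phi> x)"
    if "test_function \<phi>" for \<phi> j
    unfolding forall_3 u1_nth J1_nth using heatD_weak_derivative[OF that, of "1 + t"] t by simp
  ultimately show ?thesis unfolding weak_jacobian_def by blast
qed

lemma initial_field_eq: "initial_field \<eta> x = \<eta> *\<^sub>R u1 (0, x)"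
proof -
  have h: "heat_kernel 1 = heatD z3 1" by (rule heat_kernel_eq_heatD) simp
  have p: "partial j (heatD \<alpha> 1) = heatD (inc j \<alpha>) 1" for j \<alpha>
    by (rule ext) (simp add: partial_heatD)
  show ?thesis
    unfolding initial_field_def h p vec_eq_iff forall_3 by (simp add: u1_nth)
qed

text \<open>The initial field is divergence-free, so on the Fourier side the rank-one part of the
  symbol annihilates it. What is left is the heat semigroup, which moves the age from
  \<open>1\<close> to \<open>1 + t\<close>.\<close>

lemma multiplier_initial_field:
  assumes t: "t > 0"
  shows "multiplier \<epsilon> t (initial_field \<eta>) x = \<eta> *\<^sub>R u1 (t, x)"
proof -
  have F: "fourier (\<lambda>y. a * heatD \<alpha> 1 y) \<xi> = of_real a * gsym \<alpha> 1 \<xi>" for a \<alpha> \<xi>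
  proof -
    have "fourier (\<lambda>y. a * heatD \<alpha> 1 y) \<xi> = of_real a * fourier (heatD \<alpha> 1) \<xi>"
      unfolding fourier_def integral_mult_right_zero[symmetric] by (simp add: mult_ac)
    then show ?thesis by (simp add: fourier_heatD)
  qed
  have F1: "fourier (\<lambda>y. initial_field \<eta> y $ 1) \<xi> = of_real (- \<eta>) * gsym a22 1 \<xi>"
    and F2: "fourier (\<lambda>y. initial_field \<eta> y $ 2) \<xi> = of_real \<eta> * gsym a12 1 \<xi>"
    and F3: "fourier (\<lambda>y. initial_field \<eta> y $ 3) \<xi> = 0" for \<xi>
    using F[of "- \<eta>" a22] F[of \<eta> a12] by (simp_all add: initial_field_eq u1_nth fourier_def)
  have S: "(\<Sum>l\<in>UNIV. of_real (symbol \<epsilon> t \<xi> $ k $ l) * fourier (\<lambda>y. initial_field \<eta> y $ l) \<xi>)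
    = of_real (exp (- t * (norm \<xi>)\<^sup>2)) * fourier (\<lambda>y. initial_field \<eta> y $ k) \<xi>" for k \<xi>
  proof -
    \<comment> \<open>\<open>d\<close> swallows the division by \<open>(norm \<xi>)\<^sup>2\<close>,
      so the cancellation is a polynomial identity and the origin needs no separate case.\<close>
    define e d where "e = exp (- t * (norm \<xi>)\<^sup>2)" and "d = (1 - exp (- t * (norm \<xi>)\<^sup>2 / \<epsilon>)) / (norm \<xi>)\<^sup>2"
    have sy: "symbol \<epsilon> t \<xi> $ k $ l = e * ((if k = l then 1 else 0) - \<xi> $ k * \<xi> $ l * d)" for k l
      by (simp add: symbol_def e_def d_def)
    have "\<forall>k. (\<Sum>l\<in>UNIV. of_real (symbol \<epsilon> t \<xi> $ k $ l) * fourier (\<lambda>y. initial_field \<eta> y $ l) \<xi>) = of_real e * fourier (\<lambda>y. initial_field \<eta> y $ k) \<xi>"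
      unfolding forall_3 sum_3 sy F1 F2 F3 gsym_inc by (simp add: algebra_simps)
    then show ?thesis by (simp add: e_def)
  qed
  have I: "ift (\<lambda>\<xi>. of_real a * gsym \<alpha> s \<xi>) x = a * heatD \<alpha> s x" if "s > 0" for a \<alpha> s
    using that by (simp add: ift_scale ift_gsym)
  have G: "of_real (exp (- t * (norm \<xi>)\<^sup>2)) * (of_real a * gsym \<alpha> 1 \<xi>) = of_real a * gsym \<alpha> (1 + t) \<xi>" for a \<alpha> \<xi>
    using gsym_exp[of t \<xi> \<alpha> 1] by (simp only: mult.left_commute[of _ "of_real a"] add.commute[of 1 t])
  have "multiplier \<epsilon> t (initial_field \<eta>) x $ k = ift (\<lambda>\<xi>. of_real (exp (- t * (norm \<xi>)\<^sup>2)) * fourier (\<lambda>y. initial_field \<eta> y $ k) \<xi>) x" for k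
    unfolding multiplier_def ift_def S by simp
  then have "\<forall>k. multiplier \<epsilon> t (initial_field \<eta>) x $ k = (\<eta> *\<^sub>R u1 (t, x)) $ k"
    unfolding forall_3 using t by (simp only: F1 F2 F3 G I) (simp add: u1_nth ift_def)
  then show ?thesis by (simp add: vec_eq_iff)
qed

section \<open>The mild formula as a fixed-point equation\<close>

lemma duhamel_iterated:
  assumes c: "c \<ge> 1" and k: "dkernel c j C k" and n: "source B n" and j: "j \<le> 1" and B: "B \<ge> 0" and t: "t > 0"
  shows "duhamel k n (t, x) = (LINT s|lborel. indicator {0<..<t} s *\<^sub>R (LINT y|lborel. k (t - s) (x - y) (n (s, y))))"
proof -
  have "integrable (lborel \<Otimes>\<^sub>M lborel) (dint k n (t, x))"
    using integrable_dint[OF c k n j B t, of x] by (simp add: lborel_prod)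
  from lborel_pair.integral_fst[of "\<lambda>s y. dint k n (t, x) (s, y)"] this
  have "duhamel k n (t, x) = (LINT s|lborel. (LINT y|lborel. dint k n (t, x) (s, y)))"
    by (simp add: duhamel_def lborel_prod)
  then show ?thesis by (simp add: dint_def)
qed

lemma multiplier_eq_kU:
  assumes "t > 0" "\<epsilon> > 0" and f: "integrable lborel f"
  shows "multiplier \<epsilon> t f x = (LINT y|lborel. kU (1 + 1 / \<epsilon>) t (x - y) (f y))"
proof -
  let ?c = "1 + 1 / \<epsilon>"
  have fl: "integrable lborel (\<lambda>y. f y $ l)" for l using f by (rule integrable_vec_nth)
  have I: "integrable lborel (\<lambda>y. ker ?c k l z3 t (x - y) * f y $ l)" for k l
    using integrable_ift_mult[OF integrable_ksym[OF assms(1), of ?c k l z3] fl[of l], of x] by (simp add: ift_ksym assms)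
  then have iU: "integrable lborel (\<lambda>y. kU ?c t (x - y) (f y))"
    unfolding kU_def by (intro Bochner_Integration.integrable_sum integrable_scaleR_left)
  show ?thesis
    unfolding vec_eq_iff integral_vec_nth[OF iU] kU_nth multiplier_eq_conv[OF assms]
    using I by (simp add: Bochner_Integration.integral_sum)
qed

text \<open>On the open time interval \<open>t - s > 0\<close>, so each multiplier is a convolution
  with \<open>kU\<close>, and Fubini joins the time and space integrals into the Duhamel
  term.\<close>

lemma mild_formula:
  assumes "bilin (1 + 1 / \<epsilon>) C" "\<epsilon> > 0" and t: "t > 0" and n: "source B (\<lambda>p. Nl (u p) (J p))" "B \<ge> 0"
  shows "multiplier \<epsilon> t (initial_field \<eta>) x
        - (LINT s:{0<..<t}|lborel. multiplier \<epsilon> (t - s) (nonlinearity (\<lambda>x. u (s, x)) (\<lambda>x. J (s, x))) x)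
    = \<eta> *\<^sub>R u1 (t, x) - BU (1 + 1 / \<epsilon>) u J (t, x)"
proof -
  interpret bilin "1 + 1 / \<epsilon>" C by fact
  have "multiplier \<epsilon> (t - s) (nonlinearity (\<lambda>x. u (s, x)) (\<lambda>x. J (s, x))) x = (LINT y|lborel. kU (1 + 1 / \<epsilon>) (t - s) (x - y) (Nl (u (s, y)) (J (s, y))))"
    if "0 < s" "s < t" for s
    using multiplier_eq_kU[of "t - s" \<epsilon> "nonlinearity (\<lambda>x. u (s, x)) (\<lambda>x. J (s, x))" x] that assms(2) source_integrable[OF n(1), of s]
    by (simp add: nonlinearity_eq_Nl[abs_def])
  then have "(LINT s:{0<..<t}|lborel. multiplier \<epsilon> (t - s) (nonlinearity (\<lambda>x. u (s, x)) (\<lambda>x. J (s, x))) x)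
    = (LINT s|lborel. indicator {0<..<t} s *\<^sub>R (LINT y|lborel. kU (1 + 1 / \<epsilon>) (t - s) (x - y) (Nl (u (s, y)) (J (s, y)))))"
    unfolding set_lebesgue_integral_def by (intro Bochner_Integration.integral_cong) (auto simp: indicator_def)
  also have "\<dots> = BU (1 + 1 / \<epsilon>) u J (t, x)"
    unfolding BU_def using duhamel_iterated[OF c kU n(1) _ n(2) t, of x] by simp
  finally show ?thesis by (simp add: multiplier_initial_field[OF t])
qed

subsection \<open>Mild solutions\<close>

lemma ennreal_mult_le_cancel:
  assumes "a > 0" "ennreal a * X \<le> ennreal b" "b \<ge> 0"
  shows "X \<le> ennreal (b * (1 / a))"
proof -
  have "X = ennreal (1 / a) * (ennreal a * X)"
    using assms(1) by (simp add: mult.assoc[symmetric] flip: ennreal_mult)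
  also have "\<dots> \<le> ennreal (1 / a) * ennreal b" by (intro mult_left_mono assms(2)) auto
  also have "\<dots> = ennreal (b * (1 / a))" using assms by (simp add: mult.commute flip: ennreal_mult)
  finally show ?thesis .
qed

lemma F_norm_le_if_dec:
  assumes d: "dec A u J" and A: "A \<ge> 0" and U: "\<And>t x. t > 0 \<Longrightarrow> U t x = u (t, x)" and V: "\<And>t x. t > 0 \<Longrightarrow> V t x = J (t, x)"
  shows "F_norm U V \<le> ennreal (4 * A)"
proof -
  have u: "decay 0 A u" and J: "decay 1 A J" using d by (auto simp: dec_def)
  note mu = borel_measurable_slice[OF decay_meas[OF u]] and mJ = borel_measurable_slice[OF decay_meas[OF J]]
  have Ut: "U t = (\<lambda>x. u (t, x))" and Vt: "V t = (\<lambda>x. J (t, x))" if "t > 0" for t using U V that by auto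
  have p1: "(1 + t) powr (3/2) * (1 + t) powr (-3/2) = 1" if "t > 0" for t :: real
    using that by (simp add: powr_minus_divide)
  have 1: "(SUP t\<in>{0<..}. L1_norm (U t)) \<le> ennreal A"
    by (rule SUP_least) (use decay_imp_L1[OF u] in \<open>simp add: L1_norm_def Ut\<close>)
  have 2: "(SUP t\<in>{0<..}. ennreal (sqrt t) * L1_norm (V t)) \<le> ennreal A"
  proof (rule SUP_least)
    fix t :: real assume "t \<in> {0<..}"
    then have t: "t > 0" by simp
    have "ennreal (sqrt t) * L1_norm (V t) \<le> ennreal (sqrt t) * ennreal (A * (1 / sqrt t) ^ 1)"
      unfolding L1_norm_def Vt[OF t] by (intro mult_left_mono decay_imp_L1[OF J t]) auto
    also have "\<dots> = ennreal A" using t A by (simp flip: ennreal_mult)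
    finally show "ennreal (sqrt t) * L1_norm (V t) \<le> ennreal A" .
  qed
  have 3: "(SUP t\<in>{0<..}. ennreal ((1 + t) powr (3/2)) * Linf_norm (U t)) \<le> ennreal A"
  proof (rule SUP_least)
    fix t :: real assume "t \<in> {0<..}"
    then have t: "t > 0" by simp
    have "Linf_norm (U t) \<le> ennreal (A * (1 / sqrt t) ^ 0 * (1 + t) powr (-3/2))"
      unfolding Linf_norm_def Ut[OF t]
    proof (rule esssup_I)
      note [measurable] = mu[of t]
      show "(\<lambda>x. ennreal (norm (u (t, x)))) \<in> borel_measurable lborel" by measurable
      show "AE x in lborel. ennreal (norm (u (t, x))) \<le> ennreal (A * (1 / sqrt t) ^ 0 * (1 + t) powr (-3/2))"
        using decay_imp_norm[OF u t] by eventually_elim (rule ennreal_leI)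
    qed
    then have "ennreal ((1 + t) powr (3/2)) * Linf_norm (U t) \<le> ennreal ((1 + t) powr (3/2)) * ennreal (A * (1 / sqrt t) ^ 0 * (1 + t) powr (-3/2))"
      by (intro mult_left_mono) auto
    also have "\<dots> = ennreal (A * ((1 + t) powr (3/2) * (1 + t) powr (-3/2)))"
      using A by (subst ennreal_mult[symmetric]) (auto simp: mult_ac)
    finally show "ennreal ((1 + t) powr (3/2)) * Linf_norm (U t) \<le> ennreal A" unfolding p1[OF t] by simp
  qed
  have 4: "(SUP t\<in>{0<..}. ennreal (sqrt t * (1 + t) powr (3/2)) * Linf_norm (V t)) \<le> ennreal A"
  proof (rule SUP_least)
    fix t :: real assume "t \<in> {0<..}"
    then have t: "t > 0" by simp
    have "Linf_norm (V t) \<le> ennreal (A * (1 / sqrt t) ^ 1 * (1 + t) powr (-3/2))"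
      unfolding Linf_norm_def Vt[OF t]
    proof (rule esssup_I)
      note [measurable] = mJ[of t]
      show "(\<lambda>x. ennreal (norm (J (t, x)))) \<in> borel_measurable lborel" by measurable
      show "AE x in lborel. ennreal (norm (J (t, x))) \<le> ennreal (A * (1 / sqrt t) ^ 1 * (1 + t) powr (-3/2))"
        using decay_imp_norm[OF J t] by eventually_elim (rule ennreal_leI)
    qed
    then have "ennreal (sqrt t * (1 + t) powr (3/2)) * Linf_norm (V t) \<le> ennreal (sqrt t * (1 + t) powr (3/2)) * ennreal (A * (1 / sqrt t) ^ 1 * (1 + t) powr (-3/2))"
      by (intro mult_left_mono) auto
    also have "\<dots> = ennreal (sqrt t * (1 + t) powr (3/2) * (A * (1 / sqrt t) ^ 1 * (1 + t) powr (-3/2)))"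
      using A t by (intro ennreal_mult[symmetric]) auto
    also have "sqrt t * (1 + t) powr (3/2) * (A * (1 / sqrt t) ^ 1 * (1 + t) powr (-3/2)) = A * ((1 + t) powr (3/2) * (1 + t) powr (-3/2))"
      using t by simp
    finally show "ennreal (sqrt t * (1 + t) powr (3/2)) * Linf_norm (V t) \<le> ennreal A" unfolding p1[OF t] by simp
  qed
  have "F_norm U V \<le> ennreal A + ennreal A + ennreal A + ennreal A"
    unfolding F_norm_def by (intro add_mono 1 2 3 4)
  also have "\<dots> = ennreal (4 * A)" using A by (simp flip: ennreal_plus)
  finally show ?thesis .
qed

lemma borel_measurable_extend:
  fixes f :: "real \<Rightarrow> real^3 \<Rightarrow> 'b::euclidean_space"
  assumes "(\<lambda>(t, x). f t x) \<in> borel_measurable (restrict_space borel {0<..} \<Otimes>\<^sub>M borel)"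
  shows "(\<lambda>p. if fst p > 0 then f (fst p) (snd p) else 0) \<in> borel_measurable borel"
proof -
  let ?M = "borel \<Otimes>\<^sub>M borel :: (real \<times> (real^3)) measure"
  have "(\<lambda>p. (fst p, snd p)) \<in> measurable (restrict_space ?M {p. fst p > 0}) (restrict_space borel {0<..} \<Otimes>\<^sub>M borel)"
    by (intro measurable_Pair measurable_restrict_space2 measurable_restrict_space1) (auto simp: space_restrict_space)
  from measurable_compose[OF this assms]
  have 1: "(\<lambda>p. f (fst p) (snd p)) \<in> borel_measurable (restrict_space ?M {p. fst p > 0})" by (simp add: split_beta)
  have "(\<lambda>p. if fst p > 0 then f (fst p) (snd p) else 0) \<in> borel_measurable ?M"
    using 1 by (subst measurable_If_restrict_space_iff) auto
  then show ?thesis by (simp add: borel_prod)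
qed

text \<open>Each of the four suprema is at most their sum, so the bound \<open>r\<close> is
  inherited without a factor. Extending by zero to \<open>t \<le> 0\<close> gives functions
  measurable on all of space-time, where \<open>F_member\<close> speaks of
  \<open>t > 0\<close>.\<close>

lemma dec_if_F_norm_le:
  assumes m: "F_member U V" and n: "F_norm U V \<le> ennreal r" and r: "r \<ge> 0"
  shows "dec r (\<lambda>p. if fst p > 0 then U (fst p) (snd p) else 0) (\<lambda>p. if fst p > 0 then V (fst p) (snd p) else 0)"
proof -
  let ?a = "SUP t\<in>{0<..}. L1_norm (U t)" and ?b = "SUP t\<in>{0<..}. ennreal (sqrt t) * L1_norm (V t)"
    and ?c = "SUP t\<in>{0<..}. ennreal ((1 + t) powr (3/2)) * Linf_norm (U t)"
    and ?d = "SUP t\<in>{0<..}. ennreal (sqrt t * (1 + t) powr (3/2)) * Linf_norm (V t)"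
  have s: "?a + ?b + ?c + ?d \<le> ennreal r" using n by (simp add: F_norm_def)
  have abcd: "?a \<le> ennreal r" "?b \<le> ennreal r" "?c \<le> ennreal r" "?d \<le> ennreal r"
    by (rule order_trans[OF _ s], simp add: add_increasing add_increasing2)+
  have tm: "t \<in> {0<..}" if "t > 0" for t :: real using that by simp
  have p: "1 / (1 + t) powr (3/2) = (1 + t) powr (-3/2)" for t :: real by (simp add: powr_minus_divide)
  show ?thesis unfolding dec_def decay_def
  proof (intro conjI allI impI)
    show "(\<lambda>p. if fst p > 0 then U (fst p) (snd p) else 0) \<in> borel_measurable borel"
      "(\<lambda>p. if fst p > 0 then V (fst p) (snd p) else 0) \<in> borel_measurable borel"
      using m by (auto simp: F_member_def intro!: borel_measurable_extend)
    fix t :: real assume t: "t > 0"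
    have "L1_norm (U t) \<le> ennreal r" using order_trans[OF SUP_upper[OF tm[OF t]] abcd(1)] .
    then show "(\<integral>\<^sup>+x. ennreal (norm (if fst (t, x) > 0 then U (fst (t, x)) (snd (t, x)) else 0)) \<partial>lborel) \<le> ennreal (r * (1 / sqrt t) ^ 0)"
      using t by (simp add: L1_norm_def)
    have "ennreal (sqrt t) * L1_norm (V t) \<le> ennreal r" using order_trans[OF SUP_upper[OF tm[OF t]] abcd(2)] .
    from ennreal_mult_le_cancel[OF _ this r] t
    show "(\<integral>\<^sup>+x. ennreal (norm (if fst (t, x) > 0 then V (fst (t, x)) (snd (t, x)) else 0)) \<partial>lborel) \<le> ennreal (r * (1 / sqrt t) ^ 1)"
      by (simp add: L1_norm_def)
    have "ennreal ((1 + t) powr (3/2)) * Linf_norm (U t) \<le> ennreal r" using order_trans[OF SUP_upper[OF tm[OF t]] abcd(3)] .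
    from ennreal_mult_le_cancel[OF _ this r] t have "Linf_norm (U t) \<le> ennreal (r * (1 + t) powr (-3/2))" unfolding p by simp
    note le = this[unfolded Linf_norm_def]
    have "AE x in lborel. ennreal (norm (U t x)) \<le> ennreal (r * (1 + t) powr (-3/2))"
      using esssup_AE[of "\<lambda>x. ennreal (norm (U t x))" lborel] by eventually_elim (rule order_trans[OF _ le])
    then show "AE x in lborel. norm (if fst (t, x) > 0 then U (fst (t, x)) (snd (t, x)) else 0) \<le> r * (1 / sqrt t) ^ 0 * (1 + t) powr (-3/2)"
      using t r by (simp add: ennreal_le_iff)
    have "ennreal (sqrt t * (1 + t) powr (3/2)) * Linf_norm (V t) \<le> ennreal r" using order_trans[OF SUP_upper[OF tm[OF t]] abcd(4)] .
    from ennreal_mult_le_cancel[OF _ this r] t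
    have "Linf_norm (V t) \<le> ennreal (r * (1 / (sqrt t * (1 + t) powr (3/2))))" by simp
    also have "r * (1 / (sqrt t * (1 + t) powr (3/2))) = r * (1 / sqrt t) * (1 + t) powr (-3/2)"
      unfolding p[symmetric] by simp
    finally have "Linf_norm (V t) \<le> ennreal (r * (1 / sqrt t) * (1 + t) powr (-3/2))" .
    note le = this[unfolded Linf_norm_def]
    have "AE x in lborel. ennreal (norm (V t x)) \<le> ennreal (r * (1 / sqrt t) * (1 + t) powr (-3/2))"
      using esssup_AE[of "\<lambda>x. ennreal (norm (V t x))" lborel] by eventually_elim (rule order_trans[OF _ le])
    then show "AE x in lborel. norm (if fst (t, x) > 0 then V (fst (t, x)) (snd (t, x)) else 0) \<le> r * (1 / sqrt t) ^ 1 * (1 + t) powr (-3/2)"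
      using t r by (simp add: ennreal_le_iff)
  qed
qed

context bilin
begin

lemma weak_jacobian_B:
  assumes "dec A u J" "A \<ge> 0" "t > 0"
  shows "weak_jacobian (\<lambda>x. \<eta> *\<^sub>R u1 (t, x) - BU c u J (t, x)) (\<lambda>x. \<eta> *\<^sub>R J1 (t, x) - BJ c u J (t, x))"
  unfolding BU_def BJ_def using assms source_dec[OF assms(1,1,2,2)]
  by (intro weak_jacobian_diff weak_jacobian_scaleR weak_jacobian_u1 weak_jacobian_duhamel[of "14 * A * A"]) auto

end

lemma F_member_if_dec:
  assumes d: "dec A u J" and A: "A \<ge> 0" and U: "\<And>t x. t > 0 \<Longrightarrow> U t x = u (t, x)"
    and w: "\<And>t. t > 0 \<Longrightarrow> weak_jacobian (\<lambda>x. u (t, x)) (\<lambda>x. J (t, x))"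
  shows "F_member U (\<lambda>t x. J (t, x))"
proof -
  let ?M = "restrict_space borel {0<..} \<Otimes>\<^sub>M borel :: (real \<times> (real^3)) measure"
  have id: "(\<lambda>p. (fst p, snd p)) \<in> measurable ?M (borel \<Otimes>\<^sub>M borel)"
  proof (intro measurable_Pair measurable_snd)
    have "(\<lambda>t. t) \<in> measurable (restrict_space borel {0<..}) (borel :: real measure)"
      by (rule measurable_restrict_space1) simp
    from measurable_compose[OF measurable_fst this] show "fst \<in> measurable ?M borel" .
  qed
  have m: "(\<lambda>(t, x). f (t, x)) \<in> borel_measurable ?M" if "f \<in> borel_measurable borel" for f :: "real \<times> (real^3) \<Rightarrow> 'z::euclidean_space"
    using measurable_compose[OF id, of f borel] that by (simp add: borel_prod split_beta)
  have u: "u \<in> borel_measurable borel" and J: "J \<in> borel_measurable borel"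
    using d by (auto simp: dec_def decay_def)
  have "(\<lambda>(t, x). U t x) \<in> borel_measurable ?M \<longleftrightarrow> (\<lambda>(t, x). u (t, x)) \<in> borel_measurable ?M"
    by (rule measurable_cong) (auto simp: space_pair_measure space_restrict_space U)
  then have mU: "(\<lambda>(t, x). U t x) \<in> borel_measurable ?M" using m[OF u] by (rule iffD2)
  have wU: "weak_jacobian (U t) (\<lambda>x. J (t, x))" if "t > 0" for t
  proof -
    have "U t = (\<lambda>x. u (t, x))" using U that by auto
    then show ?thesis using w[OF that] by simp
  qed
  have "F_norm U (\<lambda>t x. J (t, x)) \<le> ennreal (4 * A)" by (rule F_norm_le_if_dec[OF d A U refl])
  then have nU: "F_norm U (\<lambda>t x. J (t, x)) < \<infinity>" by (auto intro: le_less_trans)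
  show ?thesis unfolding F_member_def using mU m[OF J] wU nU by blast
qed

text \<open>The norm sees only positive times while \<open>mild_solution\<close> prescribes the
  value at time zero, so the fixed point is completed there by the initial field.\<close>

lemma mild_solution_exists:
  assumes b: "bilin (1 + 1 / \<epsilon>) C" and \<epsilon>: "\<epsilon> > 0" and d: "dec A u J" and A: "A \<ge> 0" and r: "4 * A \<le> r"
    and fu: "\<And>p. u p = \<eta> *\<^sub>R u1 p - BU (1 + 1 / \<epsilon>) u J p" and fJ: "\<And>p. J p = \<eta> *\<^sub>R J1 p - BJ (1 + 1 / \<epsilon>) u J p"
  shows "mild_solution_in_ball \<epsilon> (initial_field \<eta>) r (\<lambda>t x. if t > 0 then u (t, x) else initial_field \<eta> x)"
proof -
  interpret bilin "1 + 1 / \<epsilon>" C by fact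
  let ?U = "\<lambda>t x. if t > 0 then u (t, x) else initial_field \<eta> x" and ?V = "\<lambda>t x. J (t, x)"
  have w: "weak_jacobian (\<lambda>x. u (t, x)) (\<lambda>x. J (t, x))" if "t > 0" for t
    using weak_jacobian_B[OF d A that, of \<eta>] unfolding fu[symmetric] fJ[symmetric] .
  have m: "F_member ?U ?V" by (rule F_member_if_dec[OF d A _ w]) auto
  have n: "F_norm ?U ?V \<le> ennreal r"
    by (rule order_trans[OF F_norm_le_if_dec[OF d A]]) (use r in \<open>auto intro: ennreal_leI\<close>)
  have s: "source (14 * A * A) (\<lambda>p. Nl (u p) (J p))" by (rule source_dec[OF d d A A])
  have "mild_solution \<epsilon> (initial_field \<eta>) ?U ?V"
    unfolding mild_solution_def
  proof (intro conjI allI impI AE_I2)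
    fix t :: real and x assume t: "t > 0"
    have "(LINT s:{0<..<t}|lborel. multiplier \<epsilon> (t - s) (nonlinearity (?U s) (?V s)) x)
      = (LINT s:{0<..<t}|lborel. multiplier \<epsilon> (t - s) (nonlinearity (\<lambda>x. u (s, x)) (\<lambda>x. J (s, x))) x)"
      by (intro set_lebesgue_integral_cong) auto
    then show "?U t x = multiplier \<epsilon> t (initial_field \<eta>) x - (LINT s:{0<..<t}|lborel. multiplier \<epsilon> (t - s) (nonlinearity (?U s) (?V s)) x)"
      using mild_formula[OF b \<epsilon> t s, of \<eta> x] A fu[of "(t, x)"] t by simp
  qed auto
  then show ?thesis using m n unfolding mild_solution_in_ball_def by blast
qed

text \<open>The hypothesis gives the field equation for \<open>v\<close>, but the contraction also
  needs an equation for its Jacobian. That one follows: \<open>L'\<close> and the differentiated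
  right-hand side are weak Jacobians of fields that agree almost everywhere, so they agree almost
  everywhere too.\<close>

lemma mild_solution_unique:
  assumes b: "bilin (1 + 1 / \<epsilon>) C" and \<epsilon>: "\<epsilon> > 0" and d: "dec r u J" and r: "r \<ge> 0" and small: "4 * bilin.K C * r \<le> 1"
    and fu: "\<And>p. u p = \<eta> *\<^sub>R u1 p - BU (1 + 1 / \<epsilon>) u J p" and fJ: "\<And>p. J p = \<eta> *\<^sub>R J1 p - BJ (1 + 1 / \<epsilon>) u J p"
    and v: "mild_solution_in_ball \<epsilon> (initial_field \<eta>) r v" and t: "t \<ge> 0"
  shows "AE x in lborel. v t x = (if t > 0 then u (t, x) else initial_field \<eta> x)"
proof -
  interpret bilin "1 + 1 / \<epsilon>" C by fact
  obtain L where L: "F_member v L" "F_norm v L \<le> ennreal r" "mild_solution \<epsilon> (initial_field \<eta>) v L"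
    using v unfolding mild_solution_in_ball_def by blast
  define v' where "v' p = (if fst p > 0 then v (fst p) (snd p) else 0)" for p
  define L' where "L' p = (if fst p > 0 then L (fst p) (snd p) else 0)" for p
  have d': "dec r v' L'" using dec_if_F_norm_le[OF L(1,2) r] by (simp add: v'_def[abs_def] L'_def[abs_def])
  have s: "source (14 * r * r) (\<lambda>p. Nl (v' p) (L' p))" by (rule source_dec[OF d' d' r r])
  have fv: "AE x in lborel. v' (t, x) = \<eta> *\<^sub>R u1 (t, x) - BU (1 + 1 / \<epsilon>) v' L' (t, x)" if t: "t > 0" for t
  proof -
    have "(LINT s:{0<..<t}|lborel. multiplier \<epsilon> (t - s) (nonlinearity (v s) (L s)) x)
      = (LINT s:{0<..<t}|lborel. multiplier \<epsilon> (t - s) (nonlinearity (\<lambda>x. v' (s, x)) (\<lambda>x. L' (s, x))) x)" for x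
      by (intro set_lebesgue_integral_cong) (auto simp: v'_def L'_def)
    then have eq: "multiplier \<epsilon> t (initial_field \<eta>) x - (LINT s:{0<..<t}|lborel. multiplier \<epsilon> (t - s) (nonlinearity (v s) (L s)) x)
      = \<eta> *\<^sub>R u1 (t, x) - BU (1 + 1 / \<epsilon>) v' L' (t, x)" for x
      using mild_formula[OF b \<epsilon> t s, of \<eta> x] r by simp
    have "AE x in lborel. v t x = multiplier \<epsilon> t (initial_field \<eta>) x - (LINT s:{0<..<t}|lborel. multiplier \<epsilon> (t - s) (nonlinearity (v s) (L s)) x)"
      using L(3) t by (simp add: mild_solution_def)
    then show ?thesis unfolding eq by eventually_elim (simp add: v'_def t)
  qed
  have fL: "AE x in lborel. L' (t, x) = \<eta> *\<^sub>R J1 (t, x) - BJ (1 + 1 / \<epsilon>) v' L' (t, x)" if t: "t > 0" for t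
  proof (rule weak_jacobian_unique[OF _ weak_jacobian_B[OF d' r t] fv[OF t]])
    show "weak_jacobian (\<lambda>x. v' (t, x)) (\<lambda>x. L' (t, x))"
      using L(1) t by (simp add: F_member_def v'_def L'_def)
  qed
  show ?thesis
  proof (cases "t > 0")
    case True
    have "AE x in lborel. v' (t, x) = u (t, x)"
      by (rule fixpoint_unique[OF d' d r small fv fL _ _ True]) (use fu fJ in auto)
    then show ?thesis using True by (simp add: v'_def)
  next
    case False
    then show ?thesis using t L(3) by (simp add: mild_solution_def)
  qed
qed

subsection \<open>The sign of the third-order coefficient\<close>

lemma prod_UNIV_3: "(\<Prod>k\<in>UNIV. f (k::3)) = f 1 * f 2 * f 3"
  unfolding UNIV_3 by (simp add: mult.assoc)

lemma he_explicit:
  assumes "s > 0" "a = 1 / (2 * s)"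
  shows "he (Suc 0) s x = - a * x * he 0 s x"
    and "he (Suc (Suc 0)) s x = (a\<^sup>2 * x\<^sup>2 - a) * he 0 s x"
    and "he (Suc (Suc (Suc 0))) s x = (3 * a\<^sup>2 * x - a ^ 3 * x ^ 3) * he 0 s x"
proof -
  have r: "z / (2 * s) = a * z" for z using assms by simp
  show 1: "he (Suc 0) s x = - a * x * he 0 s x"
    unfolding he.simps(2) r by simp
  show 2: "he (Suc (Suc 0)) s x = (a\<^sup>2 * x\<^sup>2 - a) * he 0 s x"
    unfolding he.simps(3) r 1 by (simp add: algebra_simps power2_eq_square)
  show "he (Suc (Suc (Suc 0))) s x = (3 * a\<^sup>2 * x - a ^ 3 * x ^ 3) * he 0 s x"
    unfolding he.simps(3)[of "Suc 0"] r 1 2 by (simp add: algebra_simps power2_eq_square power3_eq_cube)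
qed

lemma heatD_explicit:
  assumes "s > 0" "a = 1 / (2 * s)"
  shows "heatD a22 s x = (a\<^sup>2 * (x $ 2)\<^sup>2 - a) * heatD z3 s x"
    and "heatD a12 s x = a\<^sup>2 * x $ 1 * x $ 2 * heatD z3 s x"
    and "heatD (inc 1 a22) s x = - a * x $ 1 * (a\<^sup>2 * (x $ 2)\<^sup>2 - a) * heatD z3 s x"
    and "heatD (inc 2 a22) s x = (3 * a\<^sup>2 * x $ 2 - a ^ 3 * (x $ 2) ^ 3) * heatD z3 s x"
    and "heatD (inc 1 a12) s x = - a * x $ 2 * (a\<^sup>2 * (x $ 1)\<^sup>2 - a) * heatD z3 s x"
    and "heatD (inc 2 a12) s x = - a * x $ 1 * (a\<^sup>2 * (x $ 2)\<^sup>2 - a) * heatD z3 s x"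
  unfolding heatD_def prod_UNIV_3 by (simp_all add: inc_def he_explicit[OF assms] power2_eq_square)

text \<open>All factors are polynomials times one Gaussian, and the terms of highest degree cancel.
  The low-degree odd polynomials that remain give both the parity argument and the moment
  computation.\<close>

lemma Nl_u1_explicit:
  assumes "t > -1" "a = 1 / (2 * (1 + t))"
  shows "Nl (u1 (t, x)) (J1 (t, x)) $ 1 = - (a ^ 3 * x $ 1 * (1 + a * (x $ 2)\<^sup>2) * (heatD z3 (1 + t) x)\<^sup>2)"
    and "Nl (u1 (t, x)) (J1 (t, x)) $ 2 = a ^ 3 * x $ 2 * (1 - a * (x $ 2)\<^sup>2) * (heatD z3 (1 + t) x)\<^sup>2"
    and "Nl (u1 (t, x)) (J1 (t, x)) $ 3 = 0"
proof -
  have s: "1 + t > 0" using assms by simp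
  note E = heatD_explicit[OF s assms(2), of x]
  show "Nl (u1 (t, x)) (J1 (t, x)) $ 1 = - (a ^ 3 * x $ 1 * (1 + a * (x $ 2)\<^sup>2) * (heatD z3 (1 + t) x)\<^sup>2)"
    unfolding Nl_nth sum_3 u1_nth J1_nth fst_conv snd_conv E
    by (simp add: algebra_simps power2_eq_square power3_eq_cube)
  show "Nl (u1 (t, x)) (J1 (t, x)) $ 2 = a ^ 3 * x $ 2 * (1 - a * (x $ 2)\<^sup>2) * (heatD z3 (1 + t) x)\<^sup>2"
    unfolding Nl_nth sum_3 u1_nth J1_nth fst_conv snd_conv E
    by (simp add: algebra_simps power2_eq_square power3_eq_cube)
  show "Nl (u1 (t, x)) (J1 (t, x)) $ 3 = 0"
    unfolding Nl_nth sum_3 u1_nth J1_nth by simp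
qed

lemma integral_lborel_pos:
  fixes f :: "real \<Rightarrow> real"
  assumes f: "integrable lborel f" and nonneg: "\<And>x. 0 \<le> f x" and "a < b" and pos: "\<And>x. a < x \<Longrightarrow> x < b \<Longrightarrow> 0 < f x"
  shows "0 < (LINT x|lborel. f x)"
proof -
  have "(LINT x|lborel. f x) \<noteq> 0"
  proof
    assume "(LINT x|lborel. f x) = 0"
    then have "AE x in lborel. f x = 0" using integral_nonneg_eq_0_iff_AE[OF f] nonneg by simp
    then have "AE x in lborel. x \<notin> {a<..<b}" by eventually_elim (use pos in force)
    then have "{a<..<b} \<in> null_sets lborel" by (subst AE_iff_null_sets) auto
    then show False using \<open>a < b\<close> by (simp add: null_sets_def)
  qed
  moreover have "0 \<le> (LINT x|lborel. f x)" using nonneg by (intro Bochner_Integration.integral_nonneg)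
  ultimately show ?thesis by simp
qed

text \<open>Integration by parts: the derivative of
  \<open>y ^ Suc n * exp (- \<sigma> * y\<^sup>2)\<close> has integral zero.\<close>

lemma gaussian_moment_rec:
  assumes \<sigma>: "\<sigma> > 0"
  shows "(LINT y|lborel. y ^ Suc (Suc n) * exp (- \<sigma> * y\<^sup>2)) = real (Suc n) / (2 * \<sigma>) * (LINT y|lborel. y ^ n * exp (- \<sigma> * y\<^sup>2))"
proof -
  note I = integrable_power_gaussian[OF \<sigma>]
  have "(LINT y|lborel. real (Suc n) * (y ^ n * exp (- \<sigma> * y\<^sup>2)) - 2 * \<sigma> * (y ^ Suc (Suc n) * exp (- \<sigma> * y\<^sup>2))) = 0"
  proof (rule integral_vector_derivative_eq_0[where f="\<lambda>y. y ^ Suc n * exp (- \<sigma> * y\<^sup>2)"])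
    fix y :: real
    have "((\<lambda>y. y ^ Suc n * exp (- \<sigma> * y\<^sup>2)) has_real_derivative real (Suc n) * (y ^ n * exp (- \<sigma> * y\<^sup>2)) - 2 * \<sigma> * (y ^ Suc (Suc n) * exp (- \<sigma> * y\<^sup>2))) (at y)"
      by (rule derivative_eq_intros refl)+ (simp add: algebra_simps)
    then show "((\<lambda>y. y ^ Suc n * exp (- \<sigma> * y\<^sup>2)) has_vector_derivative real (Suc n) * (y ^ n * exp (- \<sigma> * y\<^sup>2)) - 2 * \<sigma> * (y ^ Suc (Suc n) * exp (- \<sigma> * y\<^sup>2))) (at y)"
      by (simp add: has_real_derivative_iff_has_vector_derivative)
  qed (intro I Bochner_Integration.integrable_diff integrable_mult_right continuous_intros)+
  then have "real (Suc n) * (LINT y|lborel. y ^ n * exp (- \<sigma> * y\<^sup>2)) - 2 * \<sigma> * (LINT y|lborel. y ^ Suc (Suc n) * exp (- \<sigma> * y\<^sup>2)) = 0"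
    using I[of n] I[of "Suc (Suc n)"] by (subst (asm) Bochner_Integration.integral_diff) (auto simp del: power_Suc)
  then show ?thesis using \<sigma> by (simp add: field_simps)
qed

text \<open>The integrand of the third-order coefficient at a fixed source time \<open>s\<close>,
  with \<open>T\<close> the age of the heat kernel it is paired with. Since \<open>J1\<close> has
  trace zero, \<open>Nl\<close> is here just \<open>u1 \<cdot> \<nabla>u1\<close>.\<close>

definition sgd :: "real \<Rightarrow> real \<Rightarrow> real^3 \<Rightarrow> real" where
  "sgd s T y = (\<Sum>l\<in>UNIV. Nl (u1 (s, y)) (J1 (s, y)) $ l * heatD (inc l a22) T y)"

text \<open>With \<open>a = 1/(2(1+s))\<close>, \<open>b = 1/(2T)\<close> and \<open>V = 1/(2a+b)\<close> the Gaussian moments combine to a positive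
  multiple of \<open>2 - (10a+2b) V + 18ab V\<^sup>2 = -12a(a-b) V\<^sup>2\<close>.\<close>

lemma integral_sgd_neg:
  assumes s: "s > -1" and T: "T > 1 + s"
  shows "(LINT y|lborel. sgd s T y) < 0"
proof -
  \<comment> \<open>\<open>\<sigma>\<close> is the exponent of a product of three Gaussians: two of
    age \<open>1 + s\<close>, each contributing \<open>a / 2\<close>, and one of age
    \<open>T\<close>, contributing \<open>b / 2\<close>.\<close>
  define a b \<sigma> where "a = 1 / (2 * (1 + s))" and "b = 1 / (2 * T)" and "\<sigma> = a + b / 2"
  have T0: "T > 0" using s T by linarith
  have ab: "b > 0" "a > b" "\<sigma> > 0" using s T T0 by (auto simp: a_def b_def \<sigma>_def frac_less2 intro!: add_pos_pos)
  have S0: "1 + s > 0" using s by simp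
  define Z where "Z = (1 / sqrt (4 * pi * (1 + s))) ^ 6 * (1 / sqrt (4 * pi * T)) ^ 3"
  have Z: "Z > 0" using S0 T0 by (simp add: Z_def)
  let ?e = "\<lambda>y. exp (- \<sigma> * y\<^sup>2)"
  \<comment> \<open>\<open>f\<close> holds the coordinate factors of \<open>- y\<^sub>1\<^sup>2 (1 +
    a y\<^sub>2\<^sup>2) (1 - b y\<^sub>2\<^sup>2)\<close>, from the first component of the source,
    and \<open>h\<close> those of \<open>y\<^sub>2\<^sup>2 (1 - a y\<^sub>2\<^sup>2) (3 - b
    y\<^sub>2\<^sup>2)\<close>, from the second. Each is a product over coordinates, so its integral
    factors; writing \<open>y ^ 0\<close> keeps every term a moment.\<close>
  define f :: "3 \<Rightarrow> real \<Rightarrow> real" where "f k y = (if k = 1 then - (y ^ 2 * ?e y)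
    else if k = 2 then y ^ 0 * ?e y + (a - b) * (y ^ 2 * ?e y) - a * b * (y ^ 4 * ?e y) else y ^ 0 * ?e y)" for k y
  define h :: "3 \<Rightarrow> real \<Rightarrow> real" where "h k y = (if k = 1 then y ^ 0 * ?e y
    else if k = 2 then 3 * (y ^ 2 * ?e y) - (3 * a + b) * (y ^ 4 * ?e y) + a * b * (y ^ 6 * ?e y) else y ^ 0 * ?e y)" for k y
  note I = integrable_power_gaussian[OF ab(3)]
  have If: "integrable lborel (f k)" for k
    unfolding f_def[abs_def]
    by (cases "k = 1"; cases "k = 2"; simp only: simp_thms if_True if_False;
        intro I Bochner_Integration.integrable_diff Bochner_Integration.integrable_add Bochner_Integration.integrable_minus integrable_mult_right)
  have Ih: "integrable lborel (h k)" for k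
    unfolding h_def[abs_def]
    by (cases "k = 1"; cases "k = 2"; simp only: simp_thms if_True if_False;
        intro I Bochner_Integration.integrable_diff Bochner_Integration.integrable_add Bochner_Integration.integrable_minus integrable_mult_right)
  have e3: "heatD z3 r y = (1 / sqrt (4 * pi * r)) ^ 3 * (exp (- (1 / (4 * r)) * (y $ 1)\<^sup>2) * exp (- (1 / (4 * r)) * (y $ 2)\<^sup>2) * exp (- (1 / (4 * r)) * (y $ 3)\<^sup>2))" for r y
    by (simp add: heatD_def prod_UNIV_3 he.simps power3_eq_cube)
  have ee: "(heatD z3 (1 + s) y)\<^sup>2 * heatD z3 T y = Z * (?e (y $ 1) * ?e (y $ 2) * ?e (y $ 3))" for y
  proof -
    have x: "exp (- (1 / (4 * (1 + s))) * z\<^sup>2) ^ 2 * exp (- (1 / (4 * T)) * z\<^sup>2) = ?e z" for z :: real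
    proof -
      have "2 * (- (1 / (4 * (1 + s))) * z\<^sup>2) + - (1 / (4 * T)) * z\<^sup>2 = - \<sigma> * z\<^sup>2"
      proof -
        have "1 / (4 * (1 + s)) = a / 2" "1 / (4 * T) = b / 2" using S0 T0 by (simp_all add: a_def b_def)
        then show ?thesis by (simp only: \<sigma>_def) (simp add: algebra_simps)
      qed
      then show ?thesis by (simp only: exp_double[symmetric] exp_add[symmetric])
    qed
    have alg: "(p ^ 3 * (u * v * w))\<^sup>2 * (q ^ 3 * (u' * v' * w')) = p ^ 6 * q ^ 3 * ((u ^ 2 * u') * (v ^ 2 * v') * (w ^ 2 * w'))"
      for p q u v w u' v' w' :: real
      by (simp add: power_mult_distrib flip: power_mult)
    show ?thesis unfolding e3 alg x Z_def ..
  qed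
  have eq: "sgd s T y = Z * a ^ 3 * b\<^sup>2 * ((\<Prod>k\<in>UNIV. f k (y $ k)) + (\<Prod>k\<in>UNIV. h k (y $ k)))" for y
  proof -
    have "sgd s T y = a ^ 3 * b\<^sup>2 * (- ((y $ 1)\<^sup>2 * (1 + a * (y $ 2)\<^sup>2) * (1 - b * (y $ 2)\<^sup>2)) + (y $ 2)\<^sup>2 * (1 - a * (y $ 2)\<^sup>2) * (3 - b * (y $ 2)\<^sup>2))
      * ((heatD z3 (1 + s) y)\<^sup>2 * heatD z3 T y)"
      unfolding sgd_def sum_3 Nl_u1_explicit[OF s a_def] heatD_explicit(3,4)[OF T0 b_def]
      by (simp add: algebra_simps power2_eq_square power3_eq_cube)
    also have "\<dots> = a ^ 3 * b\<^sup>2 * (- ((y $ 1)\<^sup>2 * (1 + a * (y $ 2)\<^sup>2) * (1 - b * (y $ 2)\<^sup>2)) + (y $ 2)\<^sup>2 * (1 - a * (y $ 2)\<^sup>2) * (3 - b * (y $ 2)\<^sup>2))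
      * (Z * (?e (y $ 1) * ?e (y $ 2) * ?e (y $ 3)))"
      unfolding ee ..
    also have "\<dots> = Z * a ^ 3 * b\<^sup>2 * ((\<Prod>k\<in>UNIV. f k (y $ k)) + (\<Prod>k\<in>UNIV. h k (y $ k)))"
    proof -
      have alg: "a ^ 3 * b\<^sup>2 * (- (u\<^sup>2 * (1 + a * v\<^sup>2) * (1 - b * v\<^sup>2)) + v\<^sup>2 * (1 - a * v\<^sup>2) * (3 - b * v\<^sup>2)) * (Z * (p * q * w))
        = Z * a ^ 3 * b\<^sup>2 * (- (u ^ 2 * p) * (v ^ 0 * q + (a - b) * (v ^ 2 * q) - a * b * (v ^ 4 * q)) * (z ^ 0 * w)
          + (u ^ 0 * p) * (3 * (v ^ 2 * q) - (3 * a + b) * (v ^ 4 * q) + a * b * (v ^ 6 * q)) * (z ^ 0 * w))" for u v z p q w :: real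
        by (simp add: algebra_simps power2_eq_square power4_eq_xxxx eval_nat_numeral)
      show ?thesis unfolding prod_UNIV_3 f_def h_def using alg by simp
    qed
    finally show ?thesis .
  qed
  define M where "M n = (LINT y|lborel. y ^ n * ?e y)" for n
  \<comment> \<open>\<open>exp (- \<sigma> * y\<^sup>2)\<close> is a Gaussian weight of variance
    \<open>V\<close>, whence the moments \<open>V\<close>, \<open>3 * V\<^sup>2\<close> and
    \<open>15 * V ^ 3\<close> relative to \<open>M 0\<close>.\<close>
  define V where "V = 1 / (2 * a + b)"
  have V: "V > 0" "V * (2 * a + b) = 1" using ab by (auto simp: V_def)
  have half: "1 / (2 * \<sigma>) = V" by (simp add: V_def \<sigma>_def)
  have rec: "M (Suc (Suc n)) = real (Suc n) * V * M n" for n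
    unfolding M_def gaussian_moment_rec[OF ab(3)] half[symmetric] by simp
  have M2: "M 2 = V * M 0" and M4: "M 4 = 3 * V\<^sup>2 * M 0" and M6: "M 6 = 15 * V ^ 3 * M 0"
    using rec[of 0] rec[of 2] rec[of 4] by (simp_all add: eval_nat_numeral)
  have M0: "M 0 > 0"
    unfolding M_def using integral_lborel_pos[OF I[of 0], of 0 1] by simp
  have i: "(LINT y|lborel. f 1 y) = - M 2" "(LINT y|lborel. f 2 y) = M 0 + (a - b) * M 2 - a * b * M 4" "(LINT y|lborel. f 3 y) = M 0"
    "(LINT y|lborel. h 1 y) = M 0" "(LINT y|lborel. h 2 y) = 3 * M 2 - (3 * a + b) * M 4 + a * b * M 6" "(LINT y|lborel. h 3 y) = M 0"
    using I[of 0] I[of 2] I[of 4] I[of 6] unfolding f_def h_def M_def by (simp_all del: power_0)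
  have "(LINT y|lborel. sgd s T y) = Z * a ^ 3 * b\<^sup>2 * ((\<Prod>k\<in>UNIV. (LINT y|lborel. f k y)) + (\<Prod>k\<in>UNIV. (LINT y|lborel. h k y)))"
    unfolding eq using integrable_prod_vec[where f=f, OF If] integrable_prod_vec[where f=h, OF Ih]
    by (simp add: integral_prod_vec[where f=f, OF If] integral_prod_vec[where f=h, OF Ih])
  also have "(\<Prod>k\<in>UNIV. (LINT y|lborel. f k y)) + (\<Prod>k\<in>UNIV. (LINT y|lborel. h k y))
    = M 0 ^ 3 * V * (2 - (10 * a + 2 * b) * V + 18 * a * b * V\<^sup>2)"
    unfolding prod_UNIV_3 i M2 M4 M6 by (simp add: algebra_simps power2_eq_square power3_eq_cube)
  also have "2 - (10 * a + 2 * b) * V + 18 * a * b * V\<^sup>2 = - (12 * a * (a - b) * V\<^sup>2)"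
  proof -
    \<comment> \<open>Inserting powers of \<open>V * (2 * a + b) = 1\<close> makes every term
      quadratic in \<open>V\<close>; the terms with \<open>b\<^sup>2\<close> then cancel.\<close>
    have "2 - (10 * a + 2 * b) * V + 18 * a * b * V\<^sup>2
      = 2 * (V * (2 * a + b))\<^sup>2 - (10 * a + 2 * b) * V * (V * (2 * a + b)) + 18 * a * b * V\<^sup>2"
      unfolding V(2) by simp
    also have "\<dots> = - (12 * a * (a - b) * V\<^sup>2)" by (simp add: algebra_simps power2_eq_square)
    finally show ?thesis .
  qed
  also have "Z * a ^ 3 * b\<^sup>2 * (M 0 ^ 3 * V * - (12 * a * (a - b) * V\<^sup>2)) < 0"
    using Z ab M0 V(1) by (auto simp: mult_pos_pos)
  finally show ?thesis .
qed

text \<open>Parity: one odd coordinate factor times an even function. This is how the quadratic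
  order is seen to vanish, in place of an integration by parts.\<close>

lemma integral_Nl_u1_1:
  assumes "t > 0"
  shows "(LINT x|lborel. Nl (u1 (t, x)) (J1 (t, x)) $ 1) = 0"
proof -
  let ?f = "\<lambda>x. Nl (u1 (t, x)) (J1 (t, x)) $ 1"
  have e: "heatD z3 (1 + t) (- x) = heatD z3 (1 + t) x" for x
    by (simp add: heatD_def he.simps)
  have odd: "?f (- x) = - ?f x" for x
    using Nl_u1_explicit(1)[of t _ "- x"] Nl_u1_explicit(1)[of t _ x] assms by (simp add: e)
  obtain A where A: "A \<ge> 0" "pdec A u1 J1" using pdec_u1 by blast
  have "(\<lambda>p. Nl (u1 p) (J1 p)) \<in> borel_measurable borel"
    using source_Nl[of A u1 A J1] A by (simp add: source_def pdec_def pdecay_def)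
  from borel_measurable_slice[OF this, of t] have "?f \<in> borel_measurable borel" by measurable
  from integral_lborel_uminus[OF this] have "- (LINT x|lborel. ?f x) = (LINT x|lborel. ?f x)"
    unfolding odd by simp
  then show ?thesis by simp
qed

section \<open>Pairing the linear flow with the kernel\<close>

lemma ksym_0_uminus: "ksym c k l z3 \<tau> (- \<xi>) = ksym c k l z3 \<tau> \<xi>"
  by (simp add: ksym_def gavg_def gsym_inc gsym_0)

text \<open>\<open>\<xi>\<close> is an eigenvector of the matrix symbol with eigenvalue
  \<open>exp (- c * \<tau> * |\<xi>|\<^sup>2)\<close>, as gradients diffuse with coefficient
  \<open>c\<close>. So the divergence of the kernel is the gradient of a single heat kernel.\<close>

lemma ksym_div:
  assumes "c \<ge> 1" "\<tau> > 0"
  shows "(\<Sum>m\<in>UNIV. \<i> * of_real (\<xi> $ m) * ksym c m l z3 \<tau> \<xi>) = gsym (inc l z3) (c * \<tau>) \<xi>"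
proof (cases "\<xi> = 0")
  case True
  then show ?thesis by (simp add: gsym_inc)
next
  case False
  define n e1 e2 where "n = (norm \<xi>)\<^sup>2" and "e1 = exp (- \<tau> * (norm \<xi>)\<^sup>2)" and "e2 = exp (- (c * \<tau>) * (norm \<xi>)\<^sup>2)"
  have n: "n \<noteq> 0" "(\<Sum>m\<in>UNIV. (\<xi> $ m)\<^sup>2) = n"
    using False by (simp add: n_def) (simp add: n_def norm_power2_vec)
  have k: "ksym c m l z3 \<tau> \<xi> = of_real ((if m = l then e1 else 0) - \<xi> $ m * \<xi> $ l / n * (e1 - e2))" for m
    unfolding ksym_def gavg_inc_inc[OF assms(2,1)] gsym_0 by (simp add: n_def e1_def e2_def)
  have "(\<Sum>m\<in>UNIV. \<i> * of_real (\<xi> $ m) * ksym c m l z3 \<tau> \<xi>) = \<i> * of_real (\<Sum>m\<in>UNIV. \<xi> $ m * ((if m = l then e1 else 0) - \<xi> $ m * \<xi> $ l / n * (e1 - e2)))"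
    unfolding k by (simp add: sum_distrib_left mult.assoc)
  also have "(\<Sum>m\<in>UNIV. \<xi> $ m * ((if m = l then e1 else 0) - \<xi> $ m * \<xi> $ l / n * (e1 - e2)))
    = \<xi> $ l * e1 - (\<Sum>m\<in>UNIV. (\<xi> $ m)\<^sup>2) * (\<xi> $ l / n * (e1 - e2))"
    unfolding right_diff_distrib sum_subtractf sum_distrib_right
    by (intro arg_cong2[where f="(-)"] sum.cong) (simp_all add: if_distrib[of "(*) _"] power2_eq_square mult_ac cong: if_cong)
  also have "\<dots> = \<xi> $ l * e2" unfolding n(2) using n(1) by (simp add: field_simps)
  finally show ?thesis by (simp add: gsym_inc gsym_0 e2_def mult.assoc)
qed

text \<open>The three sums stem from \<open>u1 \<cdot> \<nabla>b\<close>,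
  \<open>1/2 * u1 div b\<close> and \<open>b \<cdot> \<nabla>u1\<close>, with column
  \<open>l\<close> of the kernel for \<open>b\<close>. The first integrates to zero because
  \<open>u1\<close> is divergence-free. By \<open>ksym_div\<close> the second gives
  \<open>1/2 * D\<close> and the third \<open>- D\<close>, where \<open>D\<close> is the derivative
  of the heat kernel on the right; its age is the sum of both ages by the semigroup
  property.\<close>

lemma kernel_pairing:
  assumes c: "c \<ge> 1" and \<tau>: "\<tau> > 0" and t: "t > 0"
  shows "(\<Sum>m\<in>UNIV. (LINT x|lborel. u1 (t, x) $ m * ker c 1 l (inc m z3) \<tau> (x - y)))
     + 1/2 * (\<Sum>m\<in>UNIV. (LINT x|lborel. u1 (t, x) $ 1 * ker c m l (inc m z3) \<tau> (x - y)))
     + (\<Sum>m\<in>UNIV. (LINT x|lborel. J1 (t, x) $ 1 $ m * ker c m l z3 \<tau> (x - y)))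
     = - 1/2 * heatD (inc l a22) (c * \<tau> + (1 + t)) y"
proof -
  have t1: "1 + t > 0" using t by simp
  obtain A where A: "pdec A u1 J1" using pdec_u1 by blast
  have iu: "integrable lborel (\<lambda>x. u1 (t, x) $ m)" and iJ: "integrable lborel (\<lambda>x. J1 (t, x) $ k $ m)" for k m
    using decay_integrable[of 0 A u1 t] decay_integrable[of 1 A J1 t] A t by (auto simp: pdec_def pdecay_def intro!: integrable_vec_nth)
  have neg: "fourier (\<lambda>x. - f x) \<xi> = - fourier f \<xi>" for f \<xi> by (simp add: fourier_def)
  have F1: "fourier (\<lambda>x. u1 (t, x) $ 1) \<xi> = - gsym a22 (1 + t) \<xi>" and F2: "fourier (\<lambda>x. u1 (t, x) $ 2) \<xi> = gsym a12 (1 + t) \<xi>"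
    and F3: "fourier (\<lambda>x. u1 (t, x) $ 3) \<xi> = 0" and FJ: "fourier (\<lambda>x. J1 (t, x) $ 1 $ m) \<xi> = - gsym (inc m a22) (1 + t) \<xi>" for \<xi> m
    unfolding u1_nth J1_nth fst_conv snd_conv neg by (simp_all add: fourier_heatD[OF t1]) (simp add: fourier_def)
  have K: "integrable lborel (\<lambda>\<xi>. ksym c k l \<beta> \<tau> (- \<xi>))" for k \<beta>
  proof -
    have [measurable]: "ksym c k l \<beta> \<tau> \<in> borel_measurable borel"
      using borel_measurable_integrable[OF integrable_ksym[OF \<tau>, of c k l \<beta>]] by simp
    show ?thesis using integrable_ksym[OF \<tau>, of c k l \<beta>] nn_integral_lborel_uminus[of "\<lambda>\<xi>. ennreal (norm (ksym c k l \<beta> \<tau> \<xi>))"]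
      by (simp add: integrable_iff_bounded)
  qed
  have pair: "(LINT x|lborel. f x * ker c k l \<beta> \<tau> (x - y)) = ift (\<lambda>\<xi>. ksym c k l \<beta> \<tau> (- \<xi>) * fourier f \<xi>) y" if "integrable lborel f" for f k \<beta>
    using integral_mult_ift(1)[OF integrable_ksym[OF \<tau>] that, of c k l \<beta> y] by (simp add: ift_ksym[OF \<tau>])
  define X where "X m \<xi> = ksym c 1 l (inc m z3) \<tau> (- \<xi>) * fourier (\<lambda>x. u1 (t, x) $ m) \<xi>" for m \<xi>
  define Y where "Y m \<xi> = ksym c m l (inc m z3) \<tau> (- \<xi>) * fourier (\<lambda>x. u1 (t, x) $ 1) \<xi>" for m \<xi>
  define W where "W m \<xi> = ksym c m l z3 \<tau> (- \<xi>) * fourier (\<lambda>x. J1 (t, x) $ 1 $ m) \<xi>" for m \<xi>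
  have iX: "integrable lborel (X m)" and iY: "integrable lborel (Y m)" and iW: "integrable lborel (W m)" for m
    unfolding X_def Y_def W_def by (intro integrable_mult_fourier K iu iJ)+
  have "(\<Sum>m\<in>UNIV. ift (X m) y) + 1/2 * (\<Sum>m\<in>UNIV. ift (Y m) y) + (\<Sum>m\<in>UNIV. ift (W m) y)
    = ift (\<lambda>\<xi>. (\<Sum>m\<in>UNIV. X m \<xi>)) y + ift (\<lambda>\<xi>. of_real (1/2) * (\<Sum>m\<in>UNIV. Y m \<xi>)) y + ift (\<lambda>\<xi>. (\<Sum>m\<in>UNIV. W m \<xi>)) y"
    unfolding ift_scale using iX iY iW by (simp add: ift_sum)
  also have "\<dots> = ift (\<lambda>\<xi>. ((\<Sum>m\<in>UNIV. X m \<xi>) + of_real (1/2) * (\<Sum>m\<in>UNIV. Y m \<xi>)) + (\<Sum>m\<in>UNIV. W m \<xi>)) y"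
    using iX iY iW by (subst ift_add) (auto simp: ift_add)
  also have "(\<lambda>\<xi>. ((\<Sum>m\<in>UNIV. X m \<xi>) + of_real (1/2) * (\<Sum>m\<in>UNIV. Y m \<xi>)) + (\<Sum>m\<in>UNIV. W m \<xi>))
    = (\<lambda>\<xi>. of_real (- 1/2) * gsym (inc l a22) (c * \<tau> + (1 + t)) \<xi>)"
  proof
    fix \<xi> :: "real^3"
    have X0: "(\<Sum>m\<in>UNIV. X m \<xi>) = 0"
      unfolding X_def ksym_inc ksym_0_uminus sum_3 F1 F2 F3 gsym_inc by (simp add: algebra_simps)
    have Y1: "(\<Sum>m\<in>UNIV. Y m \<xi>) = gsym (inc l z3) (c * \<tau>) \<xi> * gsym a22 (1 + t) \<xi>"
      unfolding Y_def ksym_inc ksym_0_uminus F1 ksym_div[OF c \<tau>, symmetric] sum_distrib_right by (simp add: mult_ac)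
    have W1: "(\<Sum>m\<in>UNIV. W m \<xi>) = - (gsym (inc l z3) (c * \<tau>) \<xi> * gsym a22 (1 + t) \<xi>)"
      unfolding W_def ksym_0_uminus FJ gsym_inc[of _ a22] ksym_div[OF c \<tau>, symmetric] sum_distrib_right sum_negf[symmetric] by (simp add: mult_ac)
    have "gsym (inc l z3) (c * \<tau>) \<xi> * gsym a22 (1 + t) \<xi> = gsym (inc l a22) (c * \<tau> + (1 + t)) \<xi>"
      unfolding gsym_inc[of l] gsym_0[of "c * \<tau>"] gsym_exp[symmetric] by (simp add: mult.assoc)
    then show "((\<Sum>m\<in>UNIV. X m \<xi>) + of_real (1/2) * (\<Sum>m\<in>UNIV. Y m \<xi>)) + (\<Sum>m\<in>UNIV. W m \<xi>)
      = of_real (- 1/2) * gsym (inc l a22) (c * \<tau> + (1 + t)) \<xi>"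
      unfolding X0 Y1 W1 by simp
  qed
  also have "ift (\<lambda>\<xi>. of_real (- 1/2) * gsym (inc l a22) (c * \<tau> + (1 + t)) \<xi>) y = - 1/2 * heatD (inc l a22) (c * \<tau> + (1 + t)) y"
    unfolding ift_scale using ift_gsym[of "c * \<tau> + (1 + t)" "inc l a22" y] c \<tau> t by (simp add: add_pos_pos)
  finally show ?thesis unfolding pair[OF iu] pair[OF iJ] X_def Y_def W_def .
qed

lemma integral_pair_fst:
  assumes "integrable lborel (f :: 'a::euclidean_space \<times> 'b::euclidean_space \<Rightarrow> 'c::euclidean_space)"
  shows "(LINT p|lborel. f p) = (LINT s|lborel. (LINT y|lborel. f (s, y)))" and "integrable lborel (\<lambda>s. LINT y|lborel. f (s, y))"
proof -
  have f: "integrable (lborel \<Otimes>\<^sub>M lborel) (\<lambda>(s, y). f (s, y))" using assms by (simp add: lborel_prod)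
  show "(LINT p|lborel. f p) = (LINT s|lborel. (LINT y|lborel. f (s, y)))"
    using lborel_pair.integral_fst[OF f] by (simp add: lborel_prod)
  show "integrable lborel (\<lambda>s. LINT y|lborel. f (s, y))"
    using lborel_pair.integrable_fst[OF f] .
qed

lemma trace_J1: "(\<Sum>m\<in>UNIV. J1 q $ m $ m) = 0"
proof -
  have "inc 2 a12 = inc 1 a22" by (metis inc_commute)
  then show ?thesis unfolding sum_3 J1_nth by simp
qed

context bilin
begin

definition "g p = Nl (u1 p) (J1 p)"

lemma source_g: obtains B where "B \<ge> 0" "source B g"
proof -
  obtain A where A: "A \<ge> 0" "pdec A u1 J1" using pdec_u1 by blast
  have "source (14 * A * A) g"
    unfolding g_def[abs_def] using A by (intro source_dec pdec_imp_dec) auto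
  then show ?thesis using that A by (metis mult_nonneg_nonneg zero_le_numeral)
qed

text \<open>The second-order term of the solution is \<open>- (BU c u1 J1)\<close>; pairing it with \<open>u1\<close> moves the
  heat semigroup onto \<open>u1\<close>, and only the divergence of the kernel survives since \<open>u1\<close> is divergence-free.\<close>

lemma second_order_value:
  assumes t: "t > 0"
  defines "\<Phi> \<equiv> \<lambda>p. indicator {0<..<t} (fst p) * (- 1/2 * sgd (fst p) (c * (t - fst p) + (1 + t)) (snd p))"
  shows "integrable lborel \<Phi>"
    and "(LINT x|lborel. (Nl (u1 (t, x)) (BJ c u1 J1 (t, x)) + Nl (BU c u1 J1 (t, x)) (J1 (t, x))) $ 1) = (LINT p|lborel. \<Phi> p)"
proof -
  obtain B where B: "B \<ge> 0" "source B g" by (rule source_g)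
  obtain A where A: "A \<ge> 0" "pdec A u1 J1" using pdec_u1 by blast
  let ?b = "\<lambda>x. duhamel (kU c) g (t, x)" and ?bJ = "\<lambda>x. duhamel (kJ c) g (t, x)"
  have bB: "BU c u1 J1 = duhamel (kU c) g" "BJ c u1 J1 = duhamel (kJ c) g" by (simp_all add: BU_def BJ_def g_def[abs_def])
  have ib: "integrable lborel ?b" and ibJ: "integrable lborel ?bJ"
    using decay_integrable[OF pdecay_imp_decay[OF pdecay_duhamel[OF c kU B(2) _ B(1)]] t]
      decay_integrable[OF pdecay_imp_decay[OF pdecay_duhamel[OF c kJ B(2) _ B(1)]] t] by auto
  have mu: "(\<lambda>x. u1 (t, x)) \<in> borel_measurable borel" and mJ: "(\<lambda>x. J1 (t, x)) \<in> borel_measurable borel"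
    using A(2) by (auto simp: pdec_def pdecay_def decay_def intro!: borel_measurable_slice)
  obtain M where M: "\<And>x. norm (u1 (t, x)) \<le> M" using pdecay_imp_norm[of 0 A u1 t] A(2) t by (auto simp: pdec_def)
  obtain M' where M': "\<And>x. norm (J1 (t, x)) \<le> M'" using pdecay_imp_norm[of 1 A J1 t] A(2) t by (auto simp: pdec_def)
  have mu': "(\<lambda>x. u1 (t, x) $ m) \<in> borel_measurable borel" and mJ': "(\<lambda>x. J1 (t, x) $ k $ m) \<in> borel_measurable borel" for k m
    using mu mJ by measurable
  have Mu: "\<bar>u1 (t, x) $ m\<bar> \<le> M" and MJ: "\<bar>J1 (t, x) $ k $ m\<bar> \<le> M'" for x k m
    using component_le_norm_cart[of "u1 (t, x)" m] M[of x] abs_matrix_nth_le[of "J1 (t, x)" k m] M'[of x] by linarith+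
  note i1 = integrable_bounded_scaleR[OF ibJ mu' Mu] and i2 = integrable_bounded_scaleR[OF ib mJ' MJ]
  define X where "X m p = (LINT x|lborel. u1 (t, x) $ m *\<^sub>R dint (kJ c) g (t, x) p)" for m p
  define Y where "Y m p = (LINT x|lborel. J1 (t, x) $ 1 $ m *\<^sub>R dint (kU c) g (t, x) p)" for m p
  have X: "(LINT x|lborel. u1 (t, x) $ m *\<^sub>R ?bJ x) = (LINT p|lborel. X m p)" "integrable lborel (X m)" for m
    unfolding X_def[abs_def] using duhamel_test[OF c kJ B(2) _ B(1) mu' Mu t] integrable_duhamel_test[OF c kJ B(2) _ B(1) mu' Mu t] by auto
  have Y: "(LINT x|lborel. J1 (t, x) $ 1 $ m *\<^sub>R ?b x) = (LINT p|lborel. Y m p)" "integrable lborel (Y m)" for m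
    unfolding Y_def[abs_def] using duhamel_test[OF c kU B(2) _ B(1) mJ' MJ t] integrable_duhamel_test[OF c kU B(2) _ B(1) mJ' MJ t] by auto
  note Xn = integrable_vec_nth[OF integrable_vec_nth[OF X(2)]] and Yn = integrable_vec_nth[OF Y(2)]
  \<comment> \<open>For fixed \<open>p\<close> the pairings are linear in the vector
    \<open>g p\<close>, so \<open>kernel_pairing\<close> applies to each component \<open>l\<close>
    separately.\<close>
  have \<Phi>: "(\<Sum>m\<in>UNIV. X m p $ 1 $ m) + 1/2 * (\<Sum>m\<in>UNIV. X 1 p $ m $ m) + (\<Sum>m\<in>UNIV. Y m p $ m) = \<Phi> p" for p
  proof -
    obtain s y where p: "p = (s, y)" by (cases p)
    show ?thesis
    proof (cases "0 < s \<and> s < t")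
      case True
      then have \<tau>: "t - s > 0" by simp
      have Xk: "X m p $ k $ m' = (\<Sum>l\<in>UNIV. (LINT x|lborel. u1 (t, x) $ m * ker c k l (inc m' z3) (t - s) (x - y)) * g p $ l)" for m k m'
        unfolding X_def using True by (simp add: p dint_def integral_kJ[OF c \<tau> mu' Mu])
      have Yk: "Y m p $ k = (\<Sum>l\<in>UNIV. (LINT x|lborel. J1 (t, x) $ 1 $ m * ker c k l z3 (t - s) (x - y)) * g p $ l)" for m k
        unfolding Y_def using True by (simp add: p dint_def integral_kU[OF c \<tau> mJ' MJ])
      let ?P = "\<lambda>l. (\<Sum>m\<in>UNIV. (LINT x|lborel. u1 (t, x) $ m * ker c 1 l (inc m z3) (t - s) (x - y)))
         + 1/2 * (\<Sum>m\<in>UNIV. (LINT x|lborel. u1 (t, x) $ 1 * ker c m l (inc m z3) (t - s) (x - y)))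
         + (\<Sum>m\<in>UNIV. (LINT x|lborel. J1 (t, x) $ 1 $ m * ker c m l z3 (t - s) (x - y)))"
      have "(\<Sum>m\<in>UNIV. X m p $ 1 $ m) + 1/2 * (\<Sum>m\<in>UNIV. X 1 p $ m $ m) + (\<Sum>m\<in>UNIV. Y m p $ m) = (\<Sum>l\<in>UNIV. ?P l * g p $ l)"
        unfolding Xk Yk sum_3 by (simp add: algebra_simps add_divide_distrib)
      also have "\<dots> = (\<Sum>l\<in>UNIV. (- 1/2 * heatD (inc l a22) (c * (t - s) + (1 + t)) y) * g p $ l)"
        by (intro sum.cong refl arg_cong2[where f="(*)"] kernel_pairing[OF c \<tau> t])
      also have "\<dots> = - 1/2 * sgd s (c * (t - s) + (1 + t)) y"
        unfolding sgd_def sum_distrib_left by (simp add: g_def p mult_ac)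
      finally show ?thesis using True by (simp add: \<Phi>_def p)
    next
      case False
      then have "X m p = 0" "Y m p = 0" for m by (auto simp: X_def Y_def p dint_def)
      then show ?thesis using False by (auto simp: \<Phi>_def p)
    qed
  qed
  have "integrable lborel (\<lambda>p. (\<Sum>m\<in>UNIV. X m p $ 1 $ m) + 1/2 * (\<Sum>m\<in>UNIV. X 1 p $ m $ m) + (\<Sum>m\<in>UNIV. Y m p $ m))"
    by (intro Bochner_Integration.integrable_add Bochner_Integration.integrable_sum integrable_mult_right Xn Yn)
  then show "integrable lborel \<Phi>" unfolding \<Phi> .
  have "(LINT x|lborel. (Nl (u1 (t, x)) (BJ c u1 J1 (t, x)) + Nl (BU c u1 J1 (t, x)) (J1 (t, x))) $ 1)
    = (LINT x|lborel. (\<Sum>m\<in>UNIV. (u1 (t, x) $ m *\<^sub>R ?bJ x) $ 1 $ m) + 1/2 * (\<Sum>m\<in>UNIV. (u1 (t, x) $ 1 *\<^sub>R ?bJ x) $ m $ m)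
        + (\<Sum>m\<in>UNIV. (J1 (t, x) $ 1 $ m *\<^sub>R ?b x) $ m))"
    by (intro Bochner_Integration.integral_cong refl) (simp add: bB Nl_nth trace_J1 sum_distrib_left sum_distrib_right mult_ac)
  also have "\<dots> = (\<Sum>m\<in>UNIV. (LINT x|lborel. u1 (t, x) $ m *\<^sub>R ?bJ x) $ 1 $ m) + 1/2 * (\<Sum>m\<in>UNIV. (LINT x|lborel. u1 (t, x) $ 1 *\<^sub>R ?bJ x) $ m $ m)
        + (\<Sum>m\<in>UNIV. (LINT x|lborel. J1 (t, x) $ 1 $ m *\<^sub>R ?b x) $ m)"
  proof -
    note j1 = integrable_vec_nth[OF integrable_vec_nth[OF i1]] and j2 = integrable_vec_nth[OF i2]
    show ?thesis
      unfolding integral_vec_nth[OF i1] integral_vec_nth[OF integrable_vec_nth[OF i1]] integral_vec_nth[OF i2]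
      using j1 j2 by (simp only: Bochner_Integration.integral_add Bochner_Integration.integral_sum Bochner_Integration.integrable_add Bochner_Integration.integrable_sum integrable_mult_right integral_mult_right_zero)
  qed
  also have "\<dots> = (\<Sum>m\<in>UNIV. (LINT p|lborel. X m p $ 1 $ m)) + 1/2 * (\<Sum>m\<in>UNIV. (LINT p|lborel. X 1 p $ m $ m)) + (\<Sum>m\<in>UNIV. (LINT p|lborel. Y m p $ m))"
    unfolding X(1) Y(1) integral_vec_nth[OF X(2)] integral_vec_nth[OF integrable_vec_nth[OF X(2)]] integral_vec_nth[OF Y(2)] ..
  also have "\<dots> = (LINT p|lborel. (\<Sum>m\<in>UNIV. X m p $ 1 $ m) + 1/2 * (\<Sum>m\<in>UNIV. X 1 p $ m $ m) + (\<Sum>m\<in>UNIV. Y m p $ m))"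
    using Xn Yn by (simp only: Bochner_Integration.integral_add Bochner_Integration.integral_sum Bochner_Integration.integrable_add Bochner_Integration.integrable_sum integrable_mult_right integral_mult_right_zero)
  finally show "(LINT x|lborel. (Nl (u1 (t, x)) (BJ c u1 J1 (t, x)) + Nl (BU c u1 J1 (t, x)) (J1 (t, x))) $ 1) = (LINT p|lborel. \<Phi> p)"
    unfolding \<Phi> .
qed

text \<open>For every source time \<open>s < t\<close> the age \<open>c * (t - s) + (1 + t)\<close>
  exceeds \<open>1 + s\<close>, so each inner integral is negative and the factor
  \<open>- 1/2\<close> makes it positive: nothing cancels in the integral over \<open>s\<close>, nor
  later in that over \<open>t\<close>.\<close>

lemma second_order_pos:
  assumes t: "t > 0"
  shows "(LINT x|lborel. (Nl (u1 (t, x)) (BJ c u1 J1 (t, x)) + Nl (BU c u1 J1 (t, x)) (J1 (t, x))) $ 1) > 0"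
proof -
  note v = second_order_value[OF t]
  have "0 < (LINT s|lborel. indicator {0<..<t} s * (- 1/2 * (LINT y|lborel. sgd s (c * (t - s) + (1 + t)) y)))"
  proof (rule integral_lborel_pos[where a=0 and b=t])
    show "integrable lborel (\<lambda>s. indicator {0<..<t} s * (- 1/2 * (LINT y|lborel. sgd s (c * (t - s) + (1 + t)) y)))"
      using integral_pair_fst(2)[OF v(1)] by simp
    have neg: "(LINT y|lborel. sgd s (c * (t - s) + (1 + t)) y) < 0" if "0 < s" "s < t" for s
    proof (rule integral_sgd_neg)
      have "c * (t - s) > 0" using that c by simp
      then show "1 + s < c * (t - s) + (1 + t)" using that by linarith
    qed (use that in simp)
    show "0 \<le> indicator {0<..<t} s * (- 1/2 * (LINT y|lborel. sgd s (c * (t - s) + (1 + t)) y))" for s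
      using neg[of s] by (auto simp: indicator_def)
    show "0 < indicator {0<..<t} s * (- 1/2 * (LINT y|lborel. sgd s (c * (t - s) + (1 + t)) y))" if "0 < s" "s < t" for s
      using neg[OF that] that by (simp add: indicator_def)
  qed (rule t)
  then show ?thesis unfolding v(2) integral_pair_fst(1)[OF v(1)] by simp
qed

subsection \<open>The total integral for large times\<close>

text \<open>What a source releases over all positive times. As the evolution preserves integrals,
  minus this vector is the limit sought.\<close>

definition total :: "(real \<times> (real^3) \<Rightarrow> real^3) \<Rightarrow> real^3" where
  "total n = (LINT p|lborel. indicator {0<..} (fst p) *\<^sub>R n p)"

text \<open>The constant \<open>4\<close> is the bound for the integral of the time weight
  \<open>tw\<close>.\<close>

lemma source_total:
  assumes n: "source B n" and B: "B \<ge> 0"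
  shows "integrable lborel (\<lambda>p. indicator {0<..} (fst p) *\<^sub>R n p)" and "norm (total n) \<le> 4 * B"
proof -
  have [measurable]: "n \<in> borel_measurable (borel \<Otimes>\<^sub>M borel)" using n by (simp add: source_def borel_prod)
  have "(\<lambda>p. indicator {0<..} (fst p) *\<^sub>R n p) \<in> borel_measurable (borel \<Otimes>\<^sub>M borel)" by measurable
  then have m [measurable]: "(\<lambda>p. indicator {0<..} (fst p) *\<^sub>R n p) \<in> borel_measurable borel" by (simp add: borel_prod)
  have "(\<integral>\<^sup>+p. ennreal (norm (indicator {0<..} (fst p) *\<^sub>R n p)) \<partial>lborel)
    = (\<integral>\<^sup>+s. (\<integral>\<^sup>+y. ennreal (norm (indicator {0<..} (fst (s, y)) *\<^sub>R n (s, y))) \<partial>lborel) \<partial>lborel)"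
    by (rule nn_integral_lborel_pair) measurable
  also have "\<dots> \<le> (\<integral>\<^sup>+s. ennreal B * ennreal (indicator {0<..} s * tw s) \<partial>lborel)"
  proof (rule nn_integral_mono)
    fix s :: real
    show "(\<integral>\<^sup>+y. ennreal (norm (indicator {0<..} (fst (s, y)) *\<^sub>R n (s, y))) \<partial>lborel) \<le> ennreal B * ennreal (indicator {0<..} s * tw s)"
      using n B by (cases "s > 0") (auto simp: source_def tw_nonneg simp flip: ennreal_mult')
  qed
  also have "\<dots> = ennreal B * (\<integral>\<^sup>+s. ennreal (indicator {0<..} s * tw s) \<partial>lborel)" by (rule nn_integral_cmult) measurable
  also have "\<dots> \<le> ennreal B * ennreal 4" by (intro mult_left_mono nn_integral_tw) auto
  also have "\<dots> = ennreal (4 * B)" using B by (subst ennreal_mult[symmetric]) (auto simp: mult.commute)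
  finally have le: "(\<integral>\<^sup>+p. ennreal (norm (indicator {0<..} (fst p) *\<^sub>R n p)) \<partial>lborel) \<le> ennreal (4 * B)" .
  then show i: "integrable lborel (\<lambda>p. indicator {0<..} (fst p) *\<^sub>R n p)"
    using m by (auto simp: integrable_iff_bounded le_less_trans[OF _ ennreal_less_top])
  have "ennreal (norm (total n)) \<le> (\<integral>\<^sup>+p. ennreal (norm (indicator {0<..} (fst p) *\<^sub>R n p)) \<partial>lborel)"
    unfolding total_def using nn_integral_eq_integral[OF integrable_norm[OF i]] integral_norm_bound[of lborel "\<lambda>p. indicator {0<..} (fst p) *\<^sub>R n p"]
    by (simp add: ennreal_leI)
  from order_trans[OF this le] show "norm (total n) \<le> 4 * B" using B by (simp add: ennreal_le_iff)
qed

lemma total_add: "source B n \<Longrightarrow> source B' n' \<Longrightarrow> B \<ge> 0 \<Longrightarrow> B' \<ge> 0 \<Longrightarrow> total (\<lambda>p. n p + n' p) = total n + total n'"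
  using source_total(1)[of B n] source_total(1)[of B' n'] by (simp add: total_def scaleR_add_right)

lemma total_nth: "source B n \<Longrightarrow> B \<ge> 0 \<Longrightarrow> total n $ k = (LINT t|lborel. indicator {0<..} t * (LINT x|lborel. n (t, x) $ k))"
  and integrable_total_nth: "source B n \<Longrightarrow> B \<ge> 0 \<Longrightarrow> integrable lborel (\<lambda>t. indicator {0<..} t * (LINT x|lborel. n (t, x) $ k))"
proof -
  assume n: "source B n" and B: "B \<ge> 0"
  note i = source_total(1)[OF n B]
  show "total n $ k = (LINT t|lborel. indicator {0<..} t * (LINT x|lborel. n (t, x) $ k))"
    unfolding total_def integral_vec_nth[OF i] integral_pair_fst(1)[OF integrable_vec_nth[OF i]] by simp
  show "integrable lborel (\<lambda>t. indicator {0<..} t * (LINT x|lborel. n (t, x) $ k))"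
    using integral_pair_fst(2)[OF integrable_vec_nth[OF i, of k]] by simp
qed

lemma total_g_1: "total g $ 1 = 0"
proof -
  obtain B where B: "B \<ge> 0" "source B g" by (rule source_g)
  have "(\<lambda>t. indicator {0<..} t * (LINT x|lborel. g (t, x) $ 1)) = (\<lambda>_. 0)"
    using integral_Nl_u1_1 by (auto simp: fun_eq_iff indicator_def g_def)
  then show ?thesis unfolding total_nth[OF B(2,1)] by simp
qed

lemma source_add:
  assumes n: "source B n" and n': "source B' n'" and B: "B \<ge> 0" "B' \<ge> 0"
  shows "source (B + B') (\<lambda>p. n p + n' p)"
  unfolding source_def
proof (intro conjI allI impI)
  have [measurable]: "n \<in> borel_measurable borel" "n' \<in> borel_measurable borel" using n n' by (auto simp: source_def)
  show "(\<lambda>p. n p + n' p) \<in> borel_measurable borel" by measurable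
  fix s :: real assume s: "s > 0"
  have [measurable]: "(\<lambda>y. n (s, y)) \<in> borel_measurable borel" "(\<lambda>y. n' (s, y)) \<in> borel_measurable borel"
    by (auto intro: borel_measurable_slice)
  have "(\<integral>\<^sup>+y. ennreal (norm (n (s, y) + n' (s, y))) \<partial>lborel) \<le> (\<integral>\<^sup>+y. ennreal (norm (n (s, y))) + ennreal (norm (n' (s, y))) \<partial>lborel)"
    by (intro nn_integral_mono) (auto simp: norm_triangle_ineq simp flip: ennreal_plus intro!: ennreal_leI)
  also have "\<dots> = (\<integral>\<^sup>+y. ennreal (norm (n (s, y))) \<partial>lborel) + (\<integral>\<^sup>+y. ennreal (norm (n' (s, y))) \<partial>lborel)"
    by (rule nn_integral_add) measurable
  also have "\<dots> \<le> ennreal (B * tw s) + ennreal (B' * tw s)"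
    using n n' s by (intro add_mono) (auto simp: source_def)
  also have "\<dots> = ennreal ((B + B') * tw s)" using B s tw_nonneg[of s] by (simp add: distrib_right flip: ennreal_plus)
  finally show "(\<integral>\<^sup>+y. ennreal (norm (n (s, y) + n' (s, y))) \<partial>lborel) \<le> ennreal ((B + B') * tw s)" .
  have "AE y in lborel. norm (n (s, y)) \<le> B * tw s * (1 + s) powr (-3/2)" "AE y in lborel. norm (n' (s, y)) \<le> B' * tw s * (1 + s) powr (-3/2)"
    using n n' s by (auto simp: source_def)
  then show "AE y in lborel. norm (n (s, y) + n' (s, y)) \<le> (B + B') * tw s * (1 + s) powr (-3/2)"
  proof eventually_elim
    case (elim y)
    then show ?case using norm_triangle_ineq[of "n (s, y)" "n' (s, y)"] by (simp add: distrib_right)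
  qed
qed

text \<open>The bilinear form polarised between the linear flow and its first correction. The
  correction enters the solution with a minus sign, so this vector has coefficient
  \<open>- \<eta> ^ 3\<close> in the total of the nonlinearity and \<open>\<eta> ^ 3\<close> in the
  limit.\<close>

definition "second_order = total (\<lambda>p. Nl (u1 p) (BJ c u1 J1 p)) + total (\<lambda>p. Nl (BU c u1 J1 p) (J1 p))"

lemma second_order_1_pos: "second_order $ 1 > 0"
proof -
  obtain A where A: "A \<ge> 0" "pdec A u1 J1" using pdec_u1 by blast
  have d: "dec A u1 J1" by (rule pdec_imp_dec[OF A(2)])
  define A' where "A' = K * A * A"
  have A': "A' \<ge> 0" using A K_nonneg by (simp add: A'_def)
  have dB: "dec A' (BU c u1 J1) (BJ c u1 J1)" unfolding A'_def by (rule pdec_imp_dec[OF pdec_B[OF d d A(1) A(1)]])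
  note s1 = source_dec[OF d dB A(1) A'] and s2 = source_dec[OF dB d A' A(1)]
  have p: "0 \<le> 14 * A * A'" "0 \<le> 14 * A' * A" using A A' by auto
  let ?n = "\<lambda>p. Nl (u1 p) (BJ c u1 J1 p) + Nl (BU c u1 J1 p) (J1 p)"
  have s: "source (14 * A * A' + 14 * A' * A) ?n" by (rule source_add[OF s1 s2 p])
  have p': "0 \<le> 14 * A * A' + 14 * A' * A" using p by simp
  have e: "second_order = total ?n" unfolding second_order_def total_add[OF s1 s2 p] ..
  show ?thesis unfolding e total_nth[OF s p']
  proof (rule integral_lborel_pos[OF integrable_total_nth[OF s p', of 1], where a=0 and b=1])
    show "0 \<le> indicator {0<..} t * (LINT x|lborel. ?n (t, x) $ 1)" for t
      using second_order_pos[of t] by (cases "t > 0") (auto intro: less_imp_le)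
    show "0 < indicator {0<..} t * (LINT x|lborel. ?n (t, x) $ 1)" if "0 < t" for t
      using second_order_pos[of t] that by simp
  qed simp
qed

text \<open>Testing with the constant \<open>1\<close>: the matrix kernel integrates to the
  identity, so everything released before time \<open>t\<close> is still present at time
  \<open>t\<close>.\<close>

lemma integral_duhamel_kU:
  assumes n: "source B n" and B: "B \<ge> 0" and t: "t > 0"
  shows "(LINT x|lborel. duhamel (kU c) n (t, x)) = (LINT p|lborel. indicator {0<..<t} (fst p) *\<^sub>R n p)"
proof -
  have "(LINT x|lborel. duhamel (kU c) n (t, x)) = (LINT x|lborel. 1 *\<^sub>R duhamel (kU c) n (t, x))" by simp
  also have "\<dots> = (LINT p|lborel. (LINT x|lborel. 1 *\<^sub>R dint (kU c) n (t, x) p))"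
    by (rule duhamel_test[OF c kU n _ B, where M=1]) (auto simp: t)
  also have "\<dots> = (LINT p|lborel. indicator {0<..<t} (fst p) *\<^sub>R n p)"
  proof (rule Bochner_Integration.integral_cong)
    fix p :: "real \<times> (real^3)"
    obtain s y where p: "p = (s, y)" by (cases p)
    show "(LINT x|lborel. 1 *\<^sub>R dint (kU c) n (t, x) p) = indicator {0<..<t} (fst p) *\<^sub>R n p"
    proof (cases "0 < s \<and> s < t")
      case True
      then have \<tau>: "t - s > 0" by simp
      have k: "(LINT x|lborel. 1 * ker c k l z3 (t - s) (x - y)) = (if k = l then 1 else 0)" for k l
        using integral_lborel_translation[of "ker c k l z3 (t - s)" "- y"] integral_ker_0[OF c \<tau>, of k l] by simp
      have "(LINT x|lborel. 1 *\<^sub>R kU c (t - s) (x - y) (n p)) $ k = n p $ k" for k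
        by (subst integral_kU[OF c \<tau>, where M=1]) (simp_all add: k[simplified] if_distrib[of "\<lambda>z. z * _"] cong: if_cong)
      then have "(LINT x|lborel. 1 *\<^sub>R kU c (t - s) (x - y) (n p)) = n p" by (simp add: vec_eq_iff)
      then show ?thesis using True by (simp add: p dint_def)
    qed (auto simp: p dint_def)
  qed simp
  finally show ?thesis .
qed

lemma integral_u1: "t > 0 \<Longrightarrow> (LINT x|lborel. u1 (t, x)) = 0"
proof -
  assume t: "t > 0"
  obtain A where A: "pdec A u1 J1" using pdec_u1 by blast
  have i: "integrable lborel (\<lambda>x. u1 (t, x))" using decay_integrable[of 0 A u1 t] A t by (simp add: pdec_def pdecay_def)
  have "\<forall>k. (LINT x|lborel. u1 (t, x)) $ k = 0"
    unfolding integral_vec_nth[OF i] forall_3 u1_nth using t by (simp add: integral_heatD_inc)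
  then show ?thesis by (simp add: vec_eq_iff)
qed

text \<open>The linear flow has integral zero, so only the source released up to time
  \<open>t\<close> is left; its integrability over all positive times allows dominated
  convergence.\<close>

lemma integral_tendsto:
  assumes d: "dec A u J" and A: "A \<ge> 0" and fu: "\<And>p. u p = \<eta> *\<^sub>R u1 p - BU c u J p"
    and U: "\<And>t x. t > 0 \<Longrightarrow> U t x = u (t, x)"
  shows "((\<lambda>t. LINT x|lborel. U t x) \<longlongrightarrow> - total (\<lambda>p. Nl (u p) (J p))) at_top"
proof -
  let ?n = "\<lambda>p. Nl (u p) (J p)"
  have s: "source (14 * A * A) ?n" by (rule source_dec[OF d d A A])
  have p: "0 \<le> 14 * A * A" using A by simp
  obtain A1 where A1: "pdec A1 u1 J1" using pdec_u1 by blast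
  have eq: "(LINT x|lborel. U t x) = - (LINT p|lborel. indicator {0<..<t} (fst p) *\<^sub>R ?n p)" if t: "t > 0" for t
  proof -
    have i1: "integrable lborel (\<lambda>x. u1 (t, x))" using decay_integrable[of 0 A1 u1 t] A1 t by (simp add: pdec_def pdecay_def)
    have i2: "integrable lborel (\<lambda>x. duhamel (kU c) ?n (t, x))"
      using decay_integrable[OF pdecay_imp_decay[OF pdecay_duhamel[OF c kU s _ p]] t] by simp
    have "U t x = \<eta> *\<^sub>R u1 (t, x) - duhamel (kU c) ?n (t, x)" for x using U[OF t] fu[of "(t, x)"] by (simp add: BU_def)
    then have "(LINT x|lborel. U t x) = \<eta> *\<^sub>R (LINT x|lborel. u1 (t, x)) - (LINT x|lborel. duhamel (kU c) ?n (t, x))"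
      using i1 i2 by simp
    then show ?thesis by (simp add: integral_u1[OF t] integral_duhamel_kU[OF s p t])
  qed
  have m: "?n \<in> borel_measurable (borel \<Otimes>\<^sub>M borel)" using s by (simp add: source_def borel_prod)
  have "((\<lambda>t. LINT p|lborel. indicator {0<..<t} (fst p) *\<^sub>R ?n p) \<longlongrightarrow> total ?n) at_top"
    unfolding total_def
  proof (rule integral_dominated_convergence_at_top[where w="\<lambda>p. norm (indicator {0<..} (fst p) *\<^sub>R ?n p)"])
    note [measurable] = m
    have "(\<lambda>p. indicator {0<..<t} (fst p) *\<^sub>R ?n p) \<in> borel_measurable (borel \<Otimes>\<^sub>M borel)" for t by measurable
    then show "(\<lambda>p. indicator {0<..<t} (fst p) *\<^sub>R ?n p) \<in> borel_measurable lborel" for t by (simp add: borel_prod)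
    show "(\<lambda>p. indicator {0<..} (fst p) *\<^sub>R ?n p) \<in> borel_measurable lborel"
      "integrable lborel (\<lambda>p. norm (indicator {0<..} (fst p) *\<^sub>R ?n p))"
      using borel_measurable_integrable[OF source_total(1)[OF s p]] integrable_norm[OF source_total(1)[OF s p]] by blast+
    show "AE p in lborel. ((\<lambda>t. indicator {0<..<t} (fst p) *\<^sub>R ?n p) \<longlongrightarrow> indicator {0<..} (fst p) *\<^sub>R ?n p) at_top"
    proof (rule AE_I2, rule tendsto_eventually)
      fix p :: "real \<times> (real^3)"
      show "\<forall>\<^sub>F t in at_top. indicator {0<..<t} (fst p) *\<^sub>R ?n p = indicator {0<..} (fst p) *\<^sub>R ?n p"
        using eventually_gt_at_top[of "fst p"] by eventually_elim (simp add: indicator_def)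
    qed
    show "\<forall>\<^sub>F t in at_top. AE p in lborel. norm (indicator {0<..<t} (fst p) *\<^sub>R ?n p) \<le> norm (indicator {0<..} (fst p) *\<^sub>R ?n p)"
      by (intro always_eventually allI AE_I2) (auto simp: indicator_def)
  qed
  from tendsto_minus[OF this]
  show ?thesis
    by (rule Lim_transform_eventually) (use eventually_gt_at_top[of "0::real"] in \<open>eventually_elim, simp add: eq\<close>)
qed

section \<open>Expansion in powers of \<eta>\<close>

lemma duhamel_scaleR: "dkernel c j C k \<Longrightarrow> duhamel k (\<lambda>p. a *\<^sub>R n p) q = a *\<^sub>R duhamel k n q"
  unfolding duhamel_def integral_scaleR_right[symmetric]
  by (intro Bochner_Integration.integral_cong) (auto simp: dint_def dkernel_def linear_scale)

lemma B_scaleR: "BU c (\<lambda>p. a *\<^sub>R u p) (\<lambda>p. a *\<^sub>R J p) q = a\<^sup>2 *\<^sub>R BU c u J q" "BJ c (\<lambda>p. a *\<^sub>R u p) (\<lambda>p. a *\<^sub>R J p) q = a\<^sup>2 *\<^sub>R BJ c u J q"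
proof -
  have "(\<lambda>p. Nl (a *\<^sub>R u p) (a *\<^sub>R J p)) = (\<lambda>p. a\<^sup>2 *\<^sub>R Nl (u p) (J p))"
    by (simp add: Nl_scaleR_left Nl_scaleR_right power2_eq_square)
  then show "BU c (\<lambda>p. a *\<^sub>R u p) (\<lambda>p. a *\<^sub>R J p) q = a\<^sup>2 *\<^sub>R BU c u J q" "BJ c (\<lambda>p. a *\<^sub>R u p) (\<lambda>p. a *\<^sub>R J p) q = a\<^sup>2 *\<^sub>R BJ c u J q"
    unfolding BU_def BJ_def by (simp_all add: duhamel_scaleR[OF kU] duhamel_scaleR[OF kJ])
qed

text \<open>The field is \<open>\<eta> u1 - \<eta>\<^sup>2 BU c u1 J1\<close> up to \<open>O(\<eta>\<^sup>3)\<close>; the quadratic contribution \<open>total g\<close> vanishes in the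
  first component because \<open>g\<close> is odd in \<open>x\<close>.\<close>

lemma total_expansion:
  assumes A1: "pdec A1 u1 J1" "A1 \<ge> 0" and \<eta>: "\<eta> \<ge> 0" and d: "pdec (2 * (\<eta> * A1)) u J"
    and fu: "\<And>p. u p = \<eta> *\<^sub>R u1 p - BU c u J p" and fJ: "\<And>p. J p = \<eta> *\<^sub>R J1 p - BJ c u J p"
  shows "\<bar>total (\<lambda>p. Nl (u p) (J p)) $ 1 + \<eta> ^ 3 * second_order $ 1\<bar> \<le> 2240 * K\<^sup>2 * A1 ^ 4 * \<eta> ^ 4"
proof -
  define A where "A = \<eta> * A1"
  have A: "A \<ge> 0" using A1 \<eta> by (simp add: A_def)
  \<comment> \<open>\<open>\<delta> = K * (2 * A)\<^sup>2\<close> bounds the bilinear map at the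
    solution, and \<open>\<zeta> = K * (2 * A + A) * \<delta>\<close> bounds its change when the
    solution is replaced by the linear flow.\<close>
  define \<delta> where "\<delta> = 4 * K * A\<^sup>2"
  have \<delta>: "\<delta> \<ge> 0" using K_nonneg by (simp add: \<delta>_def)
  define \<zeta> where "\<zeta> = 12 * K\<^sup>2 * A ^ 3"
  have \<zeta>: "\<zeta> \<ge> 0" using A by (simp add: \<zeta>_def)
  define \<beta> where "\<beta> = K * A1 * A1"
  have \<beta>: "\<beta> \<ge> 0" using A1 K_nonneg by (simp add: \<beta>_def)
  let ?b = "BU c u1 J1" and ?bJ = "BJ c u1 J1"
  \<comment> \<open>\<open>w\<close> is the deviation from the linear flow, of order
    \<open>\<eta>\<^sup>2\<close>; adding back the second Picard term leaves \<open>z\<close>, of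
    order \<open>\<eta> ^ 3\<close>.\<close>
  define w wJ where "w p = u p - \<eta> *\<^sub>R u1 p" and "wJ p = J p - \<eta> *\<^sub>R J1 p" for p
  define z zJ where "z p = w p + \<eta>\<^sup>2 *\<^sub>R ?b p" and "zJ p = wJ p + \<eta>\<^sup>2 *\<^sub>R ?bJ p" for p
  have d': "dec (2 * A) u J" and d1: "dec A1 u1 J1" using d A1 by (auto intro!: pdec_imp_dec simp: A_def)
  have db: "dec \<beta> ?b ?bJ" unfolding \<beta>_def by (rule pdec_imp_dec[OF pdec_B[OF d1 d1 A1(2) A1(2)]])
  have e1: "dec A (\<lambda>p. \<eta> *\<^sub>R u1 p) (\<lambda>p. \<eta> *\<^sub>R J1 p)"
    unfolding A_def by (intro pdec_imp_dec pdec_scaleR A1 \<eta>)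
  have w: "w p = - BU c u J p" "wJ p = - BJ c u J p" for p
    using fu[of p] fJ[of p] by (simp_all add: w_def wJ_def)
  have dw: "dec \<delta> w wJ"
    using pdec_uminus[OF pdec_B[OF d' d']] A unfolding w[abs_def] by (intro pdec_imp_dec) (simp add: \<delta>_def power2_eq_square mult_ac)
  have z: "z p = - (BU c u J p - BU c (\<lambda>p. \<eta> *\<^sub>R u1 p) (\<lambda>p. \<eta> *\<^sub>R J1 p) p)"
    "zJ p = - (BJ c u J p - BJ c (\<lambda>p. \<eta> *\<^sub>R u1 p) (\<lambda>p. \<eta> *\<^sub>R J1 p) p)" for p
    by (simp_all add: z_def zJ_def w B_scaleR)
  have "pdec (K * (2 * A + A) * \<delta>) (\<lambda>p. BU c u J p - BU c (\<lambda>p. \<eta> *\<^sub>R u1 p) (\<lambda>p. \<eta> *\<^sub>R J1 p) p)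
      (\<lambda>p. BJ c u J p - BJ c (\<lambda>p. \<eta> *\<^sub>R u1 p) (\<lambda>p. \<eta> *\<^sub>R J1 p) p)"
    using dw A \<delta> by (intro pdec_B_diff d' e1) (auto simp: w_def[abs_def] wJ_def[abs_def])
  from pdec_imp_dec[OF pdec_uminus[OF this]] have "dec (K * (2 * A + A) * \<delta>) z zJ" unfolding z[abs_def] .
  moreover have "K * (2 * A + A) * \<delta> = \<zeta>" by (simp add: \<delta>_def \<zeta>_def power2_eq_square power3_eq_cube)
  ultimately have dz: "dec \<zeta> z zJ" by simp
  \<comment> \<open>Splitting by order: \<open>T1\<close> carries the coefficient of
    \<open>\<eta> ^ 3\<close>, while \<open>\<eta> *\<^sub>R T2\<close> and \<open>T3\<close> are
    both of order \<open>\<eta> ^ 4\<close>.\<close>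
  define T1 where "T1 p = Nl (u1 p) (?bJ p) + Nl (?b p) (J1 p)" for p
  define T2 where "T2 p = Nl (u1 p) (zJ p) + Nl (z p) (J1 p)" for p
  define T3 where "T3 p = Nl (w p) (wJ p)" for p
  have uJ: "u p = \<eta> *\<^sub>R u1 p + w p" "J p = \<eta> *\<^sub>R J1 p + wJ p" and ww: "w p = z p + (- \<eta>\<^sup>2) *\<^sub>R ?b p" "wJ p = zJ p + (- \<eta>\<^sup>2) *\<^sub>R ?bJ p" for p
    by (simp_all add: w_def wJ_def z_def zJ_def)
  have "Nl (u p) (J p) = \<eta>\<^sup>2 *\<^sub>R g p + (\<eta> *\<^sub>R (Nl (u1 p) (wJ p) + Nl (w p) (J1 p)) + T3 p)" for p
    unfolding uJ g_def T3_def by (simp add: Nl_add_left Nl_add_right Nl_scaleR_left Nl_scaleR_right power2_eq_square scaleR_add_right)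
  moreover have "Nl (u1 p) (wJ p) + Nl (w p) (J1 p) = T2 p + (- \<eta>\<^sup>2) *\<^sub>R T1 p" for p
    unfolding ww T1_def T2_def Nl_add_left Nl_add_right Nl_scaleR_left Nl_scaleR_right by (simp add: scaleR_add_right)
  ultimately have N: "Nl (u p) (J p) = \<eta>\<^sup>2 *\<^sub>R g p + ((- (\<eta> ^ 3)) *\<^sub>R T1 p + (\<eta> *\<^sub>R T2 p + T3 p))" for p
    by (simp add: scaleR_add_right scaleR_diff_right power2_eq_square power3_eq_cube)
  obtain B where B: "B \<ge> 0" "source B g" by (rule source_g)
  have s1: "source (14 * A1 * \<beta> + 14 * \<beta> * A1) T1" unfolding T1_def[abs_def] using A1 \<beta> by (intro source_add source_dec[OF d1 db] source_dec[OF db d1]) auto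
  have s2: "source (14 * A1 * \<zeta> + 14 * \<zeta> * A1) T2" unfolding T2_def[abs_def] using A1 \<zeta> by (intro source_add source_dec[OF d1 dz] source_dec[OF dz d1]) auto
  have s3: "source (14 * \<delta> * \<delta>) T3" unfolding T3_def[abs_def] using \<delta> by (intro source_dec[OF dw dw])
  have p: "14 * A1 * \<beta> + 14 * \<beta> * A1 \<ge> 0" "14 * A1 * \<zeta> + 14 * \<zeta> * A1 \<ge> 0" "14 * \<delta> * \<delta> \<ge> 0" using A1 \<beta> \<zeta> \<delta> by auto
  note i = source_total(1)[OF B(2,1)] source_total(1)[OF s1 p(1)] source_total(1)[OF s2 p(2)] source_total(1)[OF s3 p(3)]
  have "total (\<lambda>p. Nl (u p) (J p)) = \<eta>\<^sup>2 *\<^sub>R total g + ((- (\<eta> ^ 3)) *\<^sub>R total T1 + (\<eta> *\<^sub>R total T2 + total T3))"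
  proof -
    have "indicator {0<..} (fst p) *\<^sub>R Nl (u p) (J p) = \<eta>\<^sup>2 *\<^sub>R (indicator {0<..} (fst p) *\<^sub>R g p) + ((- (\<eta> ^ 3)) *\<^sub>R (indicator {0<..} (fst p) *\<^sub>R T1 p)
      + (\<eta> *\<^sub>R (indicator {0<..} (fst p) *\<^sub>R T2 p) + indicator {0<..} (fst p) *\<^sub>R T3 p))" for p
      unfolding N by (auto simp: indicator_def)
    then show ?thesis unfolding total_def
      using i by (simp only: Bochner_Integration.integral_add Bochner_Integration.integrable_add integrable_scaleR_right integral_scaleR_right)
  qed
  moreover have "total T1 = second_order"
    unfolding T1_def[abs_def] second_order_def using A1 \<beta> by (intro total_add[OF source_dec[OF d1 db] source_dec[OF db d1]]) auto
  ultimately have eq: "total (\<lambda>p. Nl (u p) (J p)) $ 1 + \<eta> ^ 3 * second_order $ 1 = \<eta> * total T2 $ 1 + total T3 $ 1"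
    by (simp add: total_g_1)
  \<comment> \<open>\<open>112 = 4 * (14 + 14)\<close> and \<open>56 = 4 * 14\<close>, the
    \<open>4\<close> coming from \<open>source_total\<close>. With
    \<open>\<zeta> = 12 * K\<^sup>2 * A ^ 3\<close> and
    \<open>\<delta>\<^sup>2 = 16 * K\<^sup>2 * A ^ 4\<close> the sum is
    \<open>112 * 12 + 56 * 16 = 2240\<close>.\<close>
  have t2: "\<bar>total T2 $ 1\<bar> \<le> 112 * A1 * \<zeta>" using component_le_norm_cart[of "total T2" 1] source_total(2)[OF s2 p(2)] by (simp add: mult_ac)
  have t3: "\<bar>total T3 $ 1\<bar> \<le> 56 * \<delta>\<^sup>2" using component_le_norm_cart[of "total T3" 1] source_total(2)[OF s3 p(3)] by (simp add: power2_eq_square)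
  have "\<bar>\<eta> * total T2 $ 1\<bar> \<le> \<eta> * (112 * A1 * \<zeta>)" unfolding abs_mult using t2 \<eta> by (simp add: mult_left_mono)
  then have "\<bar>\<eta> * total T2 $ 1 + total T3 $ 1\<bar> \<le> \<eta> * (112 * A1 * \<zeta>) + 56 * \<delta>\<^sup>2" using t3 by linarith
  also have "\<dots> = 2240 * K\<^sup>2 * A1 ^ 4 * \<eta> ^ 4"
    by (simp add: \<zeta>_def \<delta>_def A_def power2_eq_square power3_eq_cube power4_eq_xxxx algebra_simps)
  finally show ?thesis unfolding eq .
qed

end

section \<open>Smallness thresholds and conclusion\<close>

theorem mainTheorem3:
  fixes \<epsilon> :: real
  assumes "\<epsilon> > 0"
  shows "\<exists>r>0. \<exists>\<eta>\<^sub>0>0. \<forall>\<eta>. 0 < \<eta> \<and> \<eta> < \<eta>\<^sub>0 \<longrightarrow>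
    (\<exists>u. mild_solution_in_ball \<epsilon> (initial_field \<eta>) r u \<and>
         (\<forall>v. mild_solution_in_ball \<epsilon> (initial_field \<eta>) r v \<longrightarrow>
              (\<forall>t\<ge>0. AE x in lborel. v t x = u t x)) \<and>
         (\<exists>lam :: real^3. ((\<lambda>t. LINT x|lborel. u t x) \<longlongrightarrow> lam) at_top \<and>
              lam \<noteq> 0 \<and> lam $ 1 > 0))"
proof -
  have c: "1 + 1 / \<epsilon> \<ge> 1" using assms by simp
  obtain C where C: "bilin (1 + 1 / \<epsilon>) C" using bilin_exists[OF c] by blast
  interpret bilin "1 + 1 / \<epsilon>" C by (rule C)
  obtain A1 where A1: "A1 \<ge> 0" "pdec A1 u1 J1" using pdec_u1 by blast
  \<comment> \<open>The radius is dictated by uniqueness, \<open>4 * K * r \<le> 1\<close>, and is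
    chosen before \<open>\<eta>\<close>; the added \<open>1\<close> covers
    \<open>K = 0\<close>.\<close>
  define r where "r = 1 / (4 * K + 1)"
  have r: "r > 0" "4 * K * r \<le> 1" using K_nonneg by (auto simp: r_def divide_simps)
  define M where "M = 2240 * K\<^sup>2 * A1 ^ 4"
  have M: "M \<ge> 0" using A1 by (simp add: M_def)
  \<comment> \<open>Three demands on \<open>\<eta>\<close>: contraction of the Picard iteration, the
    fixed point lying in the ball of radius \<open>r\<close>, and the remainder
    \<open>M * \<eta> ^ 4\<close> staying below the main term
    \<open>\<eta> ^ 3 * second_order $ 1\<close>. The added \<open>1\<close>s keep the denominators
    positive.\<close>
  define \<eta>0 where "\<eta>0 = Min {1 / (8 * K * A1 + 1), r / (8 * A1 + 1), second_order $ 1 / (M + 1)}"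
  have \<eta>0: "\<eta>0 > 0"
    unfolding \<eta>0_def using K_nonneg A1(1) r(1) M second_order_1_pos by (auto intro!: divide_pos_pos add_nonneg_pos)
  have "\<exists>u. mild_solution_in_ball \<epsilon> (initial_field \<eta>) r u \<and>
         (\<forall>v. mild_solution_in_ball \<epsilon> (initial_field \<eta>) r v \<longrightarrow> (\<forall>t\<ge>0. AE x in lborel. v t x = u t x)) \<and>
         (\<exists>lam :: real^3. ((\<lambda>t. LINT x|lborel. u t x) \<longlongrightarrow> lam) at_top \<and> lam \<noteq> 0 \<and> lam $ 1 > 0)"
    if \<eta>: "0 < \<eta>" "\<eta> < \<eta>0" for \<eta>
  proof -
    have lt: "\<eta> < 1 / (8 * K * A1 + 1)" "\<eta> < r / (8 * A1 + 1)" "\<eta> < second_order $ 1 / (M + 1)"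
      using \<eta>(2) by (auto simp: \<eta>0_def)
    have pos: "8 * K * A1 + 1 > 0" "8 * A1 + 1 > 0" "M + 1 > 0" using K_nonneg A1(1) M by (auto intro!: add_nonneg_pos)
    have small: "8 * K * (\<eta> * A1) \<le> 1" "4 * (2 * (\<eta> * A1)) \<le> r" "\<eta> * M < second_order $ 1"
      using lt[unfolded pos_less_divide_eq[OF pos(1)]] lt[unfolded pos_less_divide_eq[OF pos(2)]] lt[unfolded pos_less_divide_eq[OF pos(3)]] \<eta>(1)
      by (auto simp: algebra_simps)
    have A: "\<eta> * A1 \<ge> 0" using \<eta> A1(1) by simp
    obtain u J where d: "pdec (2 * (\<eta> * A1)) u J" and fu: "\<And>p. u p = \<eta> *\<^sub>R u1 p - BU (1 + 1 / \<epsilon>) u J p"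
      and fJ: "\<And>p. J p = \<eta> *\<^sub>R J1 p - BJ (1 + 1 / \<epsilon>) u J p"
      using fixpoint_exists[OF pdec_scaleR[OF A1(2)] A small(1)] \<eta>(1) by (metis less_imp_le)
    have d': "dec (2 * (\<eta> * A1)) u J" by (rule pdec_imp_dec[OF d])
    have A2: "0 \<le> 2 * (\<eta> * A1)" using A by simp
    define U where "U = (\<lambda>t x. if t > 0 then u (t, x) else initial_field \<eta> x)"
    have "mild_solution_in_ball \<epsilon> (initial_field \<eta>) r U"
      unfolding U_def by (rule mild_solution_exists[OF C assms d' A2 small(2) fu fJ])
    moreover have "AE x in lborel. v t x = U t x" if "mild_solution_in_ball \<epsilon> (initial_field \<eta>) r v" "t \<ge> 0" for v t
    proof -
      have "dec r u J" by (rule dec_mono[OF d']) (use small(2) A in linarith)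
      then show ?thesis unfolding U_def
        using mild_solution_unique[OF C assms _ _ r(2) fu fJ that] r(1) by simp
    qed
    moreover have "((\<lambda>t. LINT x|lborel. U t x) \<longlongrightarrow> - total (\<lambda>p. Nl (u p) (J p))) at_top"
      by (rule integral_tendsto[OF d' A2 fu]) (simp add: U_def)
    moreover have "(- total (\<lambda>p. Nl (u p) (J p))) $ 1 > 0"
    proof -
      have "\<bar>total (\<lambda>p. Nl (u p) (J p)) $ 1 + \<eta> ^ 3 * second_order $ 1\<bar> \<le> M * \<eta> ^ 4"
        unfolding M_def using total_expansion[OF A1(2,1) _ d fu fJ] \<eta>(1) by simp
      moreover have "M * \<eta> ^ 4 < \<eta> ^ 3 * second_order $ 1"
      proof -
        have "M * \<eta> ^ 4 = \<eta> ^ 3 * (\<eta> * M)" by (simp add: power3_eq_cube power4_eq_xxxx)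
        also have "\<dots> < \<eta> ^ 3 * second_order $ 1" using small(3) \<eta>(1) by simp
        finally show ?thesis .
      qed
      ultimately show ?thesis by simp
    qed
    moreover from this have "- total (\<lambda>p. Nl (u p) (J p)) \<noteq> 0" by auto
    ultimately show ?thesis by blast
  qed
  then show ?thesis using r(1) \<eta>0 by blast
qed

end
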